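(* Let $N\ge 3$, let $0\le u_0\in L^1(\mathbb{R}^N)\cap L^\infty(\mathbb{R}^N)$ with $u_0=0$ in $\mathcal{H}$, let $u$ be the solution of the nonlocal problem with initial datum $u_0$, let $\phi$ be the solution of the stationary problem, and let $M^*=\int_{\mathbb{R}^N}u_0(x)\phi(x)\,dx$. Then $$t^{N/2}\,|u(x,t)-M^*\phi(x)\Gamma_\alpha(x,t)|\to 0\quad\text{as } t\to\infty,\ \text{uniformly in } x\in\mathbb{R}^N$$ (that is, $t^{N/2}\|u(\cdot,t)-M^*\phi\,\Gamma_\alpha(\cdot,t)\|_{L^\infty(\mathbb{R}^N)}\to0$ as $t\to\infty$).
   Context: Setting: $N\ge 3$; $\mathcal{H}\subset\mathbb{R}^N$ is a bounded open set with smooth boundary (not necessarily connected), $0\in\mathcal{H}$, and $\Omega=\mathbb{R}^N\setminus\mathcal{H}$. The kernel $J:\mathbb{R}^N\to[0,\infty)$ is smooth, radially symmetric, compactly supported in the unit ball centered at the origin, with $J(0)>0$ and $\int_{\mathbb{R}^N}J=1$. Nonlocal problem: $\partial_t u(x,t)=\int_{\mathbb{R}^N}J(x-y)(u(y,t)-u(x,t))\,dy$ in $\Omega\times(0,\infty)$, $u=0$ in $\mathcal{H}\times(0,\infty)$, $u(\cdot,0)=u_0$. A solution is a function $u\in C([0,\infty);L^1(\mathbb{R}^N))$ such that for all $t>0$, $u(\cdot,t)=u_0+\int_0^t(J*u(\cdot,s)-u(\cdot,s))\,ds$ a.e. in $\Omega$ and $u(\cdot,t)=0$ a.e. in $\mathcal{H}$;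 it exists and is unique. Stationary problem: $\phi\in L^1_{\rm loc}(\mathbb{R}^N)$ is the unique solution of $J*\phi=\phi$ in $\Omega$, $\phi=0$ in $\mathcal{H}$, $\phi(x)\to1$ as $|x|\to\infty$. Heat kernel: $\alpha=\frac1{2N}\int_{\mathbb{R}^N}|z|^2J(z)\,dz$ and $\Gamma_\alpha(x,t)=(4\pi\alpha t)^{-N/2}e^{-|x|^2/(4\alpha t)}$. *)

theory Defs
  imports "HOL-Probability.Essential_Supremum"
begin

primrec C_k :: "nat \<Rightarrow> ('a::real_normed_vector \<Rightarrow> real) \<Rightarrow> bool" where
  "C_k 0 f \<longleftrightarrow> continuous_on UNIV f"
| "C_k (Suc k) f \<longleftrightarrow>
     f differentiable_on UNIV \<and> (\<forall>v. C_k k (\<lambda>x. frechet_derivative f (at x) v))"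

definition smooth :: "('a::real_normed_vector \<Rightarrow> real) \<Rightarrow> bool" where
  "smooth f \<longleftrightarrow> (\<forall>k. C_k k f)"

(* Near each boundary point, H is the strict epigraph, in the direction nu, of a smooth
   function on the hyperplane orthogonal to nu. That function is given by g, of which only
   the values on this hyperplane matter: x - (x . nu) nu is the projection of x to it. *)
definition smooth_boundary :: "'a::euclidean_space set \<Rightarrow> bool" where
  "smooth_boundary H \<longleftrightarrow>
     (\<forall>p\<in>frontier H. \<exists>r>0. \<exists>\<nu> g. norm \<nu> = 1 \<and> smooth g \<and>
        H \<inter> ball p r = {x \<in> ball p r. g (x - (x \<bullet> \<nu>) *\<^sub>R \<nu>) < x \<bullet> \<nu>})"

definition nonlocal_kernel :: "('a::euclidean_space \<Rightarrow> real) \<Rightarrow> bool" where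
  "nonlocal_kernel J \<longleftrightarrow>
     (\<forall>z. 0 \<le> J z) \<and> smooth J \<and> (\<forall>y z. norm y = norm z \<longrightarrow> J y = J z) \<and>
     closure {z. J z \<noteq> 0} \<subseteq> cball 0 1 \<and> 0 < J 0 \<and>
     integrable lebesgue J \<and> (LINT z|lebesgue. J z) = 1"

definition conv :: "('a::euclidean_space \<Rightarrow> real) \<Rightarrow> ('a \<Rightarrow> real) \<Rightarrow> 'a \<Rightarrow> real" where
  "conv J f x = (LINT y|lebesgue. J (x - y) * f y)"

definition L1_continuous_on :: "real set \<Rightarrow> (real \<Rightarrow> 'a::euclidean_space \<Rightarrow> real) \<Rightarrow> bool" where
  "L1_continuous_on T u \<longleftrightarrow>
     (\<forall>t\<in>T. integrable lebesgue (u t)) \<and>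
     (\<forall>t\<in>T. ((\<lambda>s. LINT x|lebesgue. \<bar>u s x - u t x\<bar>) \<longlongrightarrow> 0) (at t within T))"

(* The integral over [a,b] of an L^1-valued function g, with value the class of G: this is
   (g has_integral G) {a..b} unfolded, with convergence of the tagged sums in the L^1 norm.
   For continuous g it is the vector-valued Riemann (hence Bochner) integral. Unlike a
   pointwise integral of s |-> g s x it does not depend on the representative chosen at each
   time s, so no joint measurability of g is needed. *)
definition has_L1_integral ::
    "(real \<Rightarrow> 'a::euclidean_space \<Rightarrow> real) \<Rightarrow> ('a \<Rightarrow> real) \<Rightarrow> real \<Rightarrow> real \<Rightarrow> bool" where
  "has_L1_integral g G a b \<longleftrightarrow>
     integrable lebesgue G \<and>
     ((\<lambda>p. LINT x|lebesgue. \<bar>(\<Sum>(s, K)\<in>p. measure lborel K * g s x) - G x\<bar>) \<longlongrightarrow> 0)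
       (division_filter {a..b})"

definition nonlocal_solution ::
    "('a::euclidean_space \<Rightarrow> real) \<Rightarrow> 'a set \<Rightarrow> ('a \<Rightarrow> real) \<Rightarrow> (real \<Rightarrow> 'a \<Rightarrow> real) \<Rightarrow> bool" where
  "nonlocal_solution J H u0 u \<longleftrightarrow>
     L1_continuous_on {0..} u \<and>
     (\<forall>t>0.
        (\<exists>G. has_L1_integral (\<lambda>s x. conv J (u s) x - u s x) G 0 t \<and>
             (AE x in lebesgue. x \<in> - H \<longrightarrow> u t x = u0 x + G x)) \<and>
        (AE x in lebesgue. x \<in> H \<longrightarrow> u t x = 0))"

definition L1_loc :: "('a::euclidean_space \<Rightarrow> real) \<Rightarrow> bool" where
  "L1_loc f \<longleftrightarrow> (\<forall>K. compact K \<longrightarrow> set_integrable lebesgue K f)"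

(* phi is an L^1_loc class, so all conditions, including the limit, are read almost everywhere. *)
definition stationary_solution ::
    "('a::euclidean_space \<Rightarrow> real) \<Rightarrow> 'a set \<Rightarrow> ('a \<Rightarrow> real) \<Rightarrow> bool" where
  "stationary_solution J H \<phi> \<longleftrightarrow>
     L1_loc \<phi> \<and>
     (AE x in lebesgue. x \<in> - H \<longrightarrow> conv J \<phi> x = \<phi> x) \<and>
     (AE x in lebesgue. x \<in> H \<longrightarrow> \<phi> x = 0) \<and>
     (\<forall>e>0. \<exists>R. AE x in lebesgue. R < norm x \<longrightarrow> \<bar>\<phi> x - 1\<bar> < e)"

definition diffusivity :: "('a::euclidean_space \<Rightarrow> real) \<Rightarrow> real" where
  "diffusivity J = 1 / (2 * real DIM('a)) * (LINT z|lebesgue. (norm z)\<^sup>2 * J z)"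

definition heat_kernel :: "real \<Rightarrow> 'a::euclidean_space \<Rightarrow> real \<Rightarrow> real" where
  "heat_kernel \<alpha> x t =
     (4 * pi * \<alpha> * t) powr (- real DIM('a) / 2) * exp (- (norm x)\<^sup>2 / (4 * \<alpha> * t))"

end

theory Submission
  imports Defs "HOL-Probability.Probability" "HOL-Real_Asymp.Real_Asymp"
begin

text \<open>
  Write \<open>A f = J * f\<close> and let \<open>T\<close> be \<open>A\<close> compressed to the complement \<open>W\<close> of the hole.
  The equation reads \<open>u' = T u - u\<close>, so \<open>u(t)\<close> is the average of \<open>T^n u0\<close> over a Poisson variable
  \<open>n\<close> of mean \<open>t\<close>: the density of a random walk with jump law \<open>J\<close> and exponential waiting times,
  killed when it enters the hole. Let \<open>S(t)\<close> and \<open>K(t)\<close> be the free and the killed semigroup. The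
  stationary profile \<open>\<phi>\<close> is a fixed point of \<open>K(t)\<close> with values in \<open>[0,1]\<close>: it is the probability of
  never being killed. Put \<open>p = N/2\<close>, and let \<open>\<Gamma>\<close> be the heat kernel.

  Everything is reduced to two facts on the free walk, the local limit theorem
  (\<open>free_local_limit\<close>), which says that \<open>t^p (S(t) f - (\<integral>f) \<Gamma>(t))\<close> tends to 0 uniformly, and the
  smoothing estimate (\<open>free_smoothing\<close>), which bounds \<open>t^p S(t) f\<close> by a multiple of the L1 norm of \<open>f\<close>, up to an
  exponentially small term. Both come from the Fourier representation \<open>heat_representation\<close>. The
  only delicate point there is integrability of the symbol: the part of the walk with at least two
  jumps has a symbol dominated by the square of the transform of \<open>J\<close>, and that square is integrable
  because \<open>J * J\<close> is bounded.

  The mass \<open>m(s) = \<integral>u(s)\<close> decreases to \<open>M = \<integral>u0 \<phi>\<close>: the integral of \<open>u(s) \<phi>\<close> is conserved by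
  symmetry of \<open>T\<close>, and where \<open>\<phi>\<close> is far from 1, that is on a bounded set, \<open>u(s)\<close> tends to 0
  (\<open>mass_limit\<close>).

  Far from the hole (\<open>outer_limit\<close>), \<open>u(t) = K(t/2) u(t/2)\<close> is compared with \<open>S(t/2) u(t/2)\<close>. By
  positivity the difference is at most \<open>sup u(t/2)\<close> times the probability of being killed, which is
  at most \<open>1 - \<phi>\<close>; hence it is \<open>t^(-p)\<close> times a quantity that is small at infinity. In turn
  \<open>u(t/2)\<close> differs from \<open>S(t/2 - k) u(k)\<close> in L1 by at most \<open>m(k) - M\<close>, small for large \<open>k\<close>, so smoothing
  and the local limit theorem give \<open>u(t) \<approx> m(k) \<Gamma>(t) \<approx> M \<Gamma>(t)\<close>.

  Near the hole (\<open>inner_limit\<close>), \<open>\<Gamma>(t)\<close> is nearly a constant \<open>c t^(-p)\<close>. The difference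
  \<open>u(t) - M c t^(-p) \<phi>\<close> is the image under \<open>K(k)\<close> of the same difference at time \<open>t - k\<close>, with the
  same factor \<open>t^(-p)\<close>, because \<open>\<phi>\<close> is a fixed point. The earlier difference is small on an annulus by the
  estimate far from the hole, and bounded by a multiple of \<open>t^(-p)\<close> elsewhere. The walk of fixed duration \<open>k\<close> is
  unlikely to end in the inner ball if \<open>k\<close> is large, and unlikely to leave the outer one.

  The two estimates are combined in \<open>killed_asymptotics\<close>. It remains to identify the given objects: \<open>solution_is_heat\<close> shows that
  every solution is the killed semigroup, by expanding its pairings with bounded functions in a Taylor
  series, and \<open>stationary_representative\<close> shows that every stationary solution has a version with the properties
  of a survival probability. Its bounds hold because a bounded fixed point of \<open>K(t)\<close>
  that is at most \<open>c\<close> at infinity is at most \<open>c\<close> everywhere: the walk leaves every ball.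
\<close>

section \<open>Poisson averages\<close>

lemma poisson_expectation_sums:
  fixes h :: "nat \<Rightarrow> real"
  assumes t: "0 < t" and h: "\<And>n. \<bar>h n\<bar> \<le> C"
  shows "(\<lambda>n. t ^ n / fact n * exp (- t) * h n) sums measure_pmf.expectation (poisson_pmf t) h"
proof -
  have int: "integrable (measure_pmf (poisson_pmf t)) h"
    using h by (intro measure_pmf.integrable_const_bound[where B=C]) auto
  have eq: "measure_pmf (poisson_pmf t) = density (count_space UNIV) (\<lambda>n. ennreal (pmf (poisson_pmf t) n))"
    by (rule measure_pmf_eq_density)
  have int2: "integrable (count_space UNIV) (\<lambda>n. pmf (poisson_pmf t) n *\<^sub>R h n)"
    using int unfolding eq by (subst (asm) integrable_density) auto
  have "measure_pmf.expectation (poisson_pmf t) h = (\<integral>n. pmf (poisson_pmf t) n *\<^sub>R h n \<partial>count_space UNIV)"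
    unfolding eq by (subst integral_density) auto
  then show ?thesis
    using sums_integral_count_space_nat[OF int2] t by simp
qed

text \<open>The convolution of two Poisson laws is the binomial theorem; it is what makes the walk a semigroup.\<close>

lemma poisson_add:
  assumes "0 < s" "0 < t"
  shows "bind_pmf (poisson_pmf s) (\<lambda>m. map_pmf (\<lambda>n. m + n) (poisson_pmf t)) = poisson_pmf (s + t)"
proof (rule pmf_eqI)
  fix j :: nat
  have p: "pmf (map_pmf (\<lambda>n. m + n) (poisson_pmf t)) j
      = (if m \<le> j then t ^ (j - m) / fact (j - m) * exp (- t) else 0)" for m
  proof (cases "m \<le> j")
    case True
    have "pmf (map_pmf (\<lambda>n. m + n) (poisson_pmf t)) (m + (j - m)) = pmf (poisson_pmf t) (j - m)"
      by (rule pmf_map_inj') (auto simp: inj_on_def)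
    then show ?thesis using True assms by simp
  next
    case False
    then show ?thesis by (auto simp: pmf_eq_0_set_pmf)
  qed
  have "pmf (bind_pmf (poisson_pmf s) (\<lambda>m. map_pmf (\<lambda>n. m + n) (poisson_pmf t))) j
     = (\<Sum>m\<le>j. (t ^ (j - m) / fact (j - m) * exp (- t)) * (s ^ m / fact m * exp (- s)))"
    unfolding pmf_bind p
    by (subst integral_measure_pmf_real[where A="{..j}"]) (use assms in \<open>auto intro!: sum.cong split: if_splits\<close>)
  also have "\<dots> = (\<Sum>m\<le>j. exp (- (s + t)) / fact j * (of_nat (j choose m) * s ^ m * t ^ (j - m)))"
  proof (rule sum.cong[OF refl])
    fix m assume "m \<in> {..j}"
    then have "real (j choose m) = fact j / (fact m * fact (j - m))"
      by (simp add: binomial_fact)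
    then show "(t ^ (j - m) / fact (j - m) * exp (- t)) * (s ^ m / fact m * exp (- s))
       = exp (- (s + t)) / fact j * (of_nat (j choose m) * s ^ m * t ^ (j - m))"
      by (simp add: exp_add exp_diff field_simps exp_minus)
  qed
  also have "\<dots> = exp (- (s + t)) / fact j * (s + t) ^ j"
    unfolding sum_distrib_left[symmetric] by (simp add: binomial_ring)
  finally show "pmf (bind_pmf (poisson_pmf s) (\<lambda>m. map_pmf (\<lambda>n. m + n) (poisson_pmf t))) j = pmf (poisson_pmf (s + t)) j"
    using assms by simp
qed

lemma poisson_expectation_add:
  fixes h :: "nat \<Rightarrow> real"
  assumes "0 < s" "0 < t" "\<And>n. \<bar>h n\<bar> \<le> C"
  shows "measure_pmf.expectation (poisson_pmf s) (\<lambda>m. measure_pmf.expectation (poisson_pmf t) (\<lambda>n. h (m + n)))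
    = measure_pmf.expectation (poisson_pmf (s + t)) h"
proof -
  have "measure_pmf.expectation (bind_pmf (poisson_pmf s) (\<lambda>m. map_pmf (\<lambda>n. m + n) (poisson_pmf t))) h
     = measure_pmf.expectation (poisson_pmf s) (\<lambda>m. measure_pmf.expectation (map_pmf (\<lambda>n. m + n) (poisson_pmf t)) h)"
    unfolding measure_pmf_bind
    by (rule integral_bind[where K="count_space UNIV" and B=C and B'=1])
       (use assms in \<open>auto simp: measure_pmf.emeasure_space_1 intro: measure_pmf_in_subprob_algebra simp del: emeasure_map_pmf\<close>)
  then show ?thesis using assms by (simp add: poisson_add)
qed

section \<open>Bounded Borel functions\<close>

text \<open>The bound is an argument and holds everywhere, not almost everywhere: iterates of the operators below are then defined pointwise, and the same bound serves for all of them.\<close>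

definition bbound :: "('a::euclidean_space \<Rightarrow> real) \<Rightarrow> real \<Rightarrow> bool" where
  "bbound f B \<longleftrightarrow> f \<in> borel_measurable borel \<and> (\<forall>x. \<bar>f x\<bar> \<le> B)"

lemma bboundD: assumes "bbound f B" shows "f \<in> borel_measurable borel" "\<bar>f x\<bar> \<le> B" "f x \<le> B" "- B \<le> f x"
  using assms by (auto simp: bbound_def abs_le_iff) (meson minus_le_iff)

lemma bbound_nonneg: "bbound f B \<Longrightarrow> 0 \<le> B"
  using abs_ge_zero order_trans unfolding bbound_def by blast

lemma bbound_add: "bbound f B \<Longrightarrow> bbound g C \<Longrightarrow> bbound (\<lambda>x. f x + g x) (B + C)"
  by (auto simp: bbound_def intro: order_trans[OF abs_triangle_ineq] add_mono)

lemma bbound_diff: "bbound f B \<Longrightarrow> bbound g C \<Longrightarrow> bbound (\<lambda>x. f x - g x) (B + C)"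
  by (auto simp: bbound_def intro: order_trans[OF abs_triangle_ineq4] add_mono)

lemma bbound_cmult: "bbound f B \<Longrightarrow> bbound (\<lambda>x. c * f x) (\<bar>c\<bar> * B)"
  by (auto simp: bbound_def abs_mult mult_left_mono)

lemma bbound_const: "bbound (\<lambda>x. c) \<bar>c\<bar>"
  by (auto simp: bbound_def)

lemma bbound_indicator: "S \<in> sets borel \<Longrightarrow> bbound (indicator S) 1"
  by (auto simp: bbound_def indicator_def)

lemma bbound_mult: "bbound f B \<Longrightarrow> bbound g C \<Longrightarrow> bbound (\<lambda>x. f x * g x) (B * C)"
  by (auto simp: bbound_def abs_mult intro!: mult_mono order_trans[OF abs_ge_zero])

lemma integrable_mult_bbound:
  assumes "integrable lborel f" "bbound g B"
  shows "integrable lborel (\<lambda>x. f x * g x)" "integrable lborel (\<lambda>x. g x * f x)"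
proof -
  have [measurable]: "f \<in> borel_measurable borel" "g \<in> borel_measurable borel"
    using assms bboundD borel_measurable_integrable by auto
  have "0 \<le> B" using assms bbound_nonneg by auto
  show 1: "integrable lborel (\<lambda>x. f x * g x)"
    by (rule Bochner_Integration.integrable_bound[where f="\<lambda>x. B * \<bar>f x\<bar>"])
       (use assms \<open>0 \<le> B\<close> in \<open>auto simp: bbound_def abs_mult mult.commute[of B] intro!: mult_left_mono\<close>)
  then show "integrable lborel (\<lambda>x. g x * f x)" by (simp add: mult.commute)
qed

lemma integral_mult_bbound_le:
  assumes f: "integrable lborel f" and g: "bbound g B"
  shows "\<bar>LINT x|lborel. f x * g x\<bar> \<le> B * (LINT x|lborel. \<bar>f x\<bar>)"
proof -
  have "\<bar>LINT x|lborel. f x * g x\<bar> \<le> (LINT x|lborel. \<bar>f x * g x\<bar>)"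
    using integral_norm_bound[of lborel "\<lambda>x. f x * g x"] by simp
  also have "\<dots> \<le> (LINT x|lborel. B * \<bar>f x\<bar>)"
  proof (rule integral_mono)
    show "integrable lborel (\<lambda>x. \<bar>f x * g x\<bar>)" by (rule integrable_abs[OF integrable_mult_bbound(1)[OF f g]])
    show "integrable lborel (\<lambda>x. B * \<bar>f x\<bar>)" using f by simp
    show "\<bar>f x * g x\<bar> \<le> B * \<bar>f x\<bar>" for x
      using mult_left_mono[OF bboundD(2)[OF g, of x], of "\<bar>f x\<bar>"] by (simp add: abs_mult mult.commute)
  qed
  finally show ?thesis by simp
qed

section \<open>Symmetric sub-Markov kernels and their continuous-time walks\<close>

text \<open>The free walk and the killed walk are the two instances. Their transition operators contract both L1 and the bounded functions, and symmetry makes the two actions dual to each other.\<close>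

locale symmetric_kernel =
  fixes k :: "'a::euclidean_space \<Rightarrow> 'a \<Rightarrow> real"
  assumes kernel_measurable [measurable]: "case_prod k \<in> borel_measurable (borel \<Otimes>\<^sub>M borel)"
    and kernel_nonneg: "0 \<le> k x y"
    and kernel_sym: "k x y = k y x"
    and kernel_integrable: "integrable lborel (k x)"
    and kernel_mass: "(LINT y|lborel. k x y) \<le> 1"
begin

definition step :: "('a \<Rightarrow> real) \<Rightarrow> 'a \<Rightarrow> real" where
  "step f x = (LINT y|lborel. k x y * f y)"

text \<open>The solution operator \<open>exp(t (step - 1))\<close>, read as an expectation over the number of jumps.\<close>

definition heat :: "real \<Rightarrow> ('a \<Rightarrow> real) \<Rightarrow> 'a \<Rightarrow> real" where
  "heat t f x = measure_pmf.expectation (poisson_pmf t) (\<lambda>n. (step ^^ n) f x)"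

lemma kernel_borel [measurable]: "k x \<in> borel_measurable borel"
  using kernel_measurable by measurable

lemma integrable_step:
  assumes "bbound f B" shows "integrable lborel (\<lambda>y. k x y * f y)"
  using integrable_mult_bbound[OF kernel_integrable assms] by auto

lemma bbound_step:
  assumes "bbound f B" shows "bbound (step f) B"
proof -
  have [measurable]: "f \<in> borel_measurable borel" using assms bboundD by auto
  have "\<bar>step f x\<bar> \<le> B" for x
  proof -
    have "\<bar>step f x\<bar> \<le> B * (LINT y|lborel. \<bar>k x y\<bar>)"
      unfolding step_def by (rule integral_mult_bbound_le) (use kernel_integrable assms in auto)
    also have "\<dots> \<le> B * 1"
      using kernel_mass[of x] bbound_nonneg[OF assms] by (intro mult_left_mono) (auto simp: kernel_nonneg)
    finally show ?thesis by simp
  qed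
  moreover have "step f \<in> borel_measurable borel"
    unfolding step_def[abs_def] by (rule lborel.borel_measurable_lebesgue_integral) measurable
  ultimately show ?thesis by (auto simp: bbound_def)
qed

lemma bbound_steps: "bbound f B \<Longrightarrow> bbound ((step ^^ n) f) B"
  by (induction n) (auto intro: bbound_step)

lemma step_diff: "bbound f B \<Longrightarrow> bbound g C \<Longrightarrow> step (\<lambda>x. f x - g x) x = step f x - step g x"
  unfolding step_def by (simp add: right_diff_distrib integrable_step)

lemma step_cmult: "step (\<lambda>x. c * f x) x = c * step f x"
  unfolding step_def by (simp add: mult.left_commute)

lemma step_mono:
  assumes "bbound f B" "bbound g C" "\<And>x. f x \<le> g x" shows "step f x \<le> step g x"
  unfolding step_def
  by (rule integral_mono) (use assms in \<open>auto intro!: integrable_step mult_left_mono kernel_nonneg\<close>)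

lemma step_nonneg: "(\<And>x. 0 \<le> f x) \<Longrightarrow> 0 \<le> step f x"
  unfolding step_def by (rule integral_nonneg_AE) (auto simp: kernel_nonneg)

lemma steps_diff:
  assumes "bbound f B" "bbound g C"
  shows "(step ^^ n) (\<lambda>x. f x - g x) = (\<lambda>x. (step ^^ n) f x - (step ^^ n) g x)"
  by (induction n) (auto simp: step_diff[OF bbound_steps[OF assms(1)] bbound_steps[OF assms(2)]])

lemma steps_cmult: "(step ^^ n) (\<lambda>x. c * f x) = (\<lambda>x. c * (step ^^ n) f x)"
  by (induction n) (auto simp: step_cmult)

lemma steps_mono:
  assumes "bbound f B" "bbound g C" "\<And>x. f x \<le> g x" shows "(step ^^ n) f x \<le> (step ^^ n) g x"
proof (induction n arbitrary: x)
  case (Suc n)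
  then show ?case using step_mono[OF bbound_steps[OF assms(1)] bbound_steps[OF assms(2)]] by auto
qed (use assms in auto)

lemma steps_nonneg: "(\<And>x. 0 \<le> f x) \<Longrightarrow> 0 \<le> (step ^^ n) f x"
  by (induction n arbitrary: x) (auto simp: step_nonneg)

lemma integrable_kernel_product:
  assumes f: "integrable lborel f" and g: "bbound g B"
  shows "integrable (lborel \<Otimes>\<^sub>M lborel) (\<lambda>(x, y). f x * (k x y * g y))"
proof -
  have [measurable]: "f \<in> borel_measurable borel" "g \<in> borel_measurable borel"
    using assms bboundD borel_measurable_integrable by auto
  note B = bbound_nonneg[OF g]
  have ag: "bbound (\<lambda>y. \<bar>g y\<bar>) B" using g by (auto simp: bbound_def)
  have eq: "(LINT y|lborel. norm (f x * (k x y * g y))) = \<bar>f x\<bar> * step (\<lambda>y. \<bar>g y\<bar>) x" for x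
    unfolding step_def by (simp add: abs_mult kernel_nonneg)
  show ?thesis
  proof (rule lborel_pair.Fubini_integrable)
    show "integrable lborel (\<lambda>x. LINT y|lborel. norm (case (x, y) of (x, y) \<Rightarrow> f x * (k x y * g y)))"
      using integrable_mult_bbound(1)[OF integrable_abs[OF f] bbound_step[OF ag]] by (simp add: eq[simplified])
    show "AE x in lborel. integrable lborel (\<lambda>y. case (x, y) of (x, y) \<Rightarrow> f x * (k x y * g y))"
      using integrable_step[OF g] by (intro AE_I2) auto
  qed measurable
qed

lemma integrable_step_L1:
  assumes f: "integrable lborel f"
  shows "integrable lborel (step f)"
proof -
  have "integrable (lborel \<Otimes>\<^sub>M lborel) (\<lambda>(x, y). f x * (k x y * 1))"
    using integrable_kernel_product[OF f bbound_const[of 1]] by simp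
  from lborel_pair.integrable_snd[OF this] have "integrable lborel (\<lambda>y. LINT x|lborel. f x * (k x y * 1))" .
  moreover have "(\<lambda>y. LINT x|lborel. f x * (k x y * 1)) = step f"
    unfolding step_def[abs_def] by (subst kernel_sym) (simp add: mult.commute)
  ultimately show ?thesis by simp
qed

lemma step_symmetric:
  assumes f: "integrable lborel f" and g: "bbound g B"
  shows "(LINT x|lborel. step f x * g x) = (LINT x|lborel. f x * step g x)"
proof -
  have "(LINT y|lborel. (LINT x|lborel. f x * (k x y * g y))) = (LINT x|lborel. (LINT y|lborel. f x * (k x y * g y)))"
    by (rule lborel_pair.Fubini_integral) (rule integrable_kernel_product[OF assms])
  moreover have "(\<lambda>y. LINT x|lborel. f x * (k x y * g y)) = (\<lambda>y. step f y * g y)"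
  proof
    fix y
    have "step f y * g y = (LINT x|lborel. k y x * f x * g y)"
      unfolding step_def by simp
    also have "\<dots> = (LINT x|lborel. f x * (k x y * g y))"
      by (subst kernel_sym) (simp add: mult_ac)
    finally show "(LINT x|lborel. f x * (k x y * g y)) = step f y * g y" by simp
  qed
  moreover have "(\<lambda>x. LINT y|lborel. f x * (k x y * g y)) = (\<lambda>x. f x * step g x)"
    unfolding step_def by simp
  ultimately show ?thesis by simp
qed

lemma integrable_steps_L1: "integrable lborel f \<Longrightarrow> integrable lborel ((step ^^ n) f)"
  by (induction n) (auto intro: integrable_step_L1)

lemma steps_symmetric:
  assumes f: "integrable lborel f" and g: "bbound g B"
  shows "(LINT x|lborel. (step ^^ n) f x * g x) = (LINT x|lborel. f x * (step ^^ n) g x)"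
  using g
proof (induction n arbitrary: g)
  case (Suc n)
  have "(LINT x|lborel. (step ^^ Suc n) f x * g x) = (LINT x|lborel. (step ^^ n) f x * step g x)"
    using step_symmetric[OF integrable_steps_L1[OF f] Suc.prems] by simp
  also have "\<dots> = (LINT x|lborel. f x * (step ^^ n) (step g) x)"
    by (rule Suc.IH[OF bbound_step[OF Suc.prems]])
  finally show ?case by (simp only: funpow_Suc_right o_apply)
qed simp

lemma step_cong_AE:
  assumes "f \<in> borel_measurable borel" "g \<in> borel_measurable borel" "AE x in lborel. f x = g x"
  shows "step f = step g"
  unfolding step_def[abs_def]
  by (intro ext integral_cong_AE) (use assms in auto)

text \<open>The Poisson average is an integral, so that every interchange of it with \<open>step\<close> or with an integral
  in space is an instance of Fubini's theorem.\<close>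

lemma integrable_poisson_steps:
  "bbound f B \<Longrightarrow> integrable (measure_pmf p) (\<lambda>n. (step ^^ n) f x)"
  by (rule measure_pmf.integrable_const_bound[where B=B]) (auto intro: bboundD bbound_steps)

lemma measurable_steps [measurable]:
  assumes f: "bbound f B"
  shows "(\<lambda>(n, x). (step ^^ n) f x) \<in> borel_measurable (measure_pmf p \<Otimes>\<^sub>M borel)"
    and "(\<lambda>(x, n). (step ^^ n) f x) \<in> borel_measurable (borel \<Otimes>\<^sub>M measure_pmf p)"
proof -
  have 1: "(\<lambda>(n, x). (step ^^ n) f x) \<in> borel_measurable (count_space UNIV \<Otimes>\<^sub>M borel)"
    by (rule measurable_pair_measure_countable1) (auto intro: bboundD bbound_steps[OF f])
  then show "(\<lambda>(n, x). (step ^^ n) f x) \<in> borel_measurable (measure_pmf p \<Otimes>\<^sub>M borel)"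
    by (simp cong: measurable_cong_sets sets_pair_measure_cong)
  from 1 have "(\<lambda>(x, n). (step ^^ n) f x) \<in> borel_measurable (borel \<Otimes>\<^sub>M count_space UNIV)"
    by (subst measurable_pair_swap_iff) (simp add: case_prod_unfold)
  then show "(\<lambda>(x, n). (step ^^ n) f x) \<in> borel_measurable (borel \<Otimes>\<^sub>M measure_pmf p)"
    by (simp cong: measurable_cong_sets sets_pair_measure_cong)
qed

lemma bbound_heat:
  assumes f: "bbound f B" shows "bbound (heat t f) B"
proof -
  have "\<bar>heat t f x\<bar> \<le> B" for x
  proof -
    have "\<bar>heat t f x\<bar> \<le> measure_pmf.expectation (poisson_pmf t) (\<lambda>n. \<bar>(step ^^ n) f x\<bar>)"
      unfolding heat_def using integral_norm_bound[of "measure_pmf (poisson_pmf t)"] by auto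
    also have "\<dots> \<le> B"
      by (rule measure_pmf.integral_le_const)
         (use f in \<open>auto intro!: integrable_abs integrable_poisson_steps bboundD(2)[OF bbound_steps]\<close>)
    finally show ?thesis .
  qed
  moreover have "heat t f \<in> borel_measurable borel"
    unfolding heat_def[abs_def]
    by (rule measure_pmf.borel_measurable_lebesgue_integral) (rule measurable_steps[OF f])
  ultimately show ?thesis by (auto simp: bbound_def)
qed

lemma heat_diff:
  assumes "bbound f B" "bbound g C"
  shows "heat t (\<lambda>x. f x - g x) x = heat t f x - heat t g x"
  unfolding heat_def steps_diff[OF assms] using assms
  by (simp add: integrable_poisson_steps)

lemma heat_cmult: "heat t (\<lambda>x. c * f x) x = c * heat t f x"
  unfolding heat_def steps_cmult by simp

lemma heat_add:
  assumes "bbound f B" "bbound g C"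
  shows "heat t (\<lambda>x. f x + g x) x = heat t f x + heat t g x"
  using heat_diff[OF assms(1) bbound_cmult[OF assms(2), of "-1"], of t x] heat_cmult[of t "-1" g x] by simp

lemma heat_mono:
  assumes "bbound f B" "bbound g C" "\<And>x. f x \<le> g x"
  shows "heat t f x \<le> heat t g x"
  unfolding heat_def
  by (rule integral_mono) (use assms in \<open>auto intro!: integrable_poisson_steps steps_mono\<close>)

lemma heat_nonneg: "(\<And>x. 0 \<le> f x) \<Longrightarrow> 0 \<le> heat t f x"
  unfolding heat_def by (rule integral_nonneg_AE) (auto intro: steps_nonneg)

lemma heat_abs_le:
  assumes "bbound f B" "bbound g C" "\<And>x. \<bar>f x\<bar> \<le> g x"
  shows "\<bar>heat t f x\<bar> \<le> heat t g x"
proof -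
  have "heat t f x \<le> heat t g x" "heat t (\<lambda>x. - 1 * f x) x \<le> heat t g x"
    using assms by (auto intro!: heat_mono[of _ B _ C] bbound_cmult[of f B "-1", simplified] simp: abs_le_iff)
  then show ?thesis unfolding heat_cmult by auto
qed

lemma heat_fixpoint: "step f = f \<Longrightarrow> heat t f = f"
proof -
  assume "step f = f"
  then have "(step ^^ n) f = f" for n by (induction n) auto
  then show ?thesis by (auto simp: heat_def)
qed

text \<open>The contraction on L1 is dual to the contraction on bounded functions: test with the sign.\<close>

lemma L1_steps_le:
  assumes f: "integrable lborel f" shows "(LINT x|lborel. \<bar>(step ^^ n) f x\<bar>) \<le> (LINT x|lborel. \<bar>f x\<bar>)"
proof -
  let ?g = "\<lambda>x. sgn ((step ^^ n) f x)"
  have [measurable]: "(step ^^ n) f \<in> borel_measurable borel"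
    using integrable_steps_L1[OF f] borel_measurable_integrable by auto
  have g: "bbound ?g 1"
    by (auto simp: bbound_def sgn_if)
  have "(LINT x|lborel. \<bar>(step ^^ n) f x\<bar>) = (LINT x|lborel. (step ^^ n) f x * ?g x)"
    by (simp only: abs_sgn)
  also have "\<dots> = (LINT x|lborel. f x * (step ^^ n) ?g x)"
    by (rule steps_symmetric[OF f g])
  also have "\<dots> \<le> 1 * (LINT x|lborel. \<bar>f x\<bar>)"
    using integral_mult_bbound_le[OF f bbound_steps[OF g]] abs_le_D1 by blast
  finally show ?thesis by simp
qed

lemma integrable_poisson_product:
  assumes f: "integrable lborel f" "bbound f B" and g: "bbound g C"
  shows "integrable (measure_pmf (poisson_pmf t) \<Otimes>\<^sub>M lborel) (\<lambda>(n, x). (step ^^ n) f x * g x)"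
proof -
  interpret P: pair_sigma_finite "measure_pmf (poisson_pmf t)" lborel
    by unfold_locales
  have [measurable]: "g \<in> borel_measurable borel" using g bboundD by auto
  note [measurable] = measurable_steps(1)[OF f(2), of "poisson_pmf t"]
  show ?thesis
  proof (rule P.Fubini_integrable)
    have "(\<lambda>z. (\<lambda>(n, x). (step ^^ n) f x) z * g (snd z)) \<in> borel_measurable (measure_pmf (poisson_pmf t) \<Otimes>\<^sub>M borel)"
      by measurable
    then show "(\<lambda>(n, x). (step ^^ n) f x * g x) \<in> borel_measurable (measure_pmf (poisson_pmf t) \<Otimes>\<^sub>M lborel)"
      by (simp add: case_prod_unfold cong: measurable_cong_sets sets_pair_measure_cong)
    show "AE n in poisson_pmf t. integrable lborel (\<lambda>x. case (n, x) of (n, x) \<Rightarrow> (step ^^ n) f x * g x)"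
      using integrable_mult_bbound(1)[OF integrable_steps_L1[OF f(1)] g] by (intro AE_I2) simp
    have "\<bar>LINT x|lborel. norm ((step ^^ n) f x * g x)\<bar> \<le> C * (LINT x|lborel. \<bar>f x\<bar>)" for n
    proof -
      have "bbound (\<lambda>x. \<bar>g x\<bar>) C" using g by (auto simp: bbound_def)
      from integral_mult_bbound_le[OF integrable_abs[OF integrable_steps_L1[OF f(1)]] this]
      have "\<bar>LINT x|lborel. \<bar>(step ^^ n) f x\<bar> * \<bar>g x\<bar>\<bar> \<le> C * (LINT x|lborel. \<bar>(step ^^ n) f x\<bar>)" by simp
      also have "\<dots> \<le> C * (LINT x|lborel. \<bar>f x\<bar>)"
        by (rule mult_left_mono[OF L1_steps_le[OF f(1)] bbound_nonneg[OF g]])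
      finally show ?thesis by (simp add: abs_mult)
    qed
    then show "integrable (poisson_pmf t) (\<lambda>n. LINT x|lborel. norm (case (n, x) of (n, x) \<Rightarrow> (step ^^ n) f x * g x))"
      by (intro measure_pmf.integrable_const_bound[where B="C * (LINT x|lborel. \<bar>f x\<bar>)"]) auto
  qed
qed

lemma integral_heat_mult:
  assumes f: "integrable lborel f" "bbound f B" and g: "bbound g C"
  shows "integrable lborel (\<lambda>x. heat t f x * g x)"
    and "(LINT x|lborel. heat t f x * g x)
      = measure_pmf.expectation (poisson_pmf t) (\<lambda>n. LINT x|lborel. (step ^^ n) f x * g x)"
proof -
  interpret P: pair_sigma_finite "measure_pmf (poisson_pmf t)" lborel
    by unfold_locales
  have eq: "heat t f x * g x = measure_pmf.expectation (poisson_pmf t) (\<lambda>n. (step ^^ n) f x * g x)" for x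
    unfolding heat_def by simp
  show "integrable lborel (\<lambda>x. heat t f x * g x)"
    unfolding eq using P.integrable_snd[OF integrable_poisson_product[OF assms, of t]] by simp
  show "(LINT x|lborel. heat t f x * g x)
      = measure_pmf.expectation (poisson_pmf t) (\<lambda>n. LINT x|lborel. (step ^^ n) f x * g x)"
    unfolding eq using P.Fubini_integral[OF integrable_poisson_product[OF assms, of t]] by simp
qed

lemma integrable_heat:
  "integrable lborel f \<Longrightarrow> bbound f B \<Longrightarrow> integrable lborel (heat t f)"
  using integral_heat_mult(1)[of f B "\<lambda>_. 1" 1] bbound_const[of 1] by simp

lemma heat_symmetric:
  assumes f: "integrable lborel f" "bbound f B" and g: "bbound g C"
  shows "(LINT x|lborel. heat t f x * g x) = (LINT x|lborel. f x * heat t g x)"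
proof -
  interpret P: pair_sigma_finite "measure_pmf (poisson_pmf t)" lborel
    by unfold_locales
  have [measurable]: "f \<in> borel_measurable borel" using f bboundD by auto
  note [measurable] = measurable_steps(1)[OF g, of "poisson_pmf t"]
  have "integrable (measure_pmf (poisson_pmf t) \<Otimes>\<^sub>M lborel) (\<lambda>(n, x). f x * (step ^^ n) g x)"
  proof (rule P.Fubini_integrable)
    have "(\<lambda>z. f (snd z) * (\<lambda>(n, x). (step ^^ n) g x) z) \<in> borel_measurable (measure_pmf (poisson_pmf t) \<Otimes>\<^sub>M borel)"
      by measurable
    then show "(\<lambda>(n, x). f x * (step ^^ n) g x) \<in> borel_measurable (measure_pmf (poisson_pmf t) \<Otimes>\<^sub>M lborel)"
      by (simp add: case_prod_unfold cong: measurable_cong_sets sets_pair_measure_cong)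
    show "AE n in poisson_pmf t. integrable lborel (\<lambda>x. case (n, x) of (n, x) \<Rightarrow> f x * (step ^^ n) g x)"
      using integrable_mult_bbound(1)[OF f(1) bbound_steps[OF g]] by (intro AE_I2) simp
    have "\<bar>LINT x|lborel. norm (f x * (step ^^ n) g x)\<bar> \<le> C * (LINT x|lborel. \<bar>f x\<bar>)" for n
    proof -
      have "bbound (\<lambda>x. \<bar>(step ^^ n) g x\<bar>) C" using bbound_steps[OF g, of n] by (auto simp: bbound_def)
      from integral_mult_bbound_le[OF integrable_abs[OF f(1)] this]
      show ?thesis by (simp add: abs_mult)
    qed
    then show "integrable (poisson_pmf t) (\<lambda>n. LINT x|lborel. norm (case (n, x) of (n, x) \<Rightarrow> f x * (step ^^ n) g x))"
      by (intro measure_pmf.integrable_const_bound[where B="C * (LINT x|lborel. \<bar>f x\<bar>)"]) auto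
  qed
  from P.Fubini_integral[OF this]
  have "(LINT x|lborel. f x * heat t g x)
      = measure_pmf.expectation (poisson_pmf t) (\<lambda>n. LINT x|lborel. f x * (step ^^ n) g x)"
    by (simp add: heat_def)
  then show ?thesis
    by (simp add: integral_heat_mult[OF assms] steps_symmetric[OF f(1) g])
qed


text \<open>The operator passes under the Poisson average, which reduces the semigroup law to the addition of independent Poisson variables.\<close>

lemma step_heat_eq:
  assumes f: "bbound f B"
  shows "(step ^^ m) (heat t f) x = measure_pmf.expectation (poisson_pmf t) (\<lambda>n. (step ^^ (m + n)) f x)"
proof (induction m arbitrary: x)
  case 0
  then show ?case by (simp add: heat_def)
next
  case (Suc m)
  interpret P: pair_sigma_finite lborel "measure_pmf (poisson_pmf t)"
    by unfold_locales
  note g = bbound_steps[OF f, of m]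
  have mn: "(step ^^ (m + n)) f = (step ^^ n) ((step ^^ m) f)" for n
    by (simp add: add.commute[of m n] funpow_add)
  note [measurable] = measurable_steps(2)[OF g, of "poisson_pmf t"]
  have "integrable (lborel \<Otimes>\<^sub>M measure_pmf (poisson_pmf t)) (\<lambda>(y, n). k x y * (step ^^ n) ((step ^^ m) f) y)"
  proof (rule P.Fubini_integrable)
    have "(\<lambda>z. k x (fst z) * (\<lambda>(y, n). (step ^^ n) ((step ^^ m) f) y) z) \<in> borel_measurable (borel \<Otimes>\<^sub>M measure_pmf (poisson_pmf t))"
      by measurable
    then show "(\<lambda>(y, n). k x y * (step ^^ n) ((step ^^ m) f) y) \<in> borel_measurable (lborel \<Otimes>\<^sub>M measure_pmf (poisson_pmf t))"
      by (simp add: case_prod_unfold cong: measurable_cong_sets sets_pair_measure_cong)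
    show "AE y in lborel. integrable (measure_pmf (poisson_pmf t)) (\<lambda>n. case (y, n) of (y, n) \<Rightarrow> k x y * (step ^^ n) ((step ^^ m) f) y)"
      by (intro AE_I2) (simp add: integrable_poisson_steps[OF g])
    have ab: "bbound (\<lambda>y. measure_pmf.expectation (poisson_pmf t) (\<lambda>n. \<bar>(step ^^ n) ((step ^^ m) f) y\<bar>)) B"
      unfolding bbound_def
    proof (intro conjI allI)
      have "(\<lambda>z. \<bar>(\<lambda>(y, n). (step ^^ n) ((step ^^ m) f) y) z\<bar>) \<in> borel_measurable (borel \<Otimes>\<^sub>M measure_pmf (poisson_pmf t))"
        by measurable
      then show "(\<lambda>y. measure_pmf.expectation (poisson_pmf t) (\<lambda>n. \<bar>(step ^^ n) ((step ^^ m) f) y\<bar>)) \<in> borel_measurable borel"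
        by (intro measure_pmf.borel_measurable_lebesgue_integral) (simp add: case_prod_unfold)
      fix y
      have "0 \<le> measure_pmf.expectation (poisson_pmf t) (\<lambda>n. \<bar>(step ^^ n) ((step ^^ m) f) y\<bar>)"
        by (rule integral_nonneg_AE) auto
      moreover have "measure_pmf.expectation (poisson_pmf t) (\<lambda>n. \<bar>(step ^^ n) ((step ^^ m) f) y\<bar>) \<le> B"
        by (rule measure_pmf.integral_le_const)
           (use g in \<open>auto intro!: integrable_abs integrable_poisson_steps[OF g] bboundD(2)[OF bbound_steps]\<close>)
      ultimately show "\<bar>measure_pmf.expectation (poisson_pmf t) (\<lambda>n. \<bar>(step ^^ n) ((step ^^ m) f) y\<bar>)\<bar> \<le> B" by simp
    qed
    show "integrable lborel (\<lambda>y. LINT n|measure_pmf (poisson_pmf t). norm (case (y, n) of (y, n) \<Rightarrow> k x y * (step ^^ n) ((step ^^ m) f) y))"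
      using integrable_step[OF ab, of x] by (simp add: abs_mult kernel_nonneg)
  qed
  from P.Fubini_integral[OF this]
  have "(LINT y|lborel. k x y * measure_pmf.expectation (poisson_pmf t) (\<lambda>n. (step ^^ n) ((step ^^ m) f) y))
     = measure_pmf.expectation (poisson_pmf t) (\<lambda>n. step ((step ^^ n) ((step ^^ m) f)) x)"
    by (simp add: step_def[of "(step ^^ _) _"])
  moreover have "(step ^^ m) (heat t f) = (\<lambda>y. measure_pmf.expectation (poisson_pmf t) (\<lambda>n. (step ^^ n) ((step ^^ m) f) y))"
    using Suc.IH by (auto simp: mn)
  ultimately show ?case
    by (simp add: step_def[of "\<lambda>y. measure_pmf.expectation _ (_ y)"] mn)
qed

lemma heat_semigroup:
  assumes "0 < s" "0 < t" "bbound f B"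
  shows "heat s (heat t f) x = heat (s + t) f x"
  unfolding heat_def[of s "heat t f"] step_heat_eq[OF assms(3)] heat_def[of "s + t"]
  by (rule poisson_expectation_add[OF assms(1,2)]) (rule bboundD(2)[OF bbound_steps[OF assms(3)]])

lemma heat_mass:
  assumes "step (\<lambda>_. 1) = (\<lambda>_. 1)" "integrable lborel f" "bbound f B"
  shows "(LINT x|lborel. heat t f x) = (LINT x|lborel. f x)"
  using heat_symmetric[OF assms(2,3) bbound_const[of 1], of t] heat_fixpoint[OF assms(1)] by simp

lemma heat_1_le: "heat t (\<lambda>_. 1) x \<le> 1"
  using bboundD(3)[OF bbound_heat[OF bbound_const[of 1]]] by simp

end

text \<open>Killing more makes the walk smaller. What is lost is at most the supremum of the data times
  the probability of having been killed: this is positivity of the loss, applied to the function \<open>B - f\<close>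
  in \<open>heat_loss_le\<close>.\<close>

lemma heat_domination:
  fixes k l :: "'a::euclidean_space \<Rightarrow> 'a \<Rightarrow> real"
  assumes "symmetric_kernel k" "symmetric_kernel l" and kl: "\<And>x y. k x y \<le> l x y"
    and f: "bbound f B" "\<And>x. 0 \<le> f x"
  shows "symmetric_kernel.heat k t f x \<le> symmetric_kernel.heat l t f x"
proof -
  interpret k: symmetric_kernel k by fact
  interpret l: symmetric_kernel l by fact
  have "(k.step ^^ n) f x \<le> (l.step ^^ n) f x" for n x
  proof (induction n arbitrary: x)
    case (Suc n)
    have "k.step ((k.step ^^ n) f) x \<le> k.step ((l.step ^^ n) f) x"
      by (rule k.step_mono[OF k.bbound_steps[OF f(1)] l.bbound_steps[OF f(1)] Suc])
    also have "\<dots> \<le> l.step ((l.step ^^ n) f) x"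
      unfolding k.step_def[of "(l.step ^^ n) f"] l.step_def[of "(l.step ^^ n) f"]
      by (rule integral_mono)
         (auto intro!: k.integrable_step[OF l.bbound_steps[OF f(1)]] l.integrable_step[OF l.bbound_steps[OF f(1)]]
            mult_right_mono kl l.steps_nonneg f(2))
    finally show ?case by simp
  qed simp
  then show ?thesis
    unfolding k.heat_def l.heat_def
    by (intro integral_mono k.integrable_poisson_steps[OF f(1)] l.integrable_poisson_steps[OF f(1)]) auto
qed

lemma heat_loss_le:
  fixes k l :: "'a::euclidean_space \<Rightarrow> 'a \<Rightarrow> real"
  assumes k: "symmetric_kernel k" and l: "symmetric_kernel l" and kl: "\<And>x y. k x y \<le> l x y"
    and f: "bbound f B"
  shows "symmetric_kernel.heat l t f x - symmetric_kernel.heat k t f x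
    \<le> B * (1 - symmetric_kernel.heat k t (\<lambda>_. 1) x)"
proof -
  interpret k: symmetric_kernel k by fact
  interpret l: symmetric_kernel l by fact
  have B: "bbound (\<lambda>x. B * 1) \<bar>B\<bar>" using bbound_const[of B] by simp
  have "k.heat t (\<lambda>x. B * 1 - f x) x \<le> l.heat t (\<lambda>x. B * 1 - f x) x"
    by (rule heat_domination[OF k l kl bbound_diff[OF B f]]) (use bboundD(3)[OF f] in simp)
  moreover have "B * l.heat t (\<lambda>_. 1) x \<le> B"
    using mult_left_mono[OF l.heat_1_le bbound_nonneg[OF f]] by simp
  ultimately show ?thesis
    by (simp only: k.heat_diff[OF B f] l.heat_diff[OF B f] k.heat_cmult l.heat_cmult) (simp add: algebra_simps)
qed

section \<open>Changes of variables and Gaussian integrals\<close>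

lemma lborel_affine_integral:
  fixes f :: "'a::euclidean_space \<Rightarrow> real"
  assumes [measurable]: "f \<in> borel_measurable borel" and c: "c \<noteq> 0"
  shows "(LINT x|lborel. f x) = \<bar>c\<bar> ^ DIM('a) * (LINT x|lborel. f (t + c *\<^sub>R x))"
    and "integrable lborel f \<longleftrightarrow> integrable lborel (\<lambda>x. f (t + c *\<^sub>R x))"
proof -
  have eq: "lborel = density (distr lborel borel (\<lambda>x::'a. t + c *\<^sub>R x)) (\<lambda>_. ennreal (\<bar>c\<bar> ^ DIM('a)))"
    using lborel_affine[OF c, of t] by simp
  show "(LINT x|lborel. f x) = \<bar>c\<bar> ^ DIM('a) * (LINT x|lborel. f (t + c *\<^sub>R x))"
    by (subst eq, subst integral_density) (auto simp: integral_distr)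
  have "integrable lborel f \<longleftrightarrow> integrable (distr lborel borel (\<lambda>x::'a. t + c *\<^sub>R x)) (\<lambda>x. \<bar>c\<bar> ^ DIM('a) *\<^sub>R f x)"
    by (subst eq, subst integrable_density) auto
  also have "\<dots> \<longleftrightarrow> integrable lborel (\<lambda>x. f (t + c *\<^sub>R x))"
    using c by (subst integrable_distr_eq) auto
  finally show "integrable lborel f \<longleftrightarrow> integrable lborel (\<lambda>x. f (t + c *\<^sub>R x))" .
qed

lemma lborel_reflect:
  fixes f :: "'a::euclidean_space \<Rightarrow> real"
  assumes "f \<in> borel_measurable borel"
  shows "(LINT z|lborel. f (x - z)) = (LINT z|lborel. f z)"
    and "integrable lborel (\<lambda>z. f (x - z)) \<longleftrightarrow> integrable lborel f"
  using lborel_affine_integral[OF assms, of "-1" x] by simp_all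

lemma gaussian_fourier_real:
  fixes a y :: real
  assumes a: "0 < a"
  shows "integrable lborel (\<lambda>s. complex_of_real (exp (- a * s\<^sup>2)) * iexp (y * s))"
    and "(CLBINT s. complex_of_real (exp (- a * s\<^sup>2)) * iexp (y * s))
        = complex_of_real (sqrt (pi / a) * exp (- y\<^sup>2 / (4 * a)))"
proof -
  \<comment> \<open>Rescaling by this factor turns the Gaussian into the standard normal density, whose transform is known.\<close>
  define c where "c = 1 / sqrt (2 * a)"
  have c: "c > 0" "c\<^sup>2 = 1 / (2 * a)" using a by (auto simp: c_def power_divide)
  have e: "complex_of_real (exp (- a * (0 + c * x)\<^sup>2)) * iexp (y * (0 + c * x))
      = sqrt (2 * pi) * (std_normal_density x *\<^sub>R iexp ((y * c) * x))" for x
  proof -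
    have "- a * (0 + c * x)\<^sup>2 = - x\<^sup>2 / 2"
      using a c by (simp add: power_mult_distrib)
    then show ?thesis
      by (simp add: std_normal_density_def scaleR_conv_of_real mult_ac)
  qed
  have i1: "integrable lborel (\<lambda>x. std_normal_density x *\<^sub>R iexp ((y * c) * x))"
    by (rule Bochner_Integration.integrable_bound[OF integrable_normal_density[where \<sigma>=1 and \<mu>=0]]) auto
  then have "integrable lborel (\<lambda>x. complex_of_real (sqrt (2 * pi)) * (std_normal_density x *\<^sub>R iexp ((y * c) * x)))"
    by (rule integrable_mult_right)
  then have "integrable lborel (\<lambda>x. complex_of_real (exp (- a * (0 + c * x)\<^sup>2)) * iexp (y * (0 + c * x)))"
    by (simp only: e)
  then show int: "integrable lborel (\<lambda>s. complex_of_real (exp (- a * s\<^sup>2)) * iexp (y * s))"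
    using c lborel_integrable_real_affine_iff[where c=c and t=0
        and f="\<lambda>s. complex_of_real (exp (- a * s\<^sup>2)) * iexp (y * s)"] by simp
  have "(CLBINT s. complex_of_real (exp (- a * s\<^sup>2)) * iexp (y * s))
     = c *\<^sub>R (CLBINT x. sqrt (2 * pi) * (std_normal_density x *\<^sub>R iexp ((y * c) * x)))"
    using c lborel_integral_real_affine[where c=c and t=0
        and f="\<lambda>s. complex_of_real (exp (- a * s\<^sup>2)) * iexp (y * s)"] by (simp only: e) simp
  also have "(CLBINT x. sqrt (2 * pi) * (std_normal_density x *\<^sub>R iexp ((y * c) * x)))
     = sqrt (2 * pi) * char std_normal_distribution (y * c)"
    unfolding char_def integral_mult_right_zero by (subst integral_density) auto
  also have "\<dots> = sqrt (2 * pi) * exp (- y\<^sup>2 / (4 * a))"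
    by (simp add: char_std_normal_distribution power_mult_distrib c)
  also have "c *\<^sub>R complex_of_real (sqrt (2 * pi) * exp (- y\<^sup>2 / (4 * a)))
     = complex_of_real (sqrt (pi / a) * exp (- y\<^sup>2 / (4 * a)))"
    by (simp add: c_def real_sqrt_mult real_sqrt_divide scaleR_conv_of_real)
  finally show "(CLBINT s. complex_of_real (exp (- a * s\<^sup>2)) * iexp (y * s))
        = complex_of_real (sqrt (pi / a) * exp (- y\<^sup>2 / (4 * a)))" .
qed

lemma gaussian_fourier:
  fixes x :: "'a::euclidean_space"
  assumes a: "0 < a"
  shows "integrable lborel (\<lambda>\<xi>::'a. exp (- a * (norm \<xi>)\<^sup>2) * cos (x \<bullet> \<xi>))"
    and "(LINT \<xi>|lborel. exp (- a * (norm \<xi>)\<^sup>2) * cos (x \<bullet> \<xi>))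
        = (pi / a) powr (real DIM('a) / 2) * exp (- (norm x)\<^sup>2 / (4 * a))"
proof -
  interpret P: product_sigma_finite "\<lambda>b::'a. lborel :: real measure" ..
  define h where "h b s = complex_of_real (exp (- a * s\<^sup>2)) * iexp ((x \<bullet> b) * s)" for b s
  define F where "F \<xi> = (\<Prod>b\<in>Basis. h b (\<xi> \<bullet> b))" for \<xi> :: 'a
  have [measurable]: "F \<in> borel_measurable borel" unfolding F_def h_def by measurable
  \<comment> \<open>The integrand is a product of functions of one coordinate each.\<close>
  have nn: "(norm z)\<^sup>2 = (\<Sum>b\<in>Basis. (z \<bullet> b)\<^sup>2)" for z :: 'a
    by (subst power2_norm_eq_inner, subst euclidean_inner) (simp add: power2_eq_square)
  have F: "F \<xi> = complex_of_real (exp (- a * (norm \<xi>)\<^sup>2)) * iexp (x \<bullet> \<xi>)" for \<xi>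
    unfolding F_def h_def nn euclidean_inner[of x \<xi>] sum_distrib_left
    by (simp add: prod.distrib exp_sum sum_distrib_left)
  have s: "F (\<Sum>b\<in>Basis. f b *\<^sub>R b) = (\<Prod>b\<in>Basis. h b (f b))" for f
    unfolding F_def by (auto intro!: prod.cong)
  have hi: "integrable lborel (h b)" for b
    unfolding h_def by (rule gaussian_fourier_real[OF a])
  have intF: "integrable lborel F"
    by (subst lborel_eq, subst integrable_distr_eq) (auto simp: s hi intro!: P.product_integrable_prod)
  have "integral\<^sup>L lborel F = (\<Prod>b\<in>Basis. integral\<^sup>L lborel (h b))"
    by (subst lborel_eq, subst integral_distr) (auto simp: s hi P.product_integral_prod)
  also have "\<dots> = (\<Prod>b\<in>Basis. complex_of_real (sqrt (pi / a) * exp (- (x \<bullet> b)\<^sup>2 / (4 * a))))"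
    unfolding h_def by (simp only: gaussian_fourier_real[OF a])
  also have "\<dots> = complex_of_real (sqrt (pi / a) ^ DIM('a) * exp (- (norm x)\<^sup>2 / (4 * a)))"
    unfolding nn by (simp add: prod.distrib exp_sum[symmetric] of_real_prod[symmetric] sum_divide_distrib sum_negf del: of_real_prod of_real_mult)
  also have "sqrt (pi / a) ^ DIM('a) = (pi / a) powr (real DIM('a) / 2)"
    using a by (simp add: powr_half_sqrt[symmetric] powr_realpow[symmetric] powr_powr)
  finally have I: "integral\<^sup>L lborel F = complex_of_real ((pi / a) powr (real DIM('a) / 2) * exp (- (norm x)\<^sup>2 / (4 * a)))" .
  have Re: "Re (F \<xi>) = exp (- a * (norm \<xi>)\<^sup>2) * cos (x \<bullet> \<xi>)" for \<xi>
    unfolding F by (simp add: Re_exp)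
  show "integrable lborel (\<lambda>\<xi>::'a. exp (- a * (norm \<xi>)\<^sup>2) * cos (x \<bullet> \<xi>))"
    using integrable_Re[OF intF] by (simp add: Re)
  show "(LINT \<xi>|lborel. exp (- a * (norm \<xi>)\<^sup>2) * cos (x \<bullet> \<xi>))
        = (pi / a) powr (real DIM('a) / 2) * exp (- (norm x)\<^sup>2 / (4 * a))"
    using integral_Re[OF intF] by (simp add: Re I)
qed

lemma gaussian_integrable:
  assumes "0 < a" shows "integrable lborel (\<lambda>\<xi>::'a::euclidean_space. exp (- a * (norm \<xi>)\<^sup>2))"
  using gaussian_fourier(1)[OF assms, of 0] by simp

section \<open>Second moments of radial densities\<close>

text \<open>The sign changes and permutations of coordinates are enough to see that the second moments of a radial density form a multiple of the identity.\<close>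

lemma lborel_sign_flip:
  fixes f :: "'a::euclidean_space \<Rightarrow> real"
  assumes [measurable]: "f \<in> borel_measurable borel" and b: "b \<in> Basis"
  shows "(LINT x|lborel. f (x - (2 * (x \<bullet> b)) *\<^sub>R b)) = (LINT x|lborel. f x)"
proof -
  define c where "c j = (if j = b then -1 else 1 :: real)" for j :: 'a
  have T: "(0 + (\<Sum>j\<in>Basis. (c j * (x \<bullet> j)) *\<^sub>R j)) = x - (2 * (x \<bullet> b)) *\<^sub>R b" for x
    by (rule euclidean_eqI) (use b in \<open>auto simp: inner_simps inner_sum_left_Basis c_def inner_Basis\<close>)
  have c: "\<bar>c j\<bar> = 1" for j by (simp add: c_def)
  have "lborel = density (distr lborel borel (\<lambda>x::'a. 0 + (\<Sum>j\<in>Basis. (c j * (x \<bullet> j)) *\<^sub>R j))) (\<lambda>_. (\<Prod>j\<in>Basis. \<bar>c j\<bar>))"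
    by (rule lborel_affine_euclidean) (auto simp: c_def)
  then have eq: "lborel = distr lborel borel (\<lambda>x::'a. x - (2 * (x \<bullet> b)) *\<^sub>R b)"
    unfolding T c by (simp add: density_1)
  show ?thesis by (subst (2) eq, subst integral_distr) auto
qed

lemma lborel_swap_coordinates:
  fixes f :: "'a::euclidean_space \<Rightarrow> real"
  assumes [measurable]: "f \<in> borel_measurable borel" and b: "b \<in> Basis" "c \<in> Basis"
  shows "(LINT x|lborel. f (\<Sum>j\<in>Basis. (x \<bullet> Transposition.transpose b c j) *\<^sub>R j)) = (LINT x|lborel. f x)"
proof -
  let ?p = "Transposition.transpose b c"
  define T where "T x = (\<Sum>j\<in>Basis. (x \<bullet> ?p j) *\<^sub>R j)" for x :: 'a
  have p: "?p j \<in> Basis" if "j \<in> Basis" for j using b that by (auto simp: Transposition.transpose_def)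
  have bij: "bij_betw ?p Basis Basis"
    by (rule bij_betwI[where g="?p"]) (auto simp: p)
  have Tj: "T x \<bullet> j = x \<bullet> ?p j" if "j \<in> Basis" for x j
    unfolding T_def using that by simp
  have [measurable]: "T \<in> borel_measurable borel" unfolding T_def by measurable
  have "lborel = distr lborel borel T"
  proof (rule lborel_eqI)
    fix l u :: 'a assume le: "\<And>b. b \<in> Basis \<Longrightarrow> l \<bullet> b \<le> u \<bullet> b"
    have "T -` box l u = box (T l) (T u)"
      using p by (auto simp: box_def Tj) (metis p transpose_involutory)+
    then have "emeasure (distr lborel borel T) (box l u) = emeasure lborel (box (T l) (T u))"
      by (subst emeasure_distr) auto
    also have "\<dots> = (\<Prod>j\<in>Basis. (T u - T l) \<bullet> j)"
      by (rule emeasure_lborel_box) (auto simp: Tj p le)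
    also have "(\<Prod>j\<in>Basis. (T u - T l) \<bullet> j) = (\<Prod>j\<in>Basis. (u - l) \<bullet> ?p j)"
      by (auto simp: Tj inner_diff_left intro!: prod.cong)
    also have "\<dots> = (\<Prod>j\<in>Basis. (u - l) \<bullet> j)"
      by (rule prod.reindex_bij_betw[OF bij])
    finally show "emeasure (distr lborel borel T) (box l u) = (\<Prod>j\<in>Basis. (u - l) \<bullet> j)" by simp
  qed simp
  then have "(LINT x|lborel. f x) = (LINT x|distr lborel borel T. f x)" by simp
  also have "\<dots> = (LINT x|lborel. f (T x))" by (subst integral_distr) auto
  finally show ?thesis by (simp add: T_def)
qed

section \<open>Radial densities and their Fourier transform\<close>

text \<open>All uses of Fubini's theorem in the Fourier argument are for integrands of this shape, with trigonometric or bounded third factor.\<close>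

lemma integrable_product_bounded:
  fixes f :: "'a::euclidean_space \<Rightarrow> real" and g :: "'b::euclidean_space \<Rightarrow> real"
  assumes f: "integrable lborel f" and g: "integrable lborel g"
    and e[measurable]: "case_prod e \<in> borel_measurable (borel \<Otimes>\<^sub>M borel)" and E: "\<And>x y. \<bar>e x y\<bar> \<le> E"
  shows "integrable (lborel \<Otimes>\<^sub>M lborel) (\<lambda>(x, y). f x * g y * e x y)"
proof -
  have [measurable]: "f \<in> borel_measurable borel" "g \<in> borel_measurable borel"
    using f g borel_measurable_integrable by auto
  have 1: "integrable (lborel \<Otimes>\<^sub>M lborel) (\<lambda>(x, y). f x * g y)"
    by (rule lborel_pair.Fubini_integrable) (use f g in \<open>auto simp: abs_mult\<close>)
  have "\<bar>e x y\<bar> * \<bar>f x * g y\<bar> \<le> E * \<bar>f x * g y\<bar>" for x y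
    by (rule mult_right_mono[OF E]) auto
  then have "norm (case z of (x, y) \<Rightarrow> f x * g y * e x y) \<le> norm (E * \<bar>case z of (x, y) \<Rightarrow> f x * g y\<bar>)" for z
    using order_trans[OF abs_ge_zero E] by (cases z) (simp add: abs_mult mult_ac)
  then show ?thesis
    by (intro Bochner_Integration.integrable_bound[OF integrable_mult_right[OF integrable_abs[OF 1], of E]]) auto
qed

locale radial_density =
  fixes J :: "'a::euclidean_space \<Rightarrow> real"
  assumes J_continuous: "continuous_on UNIV J"
    and J_nonneg: "0 \<le> J z"
    and J_radial: "norm y = norm z \<Longrightarrow> J y = J z"
    and J_support: "1 < norm z \<Longrightarrow> J z = 0"
    and J_integrable: "integrable lborel J"
    and J_mass: "(LINT z|lborel. J z) = 1"
begin

lemma J_borel [measurable]: "J \<in> borel_measurable borel"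
  by (rule borel_measurable_continuous_onI[OF J_continuous])

lemma J_even: "J (- z) = J z" "J (x - y) = J (y - x)"
  by (rule J_radial; simp add: norm_minus_commute)+

lemma J_bounded: "\<exists>C>0. bbound J C"
proof -
  have "compact (J ` cball 0 1)"
    by (rule compact_continuous_image) (auto intro: continuous_on_subset[OF J_continuous])
  then obtain C where C: "\<And>x. x \<in> J ` cball 0 1 \<Longrightarrow> norm x \<le> C"
    using compact_imp_bounded bounded_iff by metis
  have "\<bar>J z\<bar> \<le> \<bar>C\<bar> + 1" for z
    using C[of "J z"] J_support[of z] by (cases "norm z \<le> 1") auto
  then show ?thesis by (intro exI[of _ "\<bar>C\<bar> + 1"]) (auto simp: bbound_def)
qed

lemma J_shift_integrable: "integrable lborel (\<lambda>y. J (x - y))"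
  and J_shift_mass: "(LINT y|lborel. J (x - y)) = 1"
  using lborel_reflect[OF J_borel, of x] J_integrable J_mass by auto

lemma J_mult_integrable:
  assumes [measurable]: "g \<in> borel_measurable borel" and C: "\<And>z. norm z \<le> 1 \<Longrightarrow> \<bar>g z\<bar> \<le> C"
  shows "integrable lborel (\<lambda>z. J z * g z)"
proof (rule Bochner_Integration.integrable_bound[of lborel "\<lambda>z. C * J z"])
  have "J z * \<bar>g z\<bar> \<le> \<bar>C * J z\<bar>" for z
  proof (cases "norm z \<le> 1")
    case True
    then have "J z * \<bar>g z\<bar> \<le> J z * C" by (intro mult_left_mono C J_nonneg)
    then show ?thesis by (simp add: mult.commute)
  qed (simp add: J_support)
  then show "AE x in lborel. norm (J x * g x) \<le> norm (C * J x)"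
    by (auto simp: abs_mult J_nonneg)
qed (use J_integrable in auto)

lemma J_mult_mono:
  assumes "integrable lborel (\<lambda>z. J z * g z)" "integrable lborel (\<lambda>z. J z * h z)" "\<And>z. norm z \<le> 1 \<Longrightarrow> g z \<le> h z"
  shows "(LINT z|lborel. J z * g z) \<le> (LINT z|lborel. J z * h z)"
proof (rule integral_mono[OF assms(1,2)])
  fix z show "J z * g z \<le> J z * h z"
    using assms(3)[of z] J_support[of z] by (cases "norm z \<le> 1") (auto intro!: mult_left_mono J_nonneg)
qed

sublocale free: symmetric_kernel "\<lambda>x y. J (x - y)"
proof
  show "J (x - y) = J (y - x)" for x y by (rule J_even(2))
qed (auto simp: J_nonneg J_shift_integrable J_shift_mass)

lemma free_step_1: "free.step (\<lambda>_. 1) = (\<lambda>_. 1)"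
  by (simp add: free.step_def[abs_def] J_shift_mass)

definition Jhat :: "'a \<Rightarrow> real" where
  "Jhat \<xi> = (LINT z|lborel. J z * cos (z \<bullet> \<xi>))"

lemma J_cos_integrable [simp]: "integrable lborel (\<lambda>z. J z * cos (z \<bullet> \<xi>))"
  by (rule J_mult_integrable[where C=1]) auto

lemma J_sin_integrable [simp]: "integrable lborel (\<lambda>z. J z * sin (z \<bullet> \<xi>))"
  by (rule J_mult_integrable[where C=1]) auto

lemma Jhat_borel [measurable]: "Jhat \<in> borel_measurable borel"
  unfolding Jhat_def[abs_def] by (rule lborel.borel_measurable_lebesgue_integral) measurable

lemma one_minus_Jhat: "1 - Jhat \<xi> = (LINT z|lborel. J z * (1 - cos (z \<bullet> \<xi>)))"
  using J_integrable J_mass by (simp add: Jhat_def right_diff_distrib)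

lemma one_plus_Jhat: "1 + Jhat \<xi> = (LINT z|lborel. J z * (1 + cos (z \<bullet> \<xi>)))"
  using J_integrable J_mass by (simp add: Jhat_def distrib_left)

lemma Jhat_le_1: "\<bar>Jhat \<xi>\<bar> \<le> 1"
proof -
  have "0 \<le> 1 - Jhat \<xi>" unfolding one_minus_Jhat
    by (rule integral_nonneg_AE) (auto intro!: mult_nonneg_nonneg J_nonneg)
  moreover have "0 \<le> 1 + Jhat \<xi>" unfolding one_plus_Jhat
  proof (intro integral_nonneg_AE AE_I2 mult_nonneg_nonneg J_nonneg)
    show "0 \<le> 1 + cos (z \<bullet> \<xi>)" for z using cos_ge_minus_one[of "z \<bullet> \<xi>"] by linarith
  qed
  ultimately show ?thesis by auto
qed

lemma J_sin_zero: "(LINT z|lborel. J z * sin (z \<bullet> \<xi>)) = 0"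
  using lborel_reflect(1)[of "\<lambda>z. J z * sin (z \<bullet> \<xi>)" 0] by (simp add: J_even(1))

text \<open>Since \<open>J\<close> is even, plane waves are eigenfunctions of the free walk.\<close>

lemma step_cos: "free.step (\<lambda>z. cos ((z - y) \<bullet> \<xi>)) x = Jhat \<xi> * cos ((x - y) \<bullet> \<xi>)"
proof -
  have "free.step (\<lambda>z. cos ((z - y) \<bullet> \<xi>)) x = (LINT w|lborel. J w * cos ((x - w - y) \<bullet> \<xi>))"
    unfolding free.step_def
    using lborel_reflect(1)[of "\<lambda>w. J w * cos ((x - w - y) \<bullet> \<xi>)" x] by simp
  also have "\<dots> = (LINT w|lborel. cos ((x - y) \<bullet> \<xi>) * (J w * cos (w \<bullet> \<xi>)) + sin ((x - y) \<bullet> \<xi>) * (J w * sin (w \<bullet> \<xi>)))"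
  proof (rule Bochner_Integration.integral_cong[OF refl])
    fix w
    have "(x - w - y) \<bullet> \<xi> = (x - y) \<bullet> \<xi> - w \<bullet> \<xi>" by (simp add: inner_diff_left)
    then show "J w * cos ((x - w - y) \<bullet> \<xi>) = cos ((x - y) \<bullet> \<xi>) * (J w * cos (w \<bullet> \<xi>)) + sin ((x - y) \<bullet> \<xi>) * (J w * sin (w \<bullet> \<xi>))"
      by (simp only: cos_diff) (simp only: algebra_simps)
  qed
  also have "\<dots> = Jhat \<xi> * cos ((x - y) \<bullet> \<xi>)"
    by (simp add: Jhat_def J_sin_zero)
  finally show ?thesis .
qed

lemma inner_le_unit: "norm z \<le> 1 \<Longrightarrow> \<bar>z \<bullet> b\<bar> \<le> norm b" for z b :: 'a
  using Cauchy_Schwarz_ineq2[of z b] mult_right_mono[of "norm z" 1 "norm b"] by simp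

lemma second_moment_integrable: "integrable lborel (\<lambda>z. J z * ((z \<bullet> b) * (z \<bullet> c)))"
proof (rule J_mult_integrable[where C="norm b * norm c"])
  fix z :: 'a assume "norm z \<le> 1"
  then show "\<bar>(z \<bullet> b) * (z \<bullet> c)\<bar> \<le> norm b * norm c"
    unfolding abs_mult by (intro mult_mono inner_le_unit) auto
qed measurable

lemma norm_reflect: "b \<in> Basis \<Longrightarrow> norm (x - (2 * (x \<bullet> b)) *\<^sub>R b) = norm x" for x :: 'a
  unfolding norm_eq_sqrt_inner by (simp add: inner_diff_left inner_diff_right inner_commute algebra_simps)

lemma cross_moment_zero:
  assumes "b \<in> Basis" "c \<in> Basis" "b \<noteq> c" shows "(LINT z|lborel. J z * ((z \<bullet> b) * (z \<bullet> c))) = 0"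
proof -
  let ?f = "\<lambda>z. J z * ((z \<bullet> b) * (z \<bullet> c))"
  have "?f (x - (2 * (x \<bullet> b)) *\<^sub>R b) = - ?f x" for x
    using assms J_radial[OF norm_reflect[OF assms(1)], of x]
    by (simp add: inner_diff_left inner_Basis)
  then show ?thesis using lborel_sign_flip[of ?f b] assms by simp
qed

lemma equal_moments:
  assumes b: "b \<in> Basis" "c \<in> Basis"
  shows "(LINT z|lborel. J z * ((z \<bullet> b) * (z \<bullet> b))) = (LINT z|lborel. J z * ((z \<bullet> c) * (z \<bullet> c)))"
proof -
  let ?f = "\<lambda>z. J z * ((z \<bullet> b) * (z \<bullet> b))"
  let ?p = "Transposition.transpose b c"
  define T where "T x = (\<Sum>j\<in>Basis. (x \<bullet> ?p j) *\<^sub>R j)" for x :: 'a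
  have p: "?p j \<in> Basis" if "j \<in> Basis" for j using b that by (auto simp: Transposition.transpose_def)
  have bij: "bij_betw ?p Basis Basis"
    by (rule bij_betwI[where g="?p"]) (auto simp: p)
  have Tj: "T x \<bullet> j = x \<bullet> ?p j" if "j \<in> Basis" for x j
    unfolding T_def using that by simp
  have "T x \<bullet> T x = x \<bullet> x" for x
    using sum.reindex_bij_betw[OF bij, of "\<lambda>j. (x \<bullet> j) * (x \<bullet> j)"]
    unfolding euclidean_inner[of "T x" "T x"] euclidean_inner[of x x] by (simp add: Tj)
  then have "norm (T x) = norm x" for x by (simp add: norm_eq_sqrt_inner)
  then have "?f (T x) = J x * ((x \<bullet> c) * (x \<bullet> c))" for x
    using J_radial[of "T x" x] by (simp add: Tj b)
  then have "(\<lambda>x. ?f (T x)) = (\<lambda>x. J x * ((x \<bullet> c) * (x \<bullet> c)))" by blast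
  then show ?thesis using lborel_swap_coordinates[of ?f b c] b unfolding T_def[symmetric] by simp
qed

lemma norm_moment_integrable: "integrable lborel (\<lambda>z. J z * (norm z)\<^sup>2)"
  by (rule J_mult_integrable[where C=1]) (auto simp: power_le_one)

lemma diffusivity_eq: "diffusivity J = (LINT z|lborel. J z * (norm z)\<^sup>2) / (2 * real DIM('a))"
  unfolding diffusivity_def by (subst integral_completion) (auto simp: mult.commute)

lemma second_moment: "(LINT z|lborel. J z * (z \<bullet> \<eta>)\<^sup>2) = 2 * diffusivity J * (norm \<eta>)\<^sup>2"
proof -
  obtain b0 :: 'a where b0: "b0 \<in> Basis" using SOME_Basis by blast
  define m where "m = (LINT z|lborel. J z * ((z \<bullet> b0) * (z \<bullet> b0)))"
  have "(LINT z|lborel. J z * (norm z)\<^sup>2) = (LINT z|lborel. (\<Sum>b\<in>Basis. J z * ((z \<bullet> b) * (z \<bullet> b))))"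
    unfolding power2_norm_eq_inner
    by (intro Bochner_Integration.integral_cong refl) (subst euclidean_inner, simp add: sum_distrib_left)
  also have "\<dots> = (\<Sum>b\<in>(Basis::'a set). m)"
    unfolding m_def
    by (subst Bochner_Integration.integral_sum) (auto intro!: second_moment_integrable sum.cong equal_moments b0 simp del: sum_constant)
  finally have m: "m = 2 * diffusivity J"
    unfolding diffusivity_eq by simp
  have "(LINT z|lborel. J z * (z \<bullet> \<eta>)\<^sup>2)
      = (LINT z|lborel. (\<Sum>b\<in>Basis. \<Sum>c\<in>Basis. ((\<eta> \<bullet> b) * (\<eta> \<bullet> c)) * (J z * ((z \<bullet> b) * (z \<bullet> c)))))"
  proof (intro Bochner_Integration.integral_cong refl)
    fix z
    have "J z * (z \<bullet> \<eta>)\<^sup>2 = J z * ((\<Sum>b\<in>Basis. (z \<bullet> b) * (\<eta> \<bullet> b)) * (\<Sum>c\<in>Basis. (z \<bullet> c) * (\<eta> \<bullet> c)))"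
      unfolding power2_eq_square euclidean_inner[of z \<eta>] ..
    also have "\<dots> = (\<Sum>b\<in>Basis. \<Sum>c\<in>Basis. J z * ((z \<bullet> b) * (\<eta> \<bullet> b) * ((z \<bullet> c) * (\<eta> \<bullet> c))))"
      unfolding sum_product by (simp only: sum_distrib_left)
    also have "\<dots> = (\<Sum>b\<in>Basis. \<Sum>c\<in>Basis. ((\<eta> \<bullet> b) * (\<eta> \<bullet> c)) * (J z * ((z \<bullet> b) * (z \<bullet> c))))"
      by (intro sum.cong refl) (simp only: mult_ac)
    finally show "J z * (z \<bullet> \<eta>)\<^sup>2 = (\<Sum>b\<in>Basis. \<Sum>c\<in>Basis. ((\<eta> \<bullet> b) * (\<eta> \<bullet> c)) * (J z * ((z \<bullet> b) * (z \<bullet> c))))" .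
  qed
  also have "\<dots> = (\<Sum>b\<in>Basis. \<Sum>c\<in>Basis. ((\<eta> \<bullet> b) * (\<eta> \<bullet> c)) * (LINT z|lborel. J z * ((z \<bullet> b) * (z \<bullet> c))))"
    by (simp add: Bochner_Integration.integral_sum second_moment_integrable Bochner_Integration.integrable_sum)
  also have "\<dots> = (\<Sum>b\<in>Basis. \<Sum>c\<in>Basis. if b = c then (\<eta> \<bullet> b) * (\<eta> \<bullet> b) * m else 0)"
    by (intro sum.cong refl) (auto simp: cross_moment_zero m_def equal_moments[OF _ b0])
  also have "\<dots> = m * (\<eta> \<bullet> \<eta>)"
    unfolding euclidean_inner[of \<eta> \<eta>] by (simp add: sum_distrib_left mult_ac)
  finally show ?thesis by (simp add: m power2_norm_eq_inner)
qed

lemma diffusivity_pos: "0 < diffusivity J"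
proof -
  have nn: "0 \<le> (LINT z|lborel. J z * (norm z)\<^sup>2)"
    by (rule integral_nonneg_AE) (auto simp: J_nonneg)
  have "(LINT z|lborel. J z * (norm z)\<^sup>2) \<noteq> 0"
  proof
    assume "(LINT z|lborel. J z * (norm z)\<^sup>2) = 0"
    then have "AE z in lborel. J z * (norm z)\<^sup>2 = 0"
      using norm_moment_integrable by (subst (asm) integral_nonneg_eq_0_iff_AE) (auto simp: J_nonneg)
    moreover have "AE z in lborel. z \<noteq> (0::'a)" by (rule AE_lborel_singleton)
    ultimately have "AE z in lborel. J z = 0" by eventually_elim auto
    then have "(LINT z|lborel. J z) = 0" by (rule integral_eq_zero_AE)
    then show False using J_mass by simp
  qed
  then show ?thesis unfolding diffusivity_eq using nn by (simp add: less_le)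
qed

end

lemma cos_quadratic_lower:
  fixes \<theta> :: real
  assumes "\<bar>\<theta>\<bar> \<le> 1" shows "\<theta>\<^sup>2 / 4 \<le> 1 - cos \<theta>"
proof -
  define x where "x = \<theta> / 2"
  have x: "\<bar>x\<bar> \<le> 1/2" using assms by (simp add: x_def)
  have "\<bar>sin x - (\<Sum>m<3. sin_coeff m * x ^ m)\<bar> \<le> inverse (fact 3) * \<bar>x\<bar> ^ 3"
    by (rule Maclaurin_sin_bound)
  then have "\<bar>sin x - x\<bar> \<le> \<bar>x\<bar> ^ 3 / 6"
    by (simp add: eval_nat_numeral sin_coeff_def)
  moreover have "\<bar>x\<bar> ^ 3 \<le> \<bar>x\<bar>"
    using power_decreasing[of 1 3 "\<bar>x\<bar>"] x by simp
  ultimately have "\<bar>x\<bar> * (5/6) \<le> \<bar>sin x\<bar>" by linarith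
  then have "(\<bar>x\<bar> * (5/6))\<^sup>2 \<le> \<bar>sin x\<bar>\<^sup>2" by (intro power_mono) auto
  then have "x\<^sup>2 * (25/36) \<le> (sin x)\<^sup>2" by (simp add: power_mult_distrib power_divide)
  moreover have "1 - cos \<theta> = 2 * (sin x)\<^sup>2"
    using cos_double_sin[of x] by (simp add: x_def)
  moreover have "\<theta>\<^sup>2 / 4 = x\<^sup>2" by (simp add: x_def power_divide)
  ultimately show ?thesis using zero_le_power2[of x] by linarith
qed

lemma cos_quadratic_upper:
  fixes \<theta> :: real
  shows "1 - cos \<theta> \<le> \<theta>\<^sup>2 / 2"
proof -
  have "(sin (\<theta> / 2))\<^sup>2 \<le> (\<theta> / 2)\<^sup>2"
    using abs_sin_x_le_abs_x[of "\<theta> / 2"] abs_le_square_iff by blast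
  then show ?thesis using cos_double_sin[of "\<theta> / 2"] by (simp add: power_divide)
qed

text \<open>Doubling the frequency increases \<open>1 - cos\<close> at most fourfold, and bounds \<open>1 + cos\<close> from below as well. Integrated against \<open>J\<close>, this propagates a spectral gap from high frequencies down to all frequencies of norm at least 1.\<close>

lemma cos_double_angle_bound:
  fixes \<theta> :: real
  shows "1 - cos (2 * \<theta>) \<le> 4 * (1 - cos \<theta>)" "1 - cos (2 * \<theta>) \<le> 4 * (1 + cos \<theta>)"
proof -
  have e: "1 - cos (2 * \<theta>) = 2 * ((1 - cos \<theta>) * (1 + cos \<theta>))"
    by (simp add: cos_double_cos[of \<theta>] power2_eq_square right_diff_distrib left_diff_distrib distrib_left distrib_right)
  have "0 \<le> 1 - cos \<theta>" "0 \<le> 1 + cos \<theta>" using cos_ge_minus_one[of \<theta>] cos_le_one[of \<theta>] by linarith+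
  moreover have "1 - cos \<theta> \<le> 2" "1 + cos \<theta> \<le> 2" using cos_ge_minus_one[of \<theta>] cos_le_one[of \<theta>] by linarith+
  ultimately have 1: "(1 - cos \<theta>) * (1 + cos \<theta>) \<le> (1 - cos \<theta>) * 2" and 2: "(1 - cos \<theta>) * (1 + cos \<theta>) \<le> 2 * (1 + cos \<theta>)"
    using mult_left_mono[of "1 + cos \<theta>" 2 "1 - cos \<theta>"] mult_right_mono[of "1 - cos \<theta>" 2 "1 + cos \<theta>"] by blast+
  from 1 2 show "1 - cos (2 * \<theta>) \<le> 4 * (1 - cos \<theta>)" "1 - cos (2 * \<theta>) \<le> 4 * (1 + cos \<theta>)"
    unfolding e by linarith+
qed

lemma abs_four_cos_le_8:
  fixes s :: real
  shows "\<bar>4 * (1 - cos s)\<bar> \<le> 8" "\<bar>4 * (1 + cos s)\<bar> \<le> 8"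
proof -
  have "- 1 \<le> cos s" "cos s \<le> 1" by auto
  then show "\<bar>4 * (1 - cos s)\<bar> \<le> 8" "\<bar>4 * (1 + cos s)\<bar> \<le> 8"
    unfolding right_diff_distrib distrib_left by linarith+
qed

lemma cos_scaling_limit:
  fixes a :: real
  shows "((\<lambda>t. t * (1 - cos (a / sqrt t))) \<longlongrightarrow> a\<^sup>2 / 2) at_top"
proof -
  have "((\<lambda>t. t * (1 - cos (a / sqrt t))) \<longlongrightarrow> a * a / 2) at_top"
    by real_asymp
  then show ?thesis by (simp only: power2_eq_square)
qed

context radial_density
begin

lemma Jhat_near: assumes "norm \<xi> \<le> 1" shows "diffusivity J / 2 * (norm \<xi>)\<^sup>2 \<le> 1 - Jhat \<xi>"
proof -
  have i: "integrable lborel (\<lambda>z. J z * (z \<bullet> \<xi>)\<^sup>2)"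
    using second_moment_integrable[of \<xi> \<xi>] by (simp add: power2_eq_square)
  have "(LINT z|lborel. J z * ((z \<bullet> \<xi>)\<^sup>2 / 4)) \<le> (LINT z|lborel. J z * (1 - cos (z \<bullet> \<xi>)))"
  proof (rule J_mult_mono)
    show "integrable lborel (\<lambda>z. J z * ((z \<bullet> \<xi>)\<^sup>2 / 4))" using i by simp
    show "integrable lborel (\<lambda>z. J z * (1 - cos (z \<bullet> \<xi>)))" using J_integrable by (simp add: right_diff_distrib)
    fix z :: 'a assume "norm z \<le> 1"
    then have "\<bar>z \<bullet> \<xi>\<bar> \<le> 1" using inner_le_unit[of z \<xi>] assms by linarith
    then show "(z \<bullet> \<xi>)\<^sup>2 / 4 \<le> 1 - cos (z \<bullet> \<xi>)" by (rule cos_quadratic_lower)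
  qed
  then show ?thesis by (simp add: one_minus_Jhat second_moment)
qed

text \<open>The only trace of \<open>J\<close> that survives diffusive scaling is its second moment.\<close>

lemma Jhat_scaling_limit:
  "((\<lambda>t. t * (1 - Jhat ((1 / sqrt t) *\<^sub>R \<eta>))) \<longlongrightarrow> diffusivity J * (norm \<eta>)\<^sup>2) at_top"
proof -
  have i: "integrable lborel (\<lambda>z. J z * ((z \<bullet> \<eta>)\<^sup>2 / 2))"
    using second_moment_integrable[of \<eta> \<eta>] by (simp add: power2_eq_square)
  have "((\<lambda>t. LINT z|lborel. J z * (t * (1 - cos (z \<bullet> \<eta> / sqrt t)))) \<longlongrightarrow> (LINT z|lborel. J z * ((z \<bullet> \<eta>)\<^sup>2 / 2))) at_top"
  proof (rule integral_dominated_convergence_at_top[where w="\<lambda>z. J z * ((z \<bullet> \<eta>)\<^sup>2 / 2)"])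
    show "\<forall>\<^sub>F t in at_top. AE z in lborel. norm (J z * (t * (1 - cos (z \<bullet> \<eta> / sqrt t)))) \<le> J z * ((z \<bullet> \<eta>)\<^sup>2 / 2)"
    proof (rule eventually_mono[OF eventually_gt_at_top[of 0]], rule AE_I2)
      fix t :: real and z assume t: "0 < t"
      have "t * (1 - cos (z \<bullet> \<eta> / sqrt t)) \<le> t * ((z \<bullet> \<eta> / sqrt t)\<^sup>2 / 2)"
        using t cos_quadratic_upper by (intro mult_left_mono) auto
      also have "\<dots> = (z \<bullet> \<eta>)\<^sup>2 / 2" using t by (simp add: power_divide)
      finally show "norm (J z * (t * (1 - cos (z \<bullet> \<eta> / sqrt t)))) \<le> J z * ((z \<bullet> \<eta>)\<^sup>2 / 2)"
        using t cos_le_one[of "z \<bullet> \<eta> / sqrt t"]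
          mult_left_mono[OF _ J_nonneg, of "t * (1 - cos (z \<bullet> \<eta> / sqrt t))" "(z \<bullet> \<eta>)\<^sup>2 / 2" z]
        by (simp add: abs_mult J_nonneg)
    qed
    show "AE z in lborel. ((\<lambda>t. J z * (t * (1 - cos (z \<bullet> \<eta> / sqrt t)))) \<longlongrightarrow> J z * ((z \<bullet> \<eta>)\<^sup>2 / 2)) at_top"
      by (intro AE_I2 tendsto_mult tendsto_const cos_scaling_limit)
  qed (use i in auto)
  moreover have "(LINT z|lborel. J z * (t * (1 - cos (z \<bullet> \<eta> / sqrt t)))) = t * (1 - Jhat ((1 / sqrt t) *\<^sub>R \<eta>))" for t
    unfolding one_minus_Jhat
    by (subst integral_mult_right_zero[symmetric]) (simp add: mult_ac divide_inverse)
  ultimately show ?thesis by (simp add: second_moment)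
qed

lemma J_shift_uniform:
  assumes "0 < e" shows "\<exists>d>0. \<forall>z h. norm h \<le> d \<longrightarrow> \<bar>J z - J (z + h)\<bar> \<le> e"
proof -
  have "uniformly_continuous_on (cball 0 3) J"
    by (rule compact_uniformly_continuous) (auto intro: continuous_on_subset[OF J_continuous])
  then obtain d where d: "d > 0" "\<And>x y. x \<in> cball 0 3 \<Longrightarrow> y \<in> cball 0 3 \<Longrightarrow> dist y x < d \<Longrightarrow> dist (J y) (J x) < e"
    using assms unfolding uniformly_continuous_on_def by metis
  have "\<bar>J z - J (z + h)\<bar> \<le> e" if h: "norm h \<le> min (d/2) 1" for z h
  proof (cases "norm z \<le> 2")
    case True
    have "norm (z + h) \<le> 3" using norm_triangle_ineq[of z h] True h by simp
    then show ?thesis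
      using d(2)[of z "z + h"] True h d(1) by (simp only: mem_cball_0) (simp add: dist_norm abs_minus_commute)
  next
    case False
    have "norm z \<le> norm (z + h) + norm h" using norm_triangle_ineq4[of "z + h" h] by simp
    then have "1 < norm (z + h)" using False h by linarith
    then show ?thesis using False assms by (simp add: J_support)
  qed
  then show ?thesis using d(1) by (intro exI[of _ "min (d/2) 1"]) auto
qed

text \<open>The Riemann-Lebesgue argument: shifting by half a period changes the sign of the wave, so that twice the transform is the integral of the difference of \<open>J\<close> and a close translate of it.\<close>

lemma Jhat_half_at_infinity: "\<exists>R>0. \<forall>\<xi>. R \<le> norm \<xi> \<longrightarrow> \<bar>Jhat \<xi>\<bar> \<le> 1/2"
proof -
  define V where "V = measure lborel (cball (0::'a) 2)"
  have V: "0 \<le> V" by (simp add: V_def)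
  obtain d where d: "d > 0" "\<And>z h. norm h \<le> d \<Longrightarrow> \<bar>J z - J (z + h)\<bar> \<le> 1 / (V + 1)"
    using J_shift_uniform[of "1 / (V + 1)"] V by auto
  have "\<bar>Jhat \<xi>\<bar> \<le> 1/2" if xi: "max (pi / d) pi \<le> norm \<xi>" for \<xi>
  proof -
    have n0: "0 < norm \<xi>" using xi d(1) pi_gt_zero by (meson less_le_trans max.cobounded2)
    \<comment> \<open>Half a period of the wave, in the direction of the frequency.\<close>
    define h where "h = (pi / (norm \<xi>)\<^sup>2) *\<^sub>R \<xi>"
    have nh: "norm h = pi / norm \<xi>" using n0 by (simp add: h_def power2_eq_square)
    have h: "norm h \<le> d" "norm h \<le> 1" unfolding nh using xi n0 d(1) by (auto simp: field_simps)
    have hx: "h \<bullet> \<xi> = pi" using n0 by (simp add: h_def power2_norm_eq_inner)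
    have int: "integrable lborel (\<lambda>z. J (h + z) * cos ((h + z) \<bullet> \<xi>))"
      using lborel_affine_integral(2)[of "\<lambda>z. J z * cos (z \<bullet> \<xi>)" 1 h] by simp
    have Jh: "Jhat \<xi> = (LINT z|lborel. J (h + z) * cos ((h + z) \<bullet> \<xi>))"
      unfolding Jhat_def using lborel_affine_integral(1)[of "\<lambda>z. J z * cos (z \<bullet> \<xi>)" 1 h] by simp
    have c: "cos ((h + z) \<bullet> \<xi>) = - cos (z \<bullet> \<xi>)" for z
      by (simp add: inner_add_left hx cos_add)
    have int2: "integrable lborel (\<lambda>z. J (z + h) * cos (z \<bullet> \<xi>))"
      using int unfolding c by (simp add: add.commute)
    from Jh c have "2 * Jhat \<xi> = (LINT z|lborel. J z * cos (z \<bullet> \<xi>) - J (h + z) * cos (z \<bullet> \<xi>))"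
      using int by (subst Bochner_Integration.integral_diff) (auto simp: Jhat_def)
    also have "(\<lambda>z. J z * cos (z \<bullet> \<xi>) - J (h + z) * cos (z \<bullet> \<xi>)) = (\<lambda>z. (J z - J (z + h)) * cos (z \<bullet> \<xi>))"
      by (auto simp: algebra_simps)
    finally have e: "2 * Jhat \<xi> = (LINT z|lborel. (J z - J (z + h)) * cos (z \<bullet> \<xi>))" .
    have "norm (LINT z|lborel. (J z - J (z + h)) * cos (z \<bullet> \<xi>)) \<le> (LINT z|lborel. 1 / (V + 1) * indicator (cball (0::'a) 2) z)"
      unfolding real_norm_def
    proof (rule Bochner_Integration.integral_abs_bound_integral)
      show "integrable lborel (\<lambda>z. (J z - J (z + h)) * cos (z \<bullet> \<xi>))"
        unfolding left_diff_distrib using int2 by (intro Bochner_Integration.integrable_diff J_cos_integrable)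
      show "integrable lborel (\<lambda>z. 1 / (V + 1) * indicator (cball (0::'a) 2) z)"
        by (intro integrable_mult_right integrable_real_indicator) (use emeasure_bounded_finite[OF bounded_cball[of "0::'a" 2]] in \<open>auto simp: less_top\<close>)
      fix z :: 'a
      show "\<bar>(J z - J (z + h)) * cos (z \<bullet> \<xi>)\<bar> \<le> 1 / (V + 1) * indicator (cball 0 2) z"
      proof (cases "norm z \<le> 2")
        case True
        then show ?thesis
          using mult_mono[OF d(2)[OF h(1), of z] abs_cos_le_one[of "z \<bullet> \<xi>"]] V by (simp add: abs_mult)
      next
        case False
        have "norm z \<le> norm (z + h) + norm h" using norm_triangle_ineq4[of "z + h" h] by simp
        then have "1 < norm (z + h)" using False h by linarith
        then show ?thesis using False by (simp add: J_support)
      qed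
    qed
    also have "\<dots> = V / (V + 1)" by (simp add: V_def)
    also have "\<dots> \<le> 1" using V by (simp add: field_simps)
    finally show ?thesis unfolding e[symmetric] by simp
  qed
  then show ?thesis using d(1) by (intro exI[of _ "max (pi / d) pi"]) (auto simp: less_max_iff_disj)
qed

text \<open>Both signs matter: a transform near -1 would be as harmful as one near 1. The bound is 1/2 at infinity, and each application of the doubling inequality halves the radius outside which there is a gap.\<close>

lemma Jhat_far: "\<exists>\<rho><1. 0 < \<rho> \<and> (\<forall>\<xi>. 1 \<le> norm \<xi> \<longrightarrow> \<bar>Jhat \<xi>\<bar> \<le> \<rho>)"
proof -
  obtain R where R: "\<And>\<xi>. R \<le> norm \<xi> \<Longrightarrow> \<bar>Jhat \<xi>\<bar> \<le> 1/2"
    using Jhat_half_at_infinity by blast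
  have dbl: "1 - Jhat (2 *\<^sub>R \<xi>) \<le> 4 * (1 - Jhat \<xi>)" "1 - Jhat (2 *\<^sub>R \<xi>) \<le> 4 * (1 + Jhat \<xi>)" for \<xi>
  proof -
    have i: "integrable lborel (\<lambda>z. J z * (1 - cos (z \<bullet> 2 *\<^sub>R \<xi>)))" for \<xi>
      unfolding right_diff_distrib using J_integrable J_cos_integrable[of "2 *\<^sub>R \<xi>"]
      by (intro Bochner_Integration.integrable_diff) simp_all
    have i1: "integrable lborel (\<lambda>z. J z * (4 * (1 - cos (z \<bullet> \<xi>))))"
      and i2: "integrable lborel (\<lambda>z. J z * (4 * (1 + cos (z \<bullet> \<xi>))))"
      by (rule J_mult_integrable[where C=8]; use abs_four_cos_le_8 in measurable)+
    have "(LINT z|lborel. J z * (1 - cos (z \<bullet> 2 *\<^sub>R \<xi>))) \<le> (LINT z|lborel. J z * (4 * (1 - cos (z \<bullet> \<xi>))))"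
      using cos_double_angle_bound(1)[of "_ \<bullet> \<xi>"] by (intro J_mult_mono i i1) simp_all
    then show "1 - Jhat (2 *\<^sub>R \<xi>) \<le> 4 * (1 - Jhat \<xi>)"
      unfolding one_minus_Jhat by (subst integral_mult_right_zero[symmetric]) (simp add: mult.left_commute)
    have "(LINT z|lborel. J z * (1 - cos (z \<bullet> 2 *\<^sub>R \<xi>))) \<le> (LINT z|lborel. J z * (4 * (1 + cos (z \<bullet> \<xi>))))"
      using cos_double_angle_bound(2)[of "_ \<bullet> \<xi>"] by (intro J_mult_mono i i2) simp_all
    then show "1 - Jhat (2 *\<^sub>R \<xi>) \<le> 4 * (1 + Jhat \<xi>)"
      unfolding one_minus_Jhat one_plus_Jhat by (subst integral_mult_right_zero[symmetric]) (simp add: mult.left_commute)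
  qed
  have main: "\<forall>\<xi>. R / 2 ^ n \<le> norm \<xi> \<longrightarrow> \<bar>Jhat \<xi>\<bar> \<le> 1 - 1 / (2 * 4 ^ n)" for n
  proof (induction n)
    case 0
    then show ?case using R by simp
  next
    case (Suc n)
    show ?case
    proof (intro allI impI)
      fix \<xi> :: 'a assume "R / 2 ^ Suc n \<le> norm \<xi>"
      then have le: "R / 2 ^ n \<le> norm (2 *\<^sub>R \<xi>)" by (simp add: field_simps)
      define e :: real where "e = 1 / (2 * 4 ^ n)"
      have "e \<le> 1 - Jhat (2 *\<^sub>R \<xi>)"
        using Suc[rule_format, OF le] unfolding e_def abs_le_iff by linarith
      then have "e \<le> 4 * 1 - 4 * Jhat \<xi>" "e \<le> 4 * 1 + 4 * Jhat \<xi>"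
        using dbl[of \<xi>] unfolding right_diff_distrib distrib_left by linarith+
      moreover have "1 / (2 * 4 ^ Suc n) = e / 4" by (simp add: e_def)
      ultimately show "\<bar>Jhat \<xi>\<bar> \<le> 1 - 1 / (2 * 4 ^ Suc n)" by (simp add: abs_le_iff)
    qed
  qed
  obtain n :: nat where n: "R < 2 ^ n" using real_arch_pow[of 2 R] by auto
  let ?r = "1 - 1 / (2 * 4 ^ n) :: real"
  have "(1::real) < 2 * 4 ^ n" using one_le_power[of "4::real" n] by linarith
  then have "0 < ?r" by simp
  moreover have "\<bar>Jhat \<xi>\<bar> \<le> ?r" if "1 \<le> norm \<xi>" for \<xi>
  proof -
    have "R / 2 ^ n \<le> 1" using n by (simp add: field_simps)
    then have "R / 2 ^ n \<le> norm \<xi>" using that by linarith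
    then show ?thesis using main[of n] by blast
  qed
  ultimately show ?thesis by (intro exI[of _ ?r]) auto
qed

end

section \<open>The heat kernel\<close>

lemma heat_kernel_nonneg: "0 \<le> heat_kernel a x t"
  by (simp add: heat_kernel_def)

lemma heat_kernel_le:
  assumes "0 < a" "0 < t" shows "heat_kernel a (x::'a::euclidean_space) t \<le> (4 * pi * a * t) powr (- real DIM('a) / 2)"
proof -
  have "exp (- (norm x)\<^sup>2 / (4 * a * t)) \<le> 1" using assms by simp
  then show ?thesis unfolding heat_kernel_def by (intro mult_right_le_one_le) auto
qed

lemma heat_kernel_fourier:
  fixes x :: "'a::euclidean_space"
  assumes "0 < a" "0 < t"
  shows "heat_kernel a x t = (LINT \<xi>|lborel. exp (- (a * t) * (norm \<xi>)\<^sup>2) * cos (x \<bullet> \<xi>)) / (2 * pi) ^ DIM('a)"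
proof -
  have at: "0 < a * t" using assms by simp
  let ?p = "real DIM('a) / 2"
  have "(2 * pi) ^ DIM('a) = (2 * pi) powr (2 * ?p)" by (simp add: powr_realpow)
  also have "\<dots> = ((2 * pi) powr 2) powr ?p" by (simp only: powr_powr)
  also have "(2 * pi) powr 2 = (2 * pi)\<^sup>2" by (rule powr_numeral) simp
  finally have F: "(2 * pi) ^ DIM('a) = ((2 * pi)\<^sup>2) powr ?p" .
  have "(pi / (a * t)) powr ?p / (2 * pi) ^ DIM('a) = ((pi / (a * t)) / (2 * pi)\<^sup>2) powr ?p"
    unfolding F by (rule powr_divide[symmetric])
  also have "(pi / (a * t)) / (2 * pi)\<^sup>2 = inverse (4 * pi * a * t)"
    by (simp add: power2_eq_square field_simps)
  also have "\<dots> powr ?p = (4 * pi * a * t) powr (- ?p)"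
    unfolding powr_minus by (rule inverse_powr)
  finally have G: "(pi / (a * t)) powr ?p / (2 * pi) ^ DIM('a) = (4 * pi * a * t) powr (- ?p)" .
  have "heat_kernel a x t = (4 * pi * a * t) powr (- ?p) * exp (- (norm x)\<^sup>2 / (4 * (a * t)))"
    by (simp add: heat_kernel_def mult.assoc)
  also have "\<dots> = ((pi / (a * t)) powr ?p * exp (- (norm x)\<^sup>2 / (4 * (a * t)))) / (2 * pi) ^ DIM('a)"
    by (simp only: G[symmetric] times_divide_eq_left)
  finally show ?thesis by (simp only: gaussian_fourier(2)[OF at])
qed

lemma heat_kernel_borel [measurable]: "(\<lambda>x. heat_kernel a x t) \<in> borel_measurable borel"
  unfolding heat_kernel_def by measurable

lemma heat_kernel_mass:
  assumes "0 < a" "0 < t"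
  shows "integrable lborel (\<lambda>x::'a::euclidean_space. heat_kernel a x t)"
    and "(LINT x|lborel. heat_kernel a (x::'a) t) = 1"
proof -
  define c where "c = 1 / (4 * a * t)"
  have c: "0 < c" using assms by (simp add: c_def)
  have e: "heat_kernel a x t = (4 * pi * a * t) powr (- (real DIM('a) / 2)) * exp (- c * (norm x)\<^sup>2)" for x :: 'a
    by (simp add: heat_kernel_def c_def)
  show "integrable lborel (\<lambda>x::'a. heat_kernel a x t)"
    unfolding e by (rule integrable_mult_right[OF gaussian_integrable[OF c]])
  have "pi / c = 4 * pi * a * t" by (simp add: c_def)
  then show "(LINT x|lborel. heat_kernel a (x::'a) t) = 1"
    unfolding e using gaussian_fourier(2)[OF c, of "0::'a"] assms
    by (simp add: powr_minus)
qed

text \<open>The Gaussian of variance tending to 0 is a rescaling of one fixed density, which makes it an approximate identity by dominated convergence.\<close>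

lemma heat_kernel_scale:
  assumes "0 < a" "0 < t"
  shows "sqrt t ^ DIM('a) * heat_kernel a (sqrt t *\<^sub>R w) t = heat_kernel a (w::'a::euclidean_space) 1"
proof -
  have "sqrt t ^ DIM('a) = t powr (real DIM('a) / 2)"
    using assms by (simp add: powr_half_sqrt[symmetric] powr_realpow[symmetric] powr_powr)
  moreover have "(4 * pi * a * t) powr (- real DIM('a) / 2) = (4 * pi * a) powr (- real DIM('a) / 2) * t powr (- (real DIM('a) / 2))"
    using assms by (subst powr_mult) auto
  moreover have "t powr (real DIM('a) / 2) * t powr (- (real DIM('a) / 2)) = 1"
    using assms by (simp add: powr_add[symmetric])
  moreover have "(norm (sqrt t *\<^sub>R w))\<^sup>2 / (4 * a * t) = (norm w)\<^sup>2 / (4 * a)"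
    using assms by (simp add: power_mult_distrib)
  ultimately show ?thesis
    unfolding heat_kernel_def by (simp add: mult_ac)
qed

section \<open>Fourier representation of the walk\<close>

context radial_density
begin

text \<open>A step multiplies the symbol of a superposition of eigenfunctions by the transform of \<open>J\<close>. It is used for plane waves and for \<open>wave f\<close> below.\<close>

lemma step_fourier_integral:
  assumes g: "integrable lborel g"
    and e [measurable]: "case_prod e \<in> borel_measurable (borel \<Otimes>\<^sub>M borel)"
    and E: "\<And>\<xi> x. \<bar>e \<xi> x\<bar> \<le> E"
    and eig: "\<And>\<xi> x. free.step (e \<xi>) x = Jhat \<xi> * e \<xi> x"
  shows "free.step (\<lambda>x. LINT \<xi>|lborel. g \<xi> * e \<xi> x) x = (LINT \<xi>|lborel. g \<xi> * Jhat \<xi> * e \<xi> x)"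
proof -
  have "integrable (lborel \<Otimes>\<^sub>M lborel) (\<lambda>(\<xi>, y). g \<xi> * J (x - y) * e \<xi> y)"
    by (rule integrable_product_bounded[OF g J_shift_integrable e E])
  from lborel_pair.Fubini_integral[OF this]
  have "(LINT y|lborel. (LINT \<xi>|lborel. g \<xi> * J (x - y) * e \<xi> y)) = (LINT \<xi>|lborel. (LINT y|lborel. g \<xi> * J (x - y) * e \<xi> y))" .
  moreover have "(LINT \<xi>|lborel. g \<xi> * J (x - y) * e \<xi> y) = J (x - y) * (LINT \<xi>|lborel. g \<xi> * e \<xi> y)" for y
    by (subst integral_mult_right_zero[symmetric]) (simp add: mult_ac)
  moreover have "(LINT y|lborel. g \<xi> * J (x - y) * e \<xi> y) = g \<xi> * Jhat \<xi> * e \<xi> x" for \<xi>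
    using eig[of \<xi> x] by (simp add: free.step_def mult.assoc)
  ultimately show ?thesis by (simp add: free.step_def[of "\<lambda>x. LINT \<xi>|lborel. g \<xi> * e \<xi> x"])
qed

lemma step_heat_kernel_fourier:
  assumes "0 < t"
  shows "free.step (free.step (\<lambda>x. heat_kernel 1 x t)) x
     = (LINT \<xi>|lborel. exp (- t * (norm \<xi>)\<^sup>2) * (Jhat \<xi>)\<^sup>2 * cos (x \<bullet> \<xi>)) / (2 * pi) ^ DIM('a)"
proof -
  let ?c = "1 / (2 * pi) ^ DIM('a)"
  have e: "case_prod (\<lambda>\<xi> x::'a. cos (x \<bullet> \<xi>)) \<in> borel_measurable (borel \<Otimes>\<^sub>M borel)" by measurable
  have eig: "free.step (\<lambda>x. cos (x \<bullet> \<xi>)) x = Jhat \<xi> * cos (x \<bullet> \<xi>)" for \<xi> x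
    using step_cos[of 0] by simp
  have g: "integrable lborel (\<lambda>\<xi>::'a. exp (- t * (norm \<xi>)\<^sup>2))" by (rule gaussian_integrable[OF assms])
  have bJ: "bbound Jhat 1" using Jhat_le_1 by (auto simp: bbound_def)
  have g2: "integrable lborel (\<lambda>\<xi>::'a. exp (- t * (norm \<xi>)\<^sup>2) * Jhat \<xi>)"
    by (rule integrable_mult_bbound(1)[OF g bJ])
  have hk: "(\<lambda>x::'a. heat_kernel 1 x t) = (\<lambda>x. ?c * (LINT \<xi>|lborel. exp (- t * (norm \<xi>)\<^sup>2) * cos (x \<bullet> \<xi>)))"
    using heat_kernel_fourier[of 1 t] assms by auto
  have 1: "free.step (\<lambda>x. heat_kernel 1 x t) = (\<lambda>x. ?c * (LINT \<xi>|lborel. exp (- t * (norm \<xi>)\<^sup>2) * Jhat \<xi> * cos (x \<bullet> \<xi>)))"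
    unfolding hk free.step_cmult[abs_def] using step_fourier_integral[OF g e _ eig, of 1] by (simp del: power_mult_distrib)
  show ?thesis
    unfolding 1 free.step_cmult using step_fourier_integral[OF g2 e _ eig, of 1]
    by (simp add: power2_eq_square mult.assoc)
qed

lemma step_heat_kernel_le:
  assumes C: "bbound J C" and t: "0 < t"
  shows "0 \<le> free.step (\<lambda>x. heat_kernel 1 x t) z" "free.step (\<lambda>x. heat_kernel 1 x t) z \<le> C"
proof -
  have m: "(LINT x|lborel. \<bar>heat_kernel 1 (x::'a) t\<bar>) = 1"
    using heat_kernel_mass(2)[of 1 t] t by (simp add: heat_kernel_nonneg)
  have "bbound (\<lambda>y. J (z - y)) C" using C by (auto simp: bbound_def)
  from integral_mult_bbound_le[OF heat_kernel_mass(1)[of 1 t] this] t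
  show "free.step (\<lambda>x. heat_kernel 1 x t) z \<le> C"
    unfolding free.step_def m by (simp add: mult.commute abs_le_iff)
  show "0 \<le> free.step (\<lambda>x. heat_kernel 1 x t) z"
    by (rule free.step_nonneg) (rule heat_kernel_nonneg)
qed

lemma heat_kernel_bbound: "0 < t \<Longrightarrow> bbound (\<lambda>x::'a. heat_kernel 1 x t) ((4 * pi * t) powr (- real DIM('a) / 2))"
  using heat_kernel_le[of 1 t] by (auto simp: bbound_def heat_kernel_nonneg)

text \<open>Let the walk jump twice from a narrow Gaussian and look at the origin. The value is the integral of the squared transform against a Gaussian cut-off, and it is at most the supremum of \<open>J\<close>. Fatou's lemma removes the cut-off.\<close>

lemma Jhat_square_integrable: "integrable lborel (\<lambda>\<xi>. (Jhat \<xi>)\<^sup>2)"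
proof -
  obtain C where C: "C > 0" "bbound J C" using J_bounded by blast
  define e where "e n = 1 / real (Suc n)" for n
  have e: "0 < e n" for n by (simp add: e_def)
  have e0: "e \<longlonglongrightarrow> 0" unfolding e_def by (rule LIMSEQ_Suc[OF lim_1_over_n])
  let ?c = "(2 * pi) ^ DIM('a)"
  define h where "h n \<xi> = exp (- e n * (norm \<xi>)\<^sup>2) * (Jhat \<xi>)\<^sup>2" for n and \<xi> :: 'a
  have [measurable]: "h n \<in> borel_measurable borel" for n unfolding h_def by measurable
  have hi: "integrable lborel (h n)" for n
    unfolding h_def
    by (rule integrable_mult_bbound(1)[OF gaussian_integrable[OF e], of _ 1])
       (use Jhat_le_1 in \<open>auto simp: bbound_def abs_square_le_1\<close>)
  have hb: "(LINT \<xi>|lborel. h n \<xi>) \<le> C * ?c" for n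
  proof -
    have "free.step (free.step (\<lambda>x. heat_kernel 1 x (e n))) 0 \<le> free.step (\<lambda>_. C) 0"
      by (rule free.step_mono[OF free.bbound_step[OF heat_kernel_bbound[OF e]] bbound_const])
         (rule step_heat_kernel_le(2)[OF C(2) e])
    also have "\<dots> = C" using free.step_cmult[of C "\<lambda>_. 1" 0] by (simp add: free_step_1)
    finally show ?thesis
      unfolding step_heat_kernel_fourier[OF e] by (simp add: h_def field_simps)
  qed
  have "(\<integral>\<^sup>+ \<xi>. ennreal ((Jhat \<xi>)\<^sup>2) \<partial>lborel) = (\<integral>\<^sup>+ \<xi>. liminf (\<lambda>n. ennreal (h n \<xi>)) \<partial>lborel)"
  proof (rule nn_integral_cong)
    fix \<xi> :: 'a
    have "(\<lambda>n. h n \<xi>) \<longlonglongrightarrow> exp (- 0 * (norm \<xi>)\<^sup>2) * (Jhat \<xi>)\<^sup>2"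
      unfolding h_def by (intro tendsto_intros e0)
    then have "(\<lambda>n. ennreal (h n \<xi>)) \<longlonglongrightarrow> ennreal ((Jhat \<xi>)\<^sup>2)" by simp
    then show "ennreal ((Jhat \<xi>)\<^sup>2) = liminf (\<lambda>n. ennreal (h n \<xi>))"
      by (metis lim_imp_Liminf trivial_limit_sequentially)
  qed
  also have "\<dots> \<le> liminf (\<lambda>n. \<integral>\<^sup>+ \<xi>. ennreal (h n \<xi>) \<partial>lborel)"
    by (rule nn_integral_liminf) measurable
  also have "\<dots> \<le> liminf (\<lambda>n::nat. ennreal (C * ?c))"
  proof (rule Liminf_mono, rule always_eventually, rule allI)
    fix n
    have "(\<integral>\<^sup>+ \<xi>. ennreal (h n \<xi>) \<partial>lborel) = ennreal (LINT \<xi>|lborel. h n \<xi>)"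
      by (rule nn_integral_eq_integral[OF hi]) (simp add: h_def)
    also have "\<dots> \<le> ennreal (C * ?c)" by (rule ennreal_leI[OF hb])
    finally show "(\<integral>\<^sup>+ \<xi>. ennreal (h n \<xi>) \<partial>lborel) \<le> ennreal (C * ?c)" .
  qed
  also have "\<dots> = ennreal (C * ?c)" by (simp add: Liminf_const)
  also have "\<dots> < \<infinity>" by simp
  finally show ?thesis by (intro integrableI_bounded) auto
qed

lemma step_heat_kernel_limit:
  "(\<lambda>n. free.step (\<lambda>x. heat_kernel 1 x (1 / real (Suc n))) z) \<longlonglongrightarrow> J z"
proof -
  obtain C where C: "C > 0" "bbound J C" using J_bounded by blast
  define e where "e n = 1 / real (Suc n)" for n
  have e: "0 < e n" for n by (simp add: e_def)
  have e0: "e \<longlonglongrightarrow> 0" unfolding e_def by (rule LIMSEQ_Suc[OF lim_1_over_n])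
  have eq: "free.step (\<lambda>x. heat_kernel 1 x (e n)) z = (LINT w|lborel. J (z - sqrt (e n) *\<^sub>R w) * heat_kernel 1 w 1)" for n
  proof -
    have "free.step (\<lambda>x. heat_kernel 1 x (e n)) z
       = sqrt (e n) ^ DIM('a) * (LINT w|lborel. J (z - sqrt (e n) *\<^sub>R w) * heat_kernel 1 (sqrt (e n) *\<^sub>R w) (e n))"
      unfolding free.step_def using e[of n]
      using lborel_affine_integral(1)[of "\<lambda>y. J (z - y) * heat_kernel 1 y (e n)" "sqrt (e n)" 0] by simp
    also have "\<dots> = (LINT w|lborel. J (z - sqrt (e n) *\<^sub>R w) * (sqrt (e n) ^ DIM('a) * heat_kernel 1 (sqrt (e n) *\<^sub>R w) (e n)))"
      by (subst integral_mult_right_zero[symmetric]) (simp add: mult_ac)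
    finally show ?thesis using e[of n] by (simp add: heat_kernel_scale)
  qed
  have "(\<lambda>n. LINT w|lborel. J (z - sqrt (e n) *\<^sub>R w) * heat_kernel 1 w 1) \<longlonglongrightarrow> (LINT w|lborel. J z * heat_kernel 1 (w::'a) 1)"
  proof (rule integral_dominated_convergence[where w="\<lambda>w. C * heat_kernel 1 (w::'a) 1"])
    show "AE w in lborel. (\<lambda>n. J (z - sqrt (e n) *\<^sub>R w) * heat_kernel 1 w 1) \<longlonglongrightarrow> J z * heat_kernel 1 w 1"
    proof (rule AE_I2)
      fix w :: 'a
      have "(\<lambda>n. z - sqrt (e n) *\<^sub>R w) \<longlonglongrightarrow> z - sqrt 0 *\<^sub>R w" by (intro tendsto_intros e0)
      then have "(\<lambda>n. J (z - sqrt (e n) *\<^sub>R w)) \<longlonglongrightarrow> J z"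
        using J_continuous continuous_on_tendsto_compose[of UNIV J "\<lambda>n. z - sqrt (e n) *\<^sub>R w" z] by simp
      then show "(\<lambda>n. J (z - sqrt (e n) *\<^sub>R w) * heat_kernel 1 w 1) \<longlonglongrightarrow> J z * heat_kernel 1 w 1"
        by (intro tendsto_intros)
    qed
    show "AE w in lborel. norm (J (z - sqrt (e n) *\<^sub>R w) * heat_kernel 1 w 1) \<le> C * heat_kernel 1 w 1" for n
      using bboundD(2)[OF C(2)] by (auto simp: abs_mult heat_kernel_nonneg intro!: mult_right_mono)
  qed (use heat_kernel_mass(1)[of 1 1] in auto)
  then show ?thesis
    unfolding eq[symmetric] using heat_kernel_mass(2)[of 1 1, where ?'a='a] by (simp add: e_def)
qed

text \<open>Fourier inversion for \<open>J * J\<close>, by the same Gaussian regularisation.\<close>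

lemma J_square_inversion:
  "free.step J x = (LINT \<xi>|lborel. (Jhat \<xi>)\<^sup>2 * cos (x \<bullet> \<xi>)) / (2 * pi) ^ DIM('a)"
proof -
  obtain C where C: "C > 0" "bbound J C" using J_bounded by blast
  define e where "e n = 1 / real (Suc n)" for n
  have e: "0 < e n" for n by (simp add: e_def)
  have e0: "e \<longlonglongrightarrow> 0" unfolding e_def by (rule LIMSEQ_Suc[OF lim_1_over_n])
  define s where "s n = free.step (\<lambda>x. heat_kernel 1 x (e n))" for n
  have sb: "bbound (s n) ((4 * pi * e n) powr (- real DIM('a) / 2))" for n
    unfolding s_def by (rule free.bbound_step[OF heat_kernel_bbound[OF e]])
  have [measurable]: "s n \<in> borel_measurable borel" for n using bboundD(1)[OF sb] .
  have "(\<lambda>n. LINT y|lborel. J (x - y) * s n y) \<longlonglongrightarrow> (LINT y|lborel. J (x - y) * J y)"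
  proof (rule integral_dominated_convergence[where w="\<lambda>y. C * J (x - y)"])
    show "integrable lborel (\<lambda>y. C * J (x - y))" using J_shift_integrable by simp
    show "AE y in lborel. (\<lambda>n. J (x - y) * s n y) \<longlonglongrightarrow> J (x - y) * J y"
      unfolding s_def e_def by (intro AE_I2 tendsto_mult tendsto_const step_heat_kernel_limit)
    show "AE y in lborel. norm (J (x - y) * s n y) \<le> C * J (x - y)" for n
      using step_heat_kernel_le[OF C(2) e]
      by (auto simp: abs_mult J_nonneg s_def mult.commute[of C] intro!: mult_left_mono)
  qed measurable
  then have 1: "(\<lambda>n. free.step (s n) x) \<longlonglongrightarrow> free.step J x" unfolding free.step_def .
  have "(\<lambda>n. LINT \<xi>|lborel. exp (- e n * (norm \<xi>)\<^sup>2) * (Jhat \<xi>)\<^sup>2 * cos (x \<bullet> \<xi>)) \<longlonglongrightarrow> (LINT \<xi>|lborel. (Jhat \<xi>)\<^sup>2 * cos (x \<bullet> \<xi>))"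
  proof (rule integral_dominated_convergence[where w="\<lambda>\<xi>. (Jhat \<xi>)\<^sup>2"])
    show "AE \<xi> in lborel. (\<lambda>n. exp (- e n * (norm \<xi>)\<^sup>2) * (Jhat \<xi>)\<^sup>2 * cos (x \<bullet> \<xi>)) \<longlonglongrightarrow> (Jhat \<xi>)\<^sup>2 * cos (x \<bullet> \<xi>)"
    proof (rule AE_I2)
      fix \<xi> :: 'a
      have "(\<lambda>n. exp (- e n * (norm \<xi>)\<^sup>2) * (Jhat \<xi>)\<^sup>2 * cos (x \<bullet> \<xi>)) \<longlonglongrightarrow> exp (- 0 * (norm \<xi>)\<^sup>2) * (Jhat \<xi>)\<^sup>2 * cos (x \<bullet> \<xi>)"
        by (intro tendsto_intros e0)
      then show "(\<lambda>n. exp (- e n * (norm \<xi>)\<^sup>2) * (Jhat \<xi>)\<^sup>2 * cos (x \<bullet> \<xi>)) \<longlonglongrightarrow> (Jhat \<xi>)\<^sup>2 * cos (x \<bullet> \<xi>)" by simp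
    qed
    show "AE \<xi> in lborel. norm (exp (- e n * (norm \<xi>)\<^sup>2) * (Jhat \<xi>)\<^sup>2 * cos (x \<bullet> \<xi>)) \<le> (Jhat \<xi>)\<^sup>2" for n
    proof (rule AE_I2)
      fix \<xi> :: 'a
      have "exp (- e n * (norm \<xi>)\<^sup>2) * \<bar>cos (x \<bullet> \<xi>)\<bar> \<le> 1 * 1"
        using e[of n] by (intro mult_mono) (auto intro: mult_nonneg_nonneg less_imp_le)
      then show "norm (exp (- e n * (norm \<xi>)\<^sup>2) * (Jhat \<xi>)\<^sup>2 * cos (x \<bullet> \<xi>)) \<le> (Jhat \<xi>)\<^sup>2"
        using mult_left_mono[of "exp (- e n * (norm \<xi>)\<^sup>2) * \<bar>cos (x \<bullet> \<xi>)\<bar>" 1 "(Jhat \<xi>)\<^sup>2"]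
        by (simp add: abs_mult mult_ac)
    qed
  qed (use Jhat_square_integrable in auto)
  then have "(\<lambda>n. free.step (s n) x) \<longlonglongrightarrow> (LINT \<xi>|lborel. (Jhat \<xi>)\<^sup>2 * cos (x \<bullet> \<xi>)) / (2 * pi) ^ DIM('a)"
    unfolding s_def step_heat_kernel_fourier[OF e] by (intro tendsto_divide tendsto_const) auto
  with 1 show ?thesis using LIMSEQ_unique by blast
qed

end

lemma exp_minus_linear_bound:
  fixes y :: real
  shows "\<bar>exp y - 1 - y\<bar> \<le> y\<^sup>2 / 2 * exp \<bar>y\<bar>"
proof -
  obtain s where s: "\<bar>s\<bar> \<le> \<bar>y\<bar>" "exp y = (\<Sum>m<2. y ^ m / fact m) + exp s / fact 2 * y ^ 2"
    using Maclaurin_exp_le[of y 2] by blast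
  have "exp y - 1 - y = y\<^sup>2 / 2 * exp s" using s(2) by (simp add: eval_nat_numeral)
  then have "\<bar>exp y - 1 - y\<bar> = y\<^sup>2 / 2 * exp s" by (simp only: abs_mult) simp
  also have "\<dots> \<le> y\<^sup>2 / 2 * exp \<bar>y\<bar>" using s(1) by (intro mult_left_mono) auto
  finally show ?thesis .
qed

context radial_density
begin

text \<open>The contribution of the frequency \<open>\<xi>\<close> to \<open>f\<close>: a superposition of plane waves of that frequency, and hence an
  eigenfunction of the free walk.\<close>

definition wave :: "('a \<Rightarrow> real) \<Rightarrow> 'a \<Rightarrow> 'a \<Rightarrow> real" where
  "wave f \<xi> x = (LINT y|lborel. cos ((x - y) \<bullet> \<xi>) * f y)"

lemma wave_measurable [measurable]:
  assumes [measurable]: "f \<in> borel_measurable borel"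
  shows "case_prod (wave f) \<in> borel_measurable (borel \<Otimes>\<^sub>M borel)"
  unfolding wave_def[abs_def] case_prod_unfold
  by (rule lborel.borel_measurable_lebesgue_integral) measurable

lemma wave_bound:
  assumes f: "integrable lborel f"
  shows "\<bar>wave f \<xi> x\<bar> \<le> (LINT y|lborel. \<bar>f y\<bar>)"
  unfolding wave_def
proof (rule Bochner_Integration.integral_abs_bound_integral)
  show "integrable lborel (\<lambda>y. cos ((x - y) \<bullet> \<xi>) * f y)"
    by (rule integrable_mult_bbound(2)[OF f, of _ 1]) (auto simp: bbound_def)
  show "\<bar>cos ((x - y) \<bullet> \<xi>) * f y\<bar> \<le> \<bar>f y\<bar>" for y
    using mult_right_mono[OF abs_cos_le_one[of "(x - y) \<bullet> \<xi>"], of "\<bar>f y\<bar>"] by (simp add: abs_mult)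
qed (use f in auto)

lemma step_wave:
  assumes f: "integrable lborel f"
  shows "free.step (wave f \<xi>) x = Jhat \<xi> * wave f \<xi> x"
proof -
  have "integrable (lborel \<Otimes>\<^sub>M lborel) (\<lambda>(z, y). J (x - z) * f y * cos ((z - y) \<bullet> \<xi>))"
    by (rule integrable_product_bounded[OF J_shift_integrable f, of _ 1]) auto
  from lborel_pair.Fubini_integral[OF this]
  have "(LINT y|lborel. (LINT z|lborel. J (x - z) * f y * cos ((z - y) \<bullet> \<xi>)))
      = (LINT z|lborel. (LINT y|lborel. J (x - z) * f y * cos ((z - y) \<bullet> \<xi>)))" .
  moreover have "(LINT z|lborel. J (x - z) * f y * cos ((z - y) \<bullet> \<xi>)) = Jhat \<xi> * (cos ((x - y) \<bullet> \<xi>) * f y)" for y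
  proof -
    have "(LINT z|lborel. J (x - z) * f y * cos ((z - y) \<bullet> \<xi>)) = f y * free.step (\<lambda>z. cos ((z - y) \<bullet> \<xi>)) x"
      unfolding free.step_def by (subst integral_mult_right_zero[symmetric]) (simp add: mult_ac)
    then show ?thesis by (simp only: step_cos mult_ac)
  qed
  moreover have "(LINT y|lborel. J (x - z) * f y * cos ((z - y) \<bullet> \<xi>)) = J (x - z) * wave f \<xi> z" for z
    unfolding wave_def by (subst integral_mult_right_zero[symmetric]) (simp add: mult_ac)
  ultimately show ?thesis by (simp add: free.step_def[of "wave f \<xi>"]) (simp add: wave_def)
qed

lemma two_steps_wave:
  assumes f: "integrable lborel f"
  shows "free.step (free.step f) x = (LINT \<xi>|lborel. (Jhat \<xi>)\<^sup>2 * wave f \<xi> x) / (2 * pi) ^ DIM('a)"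
proof -
  obtain C where C: "C > 0" "bbound J C" using J_bounded by blast
  have [measurable]: "f \<in> borel_measurable borel" using f by auto
  have "integrable (lborel \<Otimes>\<^sub>M lborel) (\<lambda>(z, y). J (x - z) * f y * J (z - y))"
    by (rule integrable_product_bounded[OF J_shift_integrable f, of _ C]) (use bboundD(2)[OF C(2)] in auto)
  from lborel_pair.Fubini_integral[OF this]
  have 1: "(LINT y|lborel. (LINT z|lborel. J (x - z) * f y * J (z - y)))
      = (LINT z|lborel. (LINT y|lborel. J (x - z) * f y * J (z - y)))" .
  have 2: "(LINT z|lborel. J (x - z) * f y * J (z - y)) = f y * free.step J (x - y)" for y
  proof -
    have "(LINT z|lborel. J (x - z) * J (z - y)) = (LINT w|lborel. J (x - y - w) * J w)"
      using lborel_affine_integral(1)[of "\<lambda>z. J (x - z) * J (z - y)" 1 y] by (simp add: algebra_simps)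
    moreover have "(LINT z|lborel. J (x - z) * f y * J (z - y)) = f y * (LINT z|lborel. J (x - z) * J (z - y))"
      by (subst integral_mult_right_zero[symmetric]) (simp add: mult_ac)
    ultimately show ?thesis unfolding free.step_def by simp
  qed
  have 3: "(LINT y|lborel. J (x - z) * f y * J (z - y)) = J (x - z) * free.step f z" for z
    unfolding free.step_def by (subst integral_mult_right_zero[symmetric]) (simp add: mult_ac)
  have "free.step (free.step f) x = (LINT y|lborel. f y * free.step J (x - y))"
    using 1 unfolding 2 3 by (simp add: free.step_def[of "free.step f"])
  also have "\<dots> = (LINT y|lborel. (LINT \<xi>|lborel. (Jhat \<xi>)\<^sup>2 * f y * cos ((x - y) \<bullet> \<xi>))) / (2 * pi) ^ DIM('a)"
  proof -
    have "f y * free.step J (x - y) = (LINT \<xi>|lborel. (Jhat \<xi>)\<^sup>2 * f y * cos ((x - y) \<bullet> \<xi>)) / (2 * pi) ^ DIM('a)" for y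
    proof -
      have "(LINT \<xi>|lborel. (Jhat \<xi>)\<^sup>2 * f y * cos ((x - y) \<bullet> \<xi>)) = f y * (LINT \<xi>|lborel. (Jhat \<xi>)\<^sup>2 * cos ((x - y) \<bullet> \<xi>))"
        by (subst integral_mult_right_zero[symmetric]) (simp add: mult_ac)
      then show ?thesis by (simp only: J_square_inversion) simp
    qed
    then show ?thesis by simp
  qed
  also have "(LINT y|lborel. (LINT \<xi>|lborel. (Jhat \<xi>)\<^sup>2 * f y * cos ((x - y) \<bullet> \<xi>)))
     = (LINT \<xi>|lborel. (LINT y|lborel. (Jhat \<xi>)\<^sup>2 * f y * cos ((x - y) \<bullet> \<xi>)))"
    by (rule lborel_pair.Fubini_integral, rule integrable_product_bounded[OF Jhat_square_integrable f, of _ 1]) auto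
  also have "\<dots> = (LINT \<xi>|lborel. (Jhat \<xi>)\<^sup>2 * wave f \<xi> x)"
    unfolding wave_def by (subst integral_mult_right_zero[symmetric]) (simp add: mult_ac)
  finally show ?thesis .
qed

lemma Jhat_power_integrable: "integrable lborel (\<lambda>\<xi>. Jhat \<xi> ^ (n + 2))"
proof -
  have "bbound (\<lambda>\<xi>. Jhat \<xi> ^ n) 1"
    using Jhat_le_1 by (auto simp: bbound_def power_abs power_le_one)
  from integrable_mult_bbound(2)[OF Jhat_square_integrable this] show ?thesis by (simp only: power_add)
qed

text \<open>At least two steps are taken so that the symbol is dominated by the integrable square of the transform.\<close>

lemma steps_wave:
  assumes f: "integrable lborel f"
  shows "(free.step ^^ (n + 2)) f x = (LINT \<xi>|lborel. Jhat \<xi> ^ (n + 2) * wave f \<xi> x) / (2 * pi) ^ DIM('a)"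
proof (induction n arbitrary: x)
  case 0
  show ?case using two_steps_wave[OF f] by (simp add: eval_nat_numeral)
next
  case (Suc n)
  have [measurable]: "f \<in> borel_measurable borel" using f by auto
  have "(free.step ^^ (n + 2)) f = (\<lambda>x. (1 / (2 * pi) ^ DIM('a)) * (LINT \<xi>|lborel. Jhat \<xi> ^ (n + 2) * wave f \<xi> x))"
    using Suc by auto
  moreover have "free.step (\<lambda>x. LINT \<xi>|lborel. Jhat \<xi> ^ (n + 2) * wave f \<xi> x) x
      = (LINT \<xi>|lborel. Jhat \<xi> ^ (n + 2) * Jhat \<xi> * wave f \<xi> x)"
    by (rule step_fourier_integral[OF Jhat_power_integrable wave_measurable wave_bound[OF f] step_wave[OF f]]) simp
  ultimately have "free.step ((free.step ^^ (n + 2)) f) x = (1 / (2 * pi) ^ DIM('a)) * (LINT \<xi>|lborel. Jhat \<xi> ^ (n + 2) * Jhat \<xi> * wave f \<xi> x)"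
    by (simp only: free.step_cmult)
  then show ?case by (simp add: mult_ac)
qed

text \<open>The part of the symbol \<open>exp(t (Jhat - 1))\<close> due to at least two jumps. The omitted part, with no jump or one, need not be
  integrable, but is exponentially small as an operator on bounded functions.\<close>

definition symbol :: "real \<Rightarrow> 'a \<Rightarrow> real" where
  "symbol t \<xi> = exp (- t) * (exp (t * Jhat \<xi>) - 1 - t * Jhat \<xi>)"

lemma symbol_borel [measurable]: "symbol t \<in> borel_measurable borel"
  unfolding symbol_def[abs_def] by measurable

lemma symbol_sums:
  "(\<lambda>n. t ^ (n + 2) / fact (n + 2) * exp (- t) * Jhat \<xi> ^ (n + 2)) sums symbol t \<xi>"
proof -
  have "(\<lambda>n. (t * Jhat \<xi>) ^ n /\<^sub>R fact n) sums exp (t * Jhat \<xi>)" by (rule exp_converges)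
  then have "(\<lambda>n. (t * Jhat \<xi>) ^ (n + 2) /\<^sub>R fact (n + 2)) sums (exp (t * Jhat \<xi>) - (\<Sum>n<2. (t * Jhat \<xi>) ^ n /\<^sub>R fact n))"
    by (rule sums_split_initial_segment)
  then have "(\<lambda>n. exp (- t) * ((t * Jhat \<xi>) ^ (n + 2) /\<^sub>R fact (n + 2))) sums
      (exp (- t) * (exp (t * Jhat \<xi>) - (\<Sum>n<2. (t * Jhat \<xi>) ^ n /\<^sub>R fact n)))"
    by (rule sums_mult)
  moreover have "(\<Sum>n<2. (t * Jhat \<xi>) ^ n /\<^sub>R fact n) = 1 + t * Jhat \<xi>" by (simp add: eval_nat_numeral)
  moreover have "exp (- t) * ((t * Jhat \<xi>) ^ (n + 2) /\<^sub>R fact (n + 2)) = t ^ (n + 2) / fact (n + 2) * exp (- t) * Jhat \<xi> ^ (n + 2)" for n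
    by (simp only: power_mult_distrib real_scaleR_def divide_inverse mult_ac)
  ultimately show ?thesis by (simp add: symbol_def diff_diff_eq)
qed

text \<open>With \<open>\<rho> = 1\<close> this gives integrability, and with the spectral gap it makes the frequencies of norm at least 1 negligible.\<close>

lemma symbol_bound:
  assumes "0 \<le> t" "\<bar>Jhat \<xi>\<bar> \<le> \<rho>"
  shows "\<bar>symbol t \<xi>\<bar> \<le> t\<^sup>2 / 2 * exp (- t * (1 - \<rho>)) * (Jhat \<xi>)\<^sup>2"
proof -
  have "\<bar>symbol t \<xi>\<bar> \<le> exp (- t) * ((t * Jhat \<xi>)\<^sup>2 / 2 * exp \<bar>t * Jhat \<xi>\<bar>)"
    unfolding symbol_def using exp_minus_linear_bound[of "t * Jhat \<xi>"] by (simp only: abs_mult[of "exp _"]) simp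
  also have "\<dots> \<le> exp (- t) * ((t * Jhat \<xi>)\<^sup>2 / 2 * exp (t * \<rho>))"
    using assms by (intro mult_left_mono) (auto simp: abs_mult mult_left_mono)
  also have "\<dots> = t\<^sup>2 / 2 * (exp (- t) * exp (t * \<rho>)) * (Jhat \<xi>)\<^sup>2"
    by (simp add: power_mult_distrib)
  also have "exp (- t) * exp (t * \<rho>) = exp (- t * (1 - \<rho>))"
    by (simp add: exp_add[symmetric] algebra_simps)
  finally show ?thesis .
qed

lemma symbol_integrable: assumes "0 \<le> t" shows "integrable lborel (symbol t)"
proof (rule Bochner_Integration.integrable_bound[of lborel "\<lambda>\<xi>. t\<^sup>2 / 2 * exp (- t * (1 - 1)) * (Jhat \<xi>)\<^sup>2"])
  show "AE \<xi> in lborel. norm (symbol t \<xi>) \<le> norm (t\<^sup>2 / 2 * exp (- t * (1 - 1)) * (Jhat \<xi>)\<^sup>2)"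
    using symbol_bound[OF assms Jhat_le_1] by (auto intro: order_trans[OF _ abs_ge_self])
qed (use Jhat_square_integrable in auto)

lemma heat_representation:
  assumes t: "0 < t" and f: "integrable lborel f" "bbound f B"
  shows "free.heat t f x = exp (- t) * f x + t * exp (- t) * free.step f x
    + (LINT \<xi>|lborel. symbol t \<xi> * wave f \<xi> x) / (2 * pi) ^ DIM('a)"
proof -
  have [measurable]: "f \<in> borel_measurable borel" using f by auto
  let ?c = "(2 * pi) ^ DIM('a)"
  define a where "a n = t ^ n / fact n * exp (- t)" for n
  have a0: "0 \<le> a n" for n using t by (simp add: a_def)
  have asum: "summable a"
    using poisson_expectation_sums[OF t, of "\<lambda>_. 1" 1] unfolding a_def[abs_def] by (simp add: sums_iff)
  define L where "L = (LINT y|lborel. \<bar>f y\<bar>)"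
  define g where "g n \<xi> = a (n + 2) * Jhat \<xi> ^ (n + 2) * wave f \<xi> x" for n \<xi>
  have wm: "(\<lambda>\<xi>. wave f \<xi> x) \<in> borel_measurable borel"
    using measurable_compose[OF measurable_Pair2' wave_measurable] by measurable
  have wb: "bbound (\<lambda>\<xi>. wave f \<xi> x) L"
    using wave_bound[OF f(1)] wm by (auto simp: bbound_def L_def)
  have gi: "integrable lborel (g n)" for n
    unfolding g_def mult.assoc
    by (rule integrable_mult_right, rule integrable_mult_bbound(1)[OF Jhat_power_integrable wb])
  \<comment> \<open>A majorant that is summable in the number of jumps and integrable in the frequency.\<close>
  have gn: "norm (g n \<xi>) \<le> a (n + 2) * (L * (Jhat \<xi>)\<^sup>2)" for n \<xi>
  proof -
    have "\<bar>Jhat \<xi> ^ (n + 2)\<bar> = \<bar>Jhat \<xi>\<bar> ^ n * (Jhat \<xi>)\<^sup>2" by (simp add: power_add abs_mult power_abs power2_eq_square)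
    also have "\<dots> \<le> 1 * (Jhat \<xi>)\<^sup>2"
      by (intro mult_right_mono power_le_one Jhat_le_1) auto
    finally have "\<bar>Jhat \<xi> ^ (n + 2)\<bar> \<le> (Jhat \<xi>)\<^sup>2" by simp
    then have "\<bar>Jhat \<xi> ^ (n + 2)\<bar> * \<bar>wave f \<xi> x\<bar> \<le> (Jhat \<xi>)\<^sup>2 * L"
      by (intro mult_mono bboundD(2)[OF wb]) auto
    from mult_left_mono[OF this a0[of "n + 2"]] show ?thesis
      using a0[of "n + 2"] by (simp add: g_def abs_mult mult_ac)
  qed
  have asum2: "summable (\<lambda>n. a (n + 2))" using asum by (simp only: summable_iff_shift)
  have "(\<lambda>n. integral\<^sup>L lborel (g n)) sums (LINT \<xi>|lborel. (\<Sum>n. g n \<xi>))"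
  proof (rule sums_integral[OF gi])
    show "AE \<xi> in lborel. summable (\<lambda>n. norm (g n \<xi>))"
      by (intro AE_I2 summable_comparison_test'[OF summable_mult2[OF asum2], where N=0]) (use gn in auto)
    show "summable (\<lambda>n. LINT \<xi>|lborel. norm (g n \<xi>))"
    proof (rule summable_comparison_test'[OF summable_mult2[OF asum2, of "LINT \<xi>|lborel. L * (Jhat \<xi>)\<^sup>2"], where N=0])
      fix n
      have "(LINT \<xi>|lborel. norm (g n \<xi>)) \<le> (LINT \<xi>|lborel. a (n + 2) * (L * (Jhat \<xi>)\<^sup>2))"
        by (rule integral_mono) (use gi gn Jhat_square_integrable in auto)
      then show "norm (LINT \<xi>|lborel. norm (g n \<xi>)) \<le> a (n + 2) * (LINT \<xi>|lborel. L * (Jhat \<xi>)\<^sup>2)"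
        by simp
    qed
  qed
  moreover have "(\<Sum>n. g n \<xi>) = symbol t \<xi> * wave f \<xi> x" for \<xi>
    using sums_mult2[OF symbol_sums[of t \<xi>], of "wave f \<xi> x"] by (simp add: g_def a_def sums_iff)
  ultimately have "(\<lambda>n. integral\<^sup>L lborel (g n) / ?c) sums ((LINT \<xi>|lborel. symbol t \<xi> * wave f \<xi> x) / ?c)"
    by (intro sums_divide) simp
  moreover have "integral\<^sup>L lborel (g n) / ?c = a (n + 2) * (free.step ^^ (n + 2)) f x" for n
  proof -
    have "integral\<^sup>L lborel (g n) = a (n + 2) * (LINT \<xi>|lborel. Jhat \<xi> ^ (n + 2) * wave f \<xi> x)"
      unfolding g_def mult.assoc by simp
    then show ?thesis unfolding steps_wave[OF f(1)] by simp
  qed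
  ultimately have "(\<lambda>n. a (n + 2) * (free.step ^^ (n + 2)) f x) sums ((LINT \<xi>|lborel. symbol t \<xi> * wave f \<xi> x) / ?c)"
    by simp
  moreover have "(\<lambda>n. a (n + 2) * (free.step ^^ (n + 2)) f x) sums
      (free.heat t f x - (\<Sum>n<2. a n * (free.step ^^ n) f x))"
    unfolding free.heat_def a_def
    by (rule sums_split_initial_segment, rule poisson_expectation_sums[OF t]) (rule bboundD(2)[OF free.bbound_steps[OF f(2)]])
  ultimately have "free.heat t f x - (\<Sum>n<2. a n * (free.step ^^ n) f x) = (LINT \<xi>|lborel. symbol t \<xi> * wave f \<xi> x) / ?c"
    by (rule sums_unique2[symmetric])
  moreover have "(\<Sum>n<2. a n * (free.step ^^ n) f x) = exp (- t) * f x + t * exp (- t) * free.step f x"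
    by (simp add: eval_nat_numeral a_def)
  ultimately show ?thesis by linarith
qed

end

section \<open>The local limit theorem for the free walk\<close>

lemma cos_lipschitz: "\<bar>cos a - cos b\<bar> \<le> min 2 \<bar>a - b\<bar>" for a b :: real
proof -
  have "\<bar>cos a - cos b\<bar> = 2 * (\<bar>sin ((a + b) / 2)\<bar> * \<bar>sin ((b - a) / 2)\<bar>)"
    by (simp add: cos_diff_cos abs_mult)
  also have "\<dots> \<le> 2 * (1 * \<bar>(b - a) / 2\<bar>)"
    by (intro mult_left_mono mult_mono abs_sin_x_le_abs_x) auto
  finally have "\<bar>cos a - cos b\<bar> \<le> \<bar>a - b\<bar>" by simp
  moreover have "\<bar>cos a - cos b\<bar> \<le> 2"
    using abs_cos_le_one[of a] abs_cos_le_one[of b] by linarith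
  ultimately show ?thesis by simp
qed

text \<open>The factor \<open>t^(N/2)\<close> of the theorem is the Jacobian of the diffusive scaling.\<close>

lemma scaled_integral:
  fixes g :: "'a::euclidean_space \<Rightarrow> real"
  assumes "g \<in> borel_measurable borel" "0 < t"
  shows "t powr (real DIM('a) / 2) * (LINT \<xi>|lborel. g \<xi>) = (LINT \<eta>|lborel. g ((1 / sqrt t) *\<^sub>R \<eta>))"
proof -
  have "sqrt t ^ DIM('a) = t powr (real DIM('a) / 2)"
    using assms by (simp add: powr_half_sqrt[symmetric] powr_realpow[symmetric] powr_powr)
  then have "t powr (real DIM('a) / 2) * (1 / sqrt t) ^ DIM('a) = 1"
    using assms(2) by (simp add: power_one_over)
  then show ?thesis
    using lborel_affine_integral(1)[OF assms(1), of "1 / sqrt t" 0] assms(2) by (simp add: mult.assoc[symmetric])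
qed

lemma tendsto_powr_exp:
  fixes p d :: real
  assumes "0 < d"
  shows "((\<lambda>t. t powr p * (t\<^sup>2 * exp (- t * d))) \<longlongrightarrow> 0) at_top"
    and "((\<lambda>t. t powr p * ((1 + t) * exp (- t))) \<longlongrightarrow> 0) at_top"
  using assms by real_asymp+

context radial_density
begin

lemma symbol_eq: "symbol t \<xi> = exp (- (t * (1 - Jhat \<xi>))) - exp (- t) * (1 + t * Jhat \<xi>)"
proof -
  have "exp (- t) * exp (t * Jhat \<xi>) = exp (- (t * (1 - Jhat \<xi>)))"
    by (simp add: exp_add[symmetric] algebra_simps)
  then show ?thesis by (simp add: symbol_def algebra_simps)
qed

lemma abs_low_jumps_le: "0 \<le> t \<Longrightarrow> \<bar>exp (- t) * (1 + t * Jhat \<xi>)\<bar> \<le> (1 + t) * exp (- t)"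
proof -
  assume t: "0 \<le> t"
  have "\<bar>t * Jhat \<xi>\<bar> \<le> t * 1" unfolding abs_mult using t Jhat_le_1 by (intro mult_mono) auto
  then have "\<bar>1 + t * Jhat \<xi>\<bar> \<le> 1 + t" by linarith
  then show ?thesis by (simp add: abs_mult mult.commute mult_right_mono)
qed

lemma symbol_near_bound:
  assumes t: "1 \<le> t" and \<xi>: "norm \<xi> \<le> 1"
  shows "\<bar>symbol t \<xi>\<bar> \<le> exp (- (t * (diffusivity J / 2 * (norm \<xi>)\<^sup>2))) + 2 * exp (- (t / 2))"
proof -
  have "exp (- (t * (1 - Jhat \<xi>))) \<le> exp (- (t * (diffusivity J / 2 * (norm \<xi>)\<^sup>2)))"
    using t Jhat_near[OF \<xi>] by (simp add: mult_left_mono)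
  moreover have "(1 + t) * exp (- t) \<le> 2 * exp (- (t / 2))"
  proof -
    have "1 + t \<le> 2 * exp (t / 2)" using exp_ge_add_one_self[of "t / 2"] by linarith
    then have "(1 + t) * exp (- t) \<le> 2 * exp (t / 2) * exp (- t)" by (intro mult_right_mono) auto
    also have "\<dots> = 2 * exp (- (t / 2))" by (simp add: mult.assoc exp_add[symmetric])
    finally show ?thesis .
  qed
  moreover have "\<bar>exp (- t) * (1 + t * Jhat \<xi>)\<bar> \<le> (1 + t) * exp (- t)"
    using t by (intro abs_low_jumps_le) auto
  ultimately show ?thesis unfolding symbol_eq
    by (intro order_trans[OF abs_triangle_ineq4] add_mono) auto
qed

lemma symbol_scaling_limit:
  "((\<lambda>t. symbol t ((1 / sqrt t) *\<^sub>R \<eta>)) \<longlongrightarrow> exp (- (diffusivity J * (norm \<eta>)\<^sup>2))) at_top"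
proof -
  have "((\<lambda>t. exp (- (t * (1 - Jhat ((1 / sqrt t) *\<^sub>R \<eta>))))) \<longlongrightarrow> exp (- (diffusivity J * (norm \<eta>)\<^sup>2))) at_top"
    by (intro tendsto_exp tendsto_minus Jhat_scaling_limit)
  moreover have "((\<lambda>t. exp (- t) * (1 + t * Jhat ((1 / sqrt t) *\<^sub>R \<eta>))) \<longlongrightarrow> 0) at_top"
  proof (rule Lim_null_comparison[where g="\<lambda>t. (1 + t) * exp (- t)"])
    show "\<forall>\<^sub>F t in at_top. norm (exp (- t) * (1 + t * Jhat ((1 / sqrt t) *\<^sub>R \<eta>))) \<le> (1 + t) * exp (- t)"
      using eventually_ge_at_top[of "0::real"] by eventually_elim (simp add: abs_low_jumps_le)
    show "((\<lambda>t. (1 + t) * exp (- t)) \<longlongrightarrow> (0::real)) at_top" by real_asymp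
  qed
  ultimately have "((\<lambda>t. exp (- (t * (1 - Jhat ((1 / sqrt t) *\<^sub>R \<eta>)))) - exp (- t) * (1 + t * Jhat ((1 / sqrt t) *\<^sub>R \<eta>)))
      \<longlongrightarrow> exp (- (diffusivity J * (norm \<eta>)\<^sup>2)) - 0) at_top"
    by (rule tendsto_diff)
  then show ?thesis by (simp only: symbol_eq diff_zero)
qed

definition gauss_symbol :: "real \<Rightarrow> 'a \<Rightarrow> real" where
  "gauss_symbol t \<xi> = exp (- (diffusivity J * t) * (norm \<xi>)\<^sup>2)"

lemma gauss_symbol_borel [measurable]: "gauss_symbol t \<in> borel_measurable borel"
  unfolding gauss_symbol_def[abs_def] by measurable

lemma gauss_symbol_integrable: "0 < t \<Longrightarrow> integrable lborel (gauss_symbol t)"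
  unfolding gauss_symbol_def[abs_def] by (rule gaussian_integrable) (simp add: diffusivity_pos)

lemma gauss_symbol_scale: "0 < t \<Longrightarrow> gauss_symbol t ((1 / sqrt t) *\<^sub>R \<eta>) = gauss_symbol 1 \<eta>"
  by (simp add: gauss_symbol_def power_mult_distrib power_divide)

text \<open>The frequencies of norm above 1 are exponentially small. On the others, after scaling, the symbol converges pointwise to the Gaussian and has a Gaussian majorant.\<close>

lemma symbol_limit:
  "((\<lambda>t. t powr (real DIM('a) / 2) * (LINT \<xi>|lborel. \<bar>symbol t \<xi> - gauss_symbol t \<xi>\<bar>)) \<longlongrightarrow> 0) at_top"
proof -
  let ?p = "real DIM('a) / 2"
  let ?a = "diffusivity J"
  obtain \<rho> where \<rho>: "\<rho> < 1" "0 < \<rho>" "\<And>\<xi>. 1 \<le> norm \<xi> \<Longrightarrow> \<bar>Jhat \<xi>\<bar> \<le> \<rho>" using Jhat_far by blast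
  define near where "near t \<xi> = \<bar>indicator (cball 0 1) \<xi> * symbol t \<xi> - gauss_symbol t \<xi>\<bar>" for t and \<xi> :: 'a
  define K where "K = (LINT \<xi>|lborel. (Jhat \<xi>)\<^sup>2)"
  have near_m [measurable]: "near t \<in> borel_measurable borel" for t
    unfolding near_def by (intro borel_measurable_abs borel_measurable_diff borel_measurable_times borel_measurable_indicator) auto
  have near_i: "integrable lborel (near t)" if "0 < t" for t
    unfolding near_def using symbol_integrable[of t] that
    by (intro integrable_abs Bochner_Integration.integrable_diff gauss_symbol_integrable integrable_mult_bbound(2)[of _ _ 1] bbound_indicator) auto
  have bound: "(LINT \<xi>|lborel. \<bar>symbol t \<xi> - gauss_symbol t \<xi>\<bar>) \<le> (LINT \<xi>|lborel. near t \<xi>) + t\<^sup>2 / 2 * exp (- t * (1 - \<rho>)) * K"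
    if t: "0 < t" for t
  proof -
    have "(LINT \<xi>|lborel. \<bar>symbol t \<xi> - gauss_symbol t \<xi>\<bar>)
        \<le> (LINT \<xi>|lborel. near t \<xi> + t\<^sup>2 / 2 * exp (- t * (1 - \<rho>)) * (Jhat \<xi>)\<^sup>2)"
    proof (rule integral_mono)
      show "integrable lborel (\<lambda>\<xi>. \<bar>symbol t \<xi> - gauss_symbol t \<xi>\<bar>)"
        using t symbol_integrable[of t] gauss_symbol_integrable[of t] by auto
      show "integrable lborel (\<lambda>\<xi>. near t \<xi> + t\<^sup>2 / 2 * exp (- t * (1 - \<rho>)) * (Jhat \<xi>)\<^sup>2)"
        using near_i[OF t] Jhat_square_integrable by auto
      fix \<xi> :: 'a
      show "\<bar>symbol t \<xi> - gauss_symbol t \<xi>\<bar> \<le> near t \<xi> + t\<^sup>2 / 2 * exp (- t * (1 - \<rho>)) * (Jhat \<xi>)\<^sup>2"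
      proof (cases "norm \<xi> \<le> 1")
        case True
        then show ?thesis by (simp add: near_def)
      next
        case False
        then have "\<bar>symbol t \<xi>\<bar> \<le> t\<^sup>2 / 2 * exp (- t * (1 - \<rho>)) * (Jhat \<xi>)\<^sup>2"
          using t by (intro symbol_bound \<rho>(3)) auto
        moreover have "near t \<xi> = \<bar>gauss_symbol t \<xi>\<bar>" using False by (simp add: near_def)
        ultimately show ?thesis by linarith
      qed
    qed
    also have "\<dots> = (LINT \<xi>|lborel. near t \<xi>) + t\<^sup>2 / 2 * exp (- t * (1 - \<rho>)) * K"
      unfolding K_def using near_i[OF t] Jhat_square_integrable by (subst Bochner_Integration.integral_add) auto
    finally show ?thesis .
  qed
  have near_lim: "((\<lambda>t. LINT \<eta>|lborel. near t ((1 / sqrt t) *\<^sub>R \<eta>)) \<longlongrightarrow> (LINT \<eta>|(lborel::'a measure). (0::real))) at_top"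
  proof (rule integral_dominated_convergence_at_top[where w="\<lambda>\<eta>::'a. exp (- (?a / 2) * (norm \<eta>)\<^sup>2) + 2 * exp (- (1 / 2) * (norm \<eta>)\<^sup>2) + gauss_symbol 1 \<eta>"])
    show "integrable lborel (\<lambda>\<eta>::'a. exp (- (?a / 2) * (norm \<eta>)\<^sup>2) + 2 * exp (- (1 / 2) * (norm \<eta>)\<^sup>2) + gauss_symbol 1 \<eta>)"
      using diffusivity_pos
      by (intro Bochner_Integration.integrable_add integrable_mult_right gaussian_integrable gauss_symbol_integrable) auto
    show "\<forall>\<^sub>F t in at_top. AE \<eta> in lborel. norm (near t ((1 / sqrt t) *\<^sub>R \<eta>))
       \<le> exp (- (?a / 2) * (norm \<eta>)\<^sup>2) + 2 * exp (- (1 / 2) * (norm \<eta>)\<^sup>2) + gauss_symbol 1 \<eta>"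
      using eventually_ge_at_top[of "1::real"]
    proof (eventually_elim, intro AE_I2)
      fix t :: real and \<eta> :: 'a assume t: "1 \<le> t"
      let ?x = "(1 / sqrt t) *\<^sub>R \<eta>"
      have n2: "t * (norm ?x)\<^sup>2 = (norm \<eta>)\<^sup>2" using t by (simp add: power_mult_distrib power_divide)
      have g: "gauss_symbol t ?x = gauss_symbol 1 \<eta>" using t by (intro gauss_symbol_scale) auto
      have g0: "0 \<le> gauss_symbol 1 \<eta>" by (simp add: gauss_symbol_def)
      show "norm (near t ?x) \<le> exp (- (?a / 2) * (norm \<eta>)\<^sup>2) + 2 * exp (- (1 / 2) * (norm \<eta>)\<^sup>2) + gauss_symbol 1 \<eta>"
      proof (cases "norm ?x \<le> 1")
        case True
        \<comment> \<open>On the scaled ball the term with at most one jump, of order exp (-t/2), is itself below a Gaussian.\<close>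
        have "(norm ?x)\<^sup>2 \<le> 1" using True by (simp add: power_le_one)
        then have "t * (norm ?x)\<^sup>2 \<le> t * 1" using t by (intro mult_left_mono) auto
        then have "(norm \<eta>)\<^sup>2 \<le> t" unfolding n2 by simp
        then have A: "exp (- (t / 2)) \<le> exp (- (1 / 2) * (norm \<eta>)\<^sup>2)" by simp
        have Q: "t * (?a / 2 * (norm ?x)\<^sup>2) = ?a / 2 * (norm \<eta>)\<^sup>2" unfolding n2[symmetric] by (simp only: mult_ac)
        have "\<bar>symbol t ?x\<bar> \<le> exp (- (?a / 2 * (norm \<eta>)\<^sup>2)) + 2 * exp (- (t / 2))"
          using symbol_near_bound[OF t True] unfolding Q .
        also have "\<dots> \<le> exp (- (?a / 2 * (norm \<eta>)\<^sup>2)) + 2 * exp (- (1 / 2) * (norm \<eta>)\<^sup>2)"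
          using A by (intro add_left_mono mult_left_mono) auto
        finally have "\<bar>symbol t ?x\<bar> \<le> exp (- (?a / 2 * (norm \<eta>)\<^sup>2)) + 2 * exp (- (1 / 2) * (norm \<eta>)\<^sup>2)" .
        moreover have "norm (near t ?x) = \<bar>symbol t ?x - gauss_symbol 1 \<eta>\<bar>" unfolding near_def g using True by simp
        ultimately show ?thesis using g0 by (simp add: mult_minus_left del: norm_scaleR)
      next
        case False
        then have "norm (near t ?x) = gauss_symbol 1 \<eta>" unfolding near_def g using g0 by (simp del: norm_scaleR)
        then show ?thesis by simp
      qed
    qed
    show "AE \<eta> in lborel. ((\<lambda>t. near t ((1 / sqrt t) *\<^sub>R \<eta>)) \<longlongrightarrow> 0) at_top"
    proof (rule AE_I2)
      fix \<eta> :: 'a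
      have "((\<lambda>t. \<bar>symbol t ((1 / sqrt t) *\<^sub>R \<eta>) - gauss_symbol 1 \<eta>\<bar>) \<longlongrightarrow> \<bar>exp (- (?a * (norm \<eta>)\<^sup>2)) - gauss_symbol 1 \<eta>\<bar>) at_top"
        by (intro tendsto_rabs tendsto_diff symbol_scaling_limit tendsto_const)
      then have "((\<lambda>t. \<bar>symbol t ((1 / sqrt t) *\<^sub>R \<eta>) - gauss_symbol 1 \<eta>\<bar>) \<longlongrightarrow> 0) at_top"
        by (simp add: gauss_symbol_def)
      then show "((\<lambda>t. near t ((1 / sqrt t) *\<^sub>R \<eta>)) \<longlongrightarrow> 0) at_top"
      proof (rule Lim_transform_eventually)
        show "\<forall>\<^sub>F t in at_top. \<bar>symbol t ((1 / sqrt t) *\<^sub>R \<eta>) - gauss_symbol 1 \<eta>\<bar> = near t ((1 / sqrt t) *\<^sub>R \<eta>)"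
          using eventually_ge_at_top[of "max 1 ((norm \<eta>)\<^sup>2)"]
        proof eventually_elim
          fix t assume t: "max 1 ((norm \<eta>)\<^sup>2) \<le> t"
          then have "norm \<eta> \<le> sqrt t" by (simp add: real_le_rsqrt)
          then have "norm ((1 / sqrt t) *\<^sub>R \<eta>) \<le> 1" using t by (simp add: field_simps)
          then show "\<bar>symbol t ((1 / sqrt t) *\<^sub>R \<eta>) - gauss_symbol 1 \<eta>\<bar> = near t ((1 / sqrt t) *\<^sub>R \<eta>)"
            unfolding near_def using t gauss_symbol_scale[of t \<eta>] by simp
        qed
      qed
    qed
  qed measurable
  have "((\<lambda>t. (LINT \<eta>|lborel. near t ((1 / sqrt t) *\<^sub>R \<eta>)) + (t powr ?p * (t\<^sup>2 * exp (- t * (1 - \<rho>)))) * (K / 2)) \<longlongrightarrow> 0 + 0 * (K / 2)) at_top"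
    using near_lim \<rho>(1) by (intro tendsto_add tendsto_mult tendsto_const tendsto_powr_exp) auto
  then have lim: "((\<lambda>t. (LINT \<eta>|lborel. near t ((1 / sqrt t) *\<^sub>R \<eta>)) + (t powr ?p * (t\<^sup>2 * exp (- t * (1 - \<rho>)))) * (K / 2)) \<longlongrightarrow> 0) at_top"
    by simp
  show ?thesis
  proof (rule Lim_null_comparison[OF _ lim])
    show "\<forall>\<^sub>F t in at_top. norm (t powr ?p * (LINT \<xi>|lborel. \<bar>symbol t \<xi> - gauss_symbol t \<xi>\<bar>))
       \<le> (LINT \<eta>|lborel. near t ((1 / sqrt t) *\<^sub>R \<eta>)) + (t powr ?p * (t\<^sup>2 * exp (- t * (1 - \<rho>)))) * (K / 2)"
      using eventually_gt_at_top[of "0::real"]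
    proof eventually_elim
      fix t :: real assume t: "0 < t"
      have "norm (t powr ?p * (LINT \<xi>|lborel. \<bar>symbol t \<xi> - gauss_symbol t \<xi>\<bar>)) = t powr ?p * (LINT \<xi>|lborel. \<bar>symbol t \<xi> - gauss_symbol t \<xi>\<bar>)"
        by (simp add: abs_mult integral_nonneg_AE)
      also have "\<dots> \<le> t powr ?p * ((LINT \<xi>|lborel. near t \<xi>) + t\<^sup>2 / 2 * exp (- t * (1 - \<rho>)) * K)"
        by (intro mult_left_mono bound[OF t]) auto
      also have "\<dots> = t powr ?p * (LINT \<xi>|lborel. near t \<xi>) + (t powr ?p * (t\<^sup>2 * exp (- t * (1 - \<rho>)))) * (K / 2)"
        by (simp add: distrib_left)
      finally show "norm (t powr ?p * (LINT \<xi>|lborel. \<bar>symbol t \<xi> - gauss_symbol t \<xi>\<bar>))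
         \<le> (LINT \<eta>|lborel. near t ((1 / sqrt t) *\<^sub>R \<eta>)) + (t powr ?p * (t\<^sup>2 * exp (- t * (1 - \<rho>)))) * (K / 2)"
        unfolding scaled_integral[OF near_m t] .
    qed
  qed
qed

lemma low_jumps_bound:
  assumes t: "0 < t" and f: "bbound f B"
  shows "\<bar>exp (- t) * f x + t * exp (- t) * free.step f x\<bar> \<le> (1 + t) * exp (- t) * B"
proof -
  have "\<bar>exp (- t) * f x + t * exp (- t) * free.step f x\<bar> \<le> exp (- t) * \<bar>f x\<bar> + t * exp (- t) * \<bar>free.step f x\<bar>"
    using t by (intro order_trans[OF abs_triangle_ineq]) (simp add: abs_mult)
  also have "\<dots> \<le> exp (- t) * B + t * exp (- t) * B"
    using t by (intro add_mono mult_left_mono bboundD(2)[OF f] bboundD(2)[OF free.bbound_step[OF f]]) auto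
  finally show ?thesis by (simp add: algebra_simps)
qed

lemma gauss_symbol_mass:
  assumes "0 < t"
  shows "t powr (real DIM('a) / 2) * (LINT \<xi>|lborel. gauss_symbol t \<xi>) = (LINT \<xi>|lborel. gauss_symbol 1 \<xi>)"
  using assms by (simp add: scaled_integral gauss_symbol_scale)

lemma wave_slice:
  assumes "f \<in> borel_measurable borel" shows "(\<lambda>\<xi>. wave f \<xi> x) \<in> borel_measurable borel"
  using measurable_compose[OF _ wave_measurable[OF assms], of "\<lambda>\<xi>. (\<xi>, x)" borel] by simp

text \<open>The constant and the threshold in time do not depend on \<open>f\<close>; the lemma will be applied to data that depend on the time.\<close>

lemma free_smoothing:
  "\<exists>C>0. \<forall>\<^sub>F t in at_top. \<forall>f B x. integrable lborel f \<longrightarrow> bbound f B \<longrightarrow>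
    t powr (real DIM('a) / 2) * \<bar>free.heat t f x\<bar>
      \<le> t powr (real DIM('a) / 2) * ((1 + t) * exp (- t)) * B + C * (LINT y|lborel. \<bar>f y\<bar>)"
proof -
  let ?p = "real DIM('a) / 2"
  let ?c = "(2 * pi) ^ DIM('a)"
  define G where "G = (LINT \<xi>|lborel. gauss_symbol 1 \<xi>)"
  have G: "0 \<le> G" unfolding G_def by (rule integral_nonneg_AE) (simp add: gauss_symbol_def)
  have ev: "\<forall>\<^sub>F t in at_top. t powr ?p * (LINT \<xi>|lborel. \<bar>symbol t \<xi> - gauss_symbol t \<xi>\<bar>) < 1"
    using symbol_limit by (rule order_tendstoD) simp
  have "\<forall>\<^sub>F t in at_top. \<forall>f B x. integrable lborel f \<longrightarrow> bbound f B \<longrightarrow>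
    t powr ?p * \<bar>free.heat t f x\<bar> \<le> t powr ?p * ((1 + t) * exp (- t)) * B + ((1 + G) / ?c) * (LINT y|lborel. \<bar>f y\<bar>)"
    using ev eventually_gt_at_top[of "0::real"]
  proof (eventually_elim, intro allI impI)
    fix t B x and f :: "'a \<Rightarrow> real"
    assume 1: "t powr ?p * (LINT \<xi>|lborel. \<bar>symbol t \<xi> - gauss_symbol t \<xi>\<bar>) < 1" and t: "0 < t"
      and f: "integrable lborel f" "bbound f B"
    define L where "L = (LINT y|lborel. \<bar>f y\<bar>)"
    have L: "0 \<le> L" by (simp add: L_def)
    have [measurable]: "f \<in> borel_measurable borel" using f by auto
    have wb: "bbound (\<lambda>\<xi>. wave f \<xi> x) L"
      using wave_bound[OF f(1)] wave_slice[of f x] by (auto simp: bbound_def L_def)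
    note si = symbol_integrable[of t] gauss_symbol_integrable[OF t]
    have "(LINT \<xi>|lborel. \<bar>symbol t \<xi>\<bar>) \<le> (LINT \<xi>|lborel. \<bar>symbol t \<xi> - gauss_symbol t \<xi>\<bar> + gauss_symbol t \<xi>)"
    proof (rule integral_mono)
      show "\<bar>symbol t \<xi>\<bar> \<le> \<bar>symbol t \<xi> - gauss_symbol t \<xi>\<bar> + gauss_symbol t \<xi>" for \<xi>
      proof -
        have "0 \<le> gauss_symbol t \<xi>" by (simp add: gauss_symbol_def)
        then show ?thesis by linarith
      qed
    qed (use t si in auto)
    also have "\<dots> = (LINT \<xi>|lborel. \<bar>symbol t \<xi> - gauss_symbol t \<xi>\<bar>) + (LINT \<xi>|lborel. gauss_symbol t \<xi>)"
      using t si by (subst Bochner_Integration.integral_add) auto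
    finally have "t powr ?p * (LINT \<xi>|lborel. \<bar>symbol t \<xi>\<bar>)
        \<le> t powr ?p * ((LINT \<xi>|lborel. \<bar>symbol t \<xi> - gauss_symbol t \<xi>\<bar>) + (LINT \<xi>|lborel. gauss_symbol t \<xi>))"
      by (rule mult_left_mono) auto
    also have "\<dots> \<le> 1 + G"
      using 1 gauss_symbol_mass[OF t] by (simp add: distrib_left G_def)
    finally have 2: "t powr ?p * (LINT \<xi>|lborel. \<bar>symbol t \<xi>\<bar>) \<le> 1 + G" .
    have "\<bar>LINT \<xi>|lborel. symbol t \<xi> * wave f \<xi> x\<bar> \<le> L * (LINT \<xi>|lborel. \<bar>symbol t \<xi>\<bar>)"
      using t by (intro integral_mult_bbound_le si wb) auto
    then have "t powr ?p * \<bar>LINT \<xi>|lborel. symbol t \<xi> * wave f \<xi> x\<bar> \<le> t powr ?p * (L * (LINT \<xi>|lborel. \<bar>symbol t \<xi>\<bar>))"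
      by (rule mult_left_mono) auto
    also have "\<dots> = L * (t powr ?p * (LINT \<xi>|lborel. \<bar>symbol t \<xi>\<bar>))" by simp
    also have "\<dots> \<le> L * (1 + G)" by (rule mult_left_mono[OF 2 L])
    finally have 3: "t powr ?p * (\<bar>LINT \<xi>|lborel. symbol t \<xi> * wave f \<xi> x\<bar> / ?c) \<le> (1 + G) / ?c * L"
      by (simp add: divide_right_mono mult.commute)
    have "\<bar>free.heat t f x\<bar> \<le> (1 + t) * exp (- t) * B + \<bar>LINT \<xi>|lborel. symbol t \<xi> * wave f \<xi> x\<bar> / ?c"
      unfolding heat_representation[OF t f]
      by (rule order_trans[OF abs_triangle_ineq], rule add_mono[OF low_jumps_bound[OF t f(2)]]) simp
    then have "t powr ?p * \<bar>free.heat t f x\<bar> \<le> t powr ?p * ((1 + t) * exp (- t) * B + \<bar>LINT \<xi>|lborel. symbol t \<xi> * wave f \<xi> x\<bar> / ?c)"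
      by (rule mult_left_mono) auto
    also have "\<dots> = t powr ?p * ((1 + t) * exp (- t)) * B + t powr ?p * (\<bar>LINT \<xi>|lborel. symbol t \<xi> * wave f \<xi> x\<bar> / ?c)"
      by (simp only: distrib_left mult.assoc)
    finally show "t powr ?p * \<bar>free.heat t f x\<bar> \<le> t powr ?p * ((1 + t) * exp (- t)) * B + (1 + G) / ?c * (LINT y|lborel. \<bar>f y\<bar>)"
      using 3 unfolding L_def by linarith
  qed
  moreover have "0 < (1 + G) / ?c" using G by simp
  ultimately show ?thesis by blast
qed

text \<open>Besides \<open>symbol_limit\<close>, it has to be shown that a wave of low frequency sees only the mass of \<open>f\<close>. The modulus \<open>D\<close> measures the defect independently of the point \<open>x\<close>, and tends to 0 with the frequency.\<close>

lemma free_local_limit: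
  assumes f: "integrable lborel f" "bbound f B"
  shows "\<exists>b. (b \<longlongrightarrow> 0) at_top \<and> (\<forall>t>0. \<forall>x. t powr (real DIM('a) / 2) *
    \<bar>free.heat t f x - (LINT y|lborel. f y) * heat_kernel (diffusivity J) x t\<bar> \<le> b t)"
proof -
  let ?p = "real DIM('a) / 2"
  let ?c = "(2 * pi) ^ DIM('a)"
  have [measurable]: "f \<in> borel_measurable borel" using f by auto
  define L where "L = (LINT y|lborel. \<bar>f y\<bar>)"
  define m where "m = (LINT y|lborel. f y)"
  define D where "D \<xi> = (LINT y|lborel. \<bar>f y\<bar> * min 2 \<bar>y \<bullet> \<xi>\<bar>)" for \<xi>
  have Dm [measurable]: "D \<in> borel_measurable borel"
    unfolding D_def[abs_def] by (rule lborel.borel_measurable_lebesgue_integral) measurable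
  have mb: "bbound (\<lambda>y::'a. min 2 \<bar>y \<bullet> \<xi>\<bar>) 2" for \<xi> by (auto simp: bbound_def)
  have Di: "integrable lborel (\<lambda>y. \<bar>f y\<bar> * min 2 \<bar>y \<bullet> \<xi>\<bar>)" for \<xi>
    by (rule integrable_mult_bbound(1)[OF integrable_abs[OF f(1)] mb])
  have Db: "bbound D (2 * L)"
    unfolding bbound_def
    using integral_mult_bbound_le[OF integrable_abs[OF f(1)] mb] by (simp add: D_def L_def Dm[unfolded D_def[abs_def]])
  have D0: "((\<lambda>t. D ((1 / sqrt t) *\<^sub>R \<eta>)) \<longlongrightarrow> 0) at_top" for \<eta>
  proof -
    have "((\<lambda>t. LINT y|lborel. \<bar>f y\<bar> * min 2 \<bar>y \<bullet> ((1 / sqrt t) *\<^sub>R \<eta>)\<bar>) \<longlongrightarrow> (LINT y|(lborel::'a measure). (0::real))) at_top"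
    proof (rule integral_dominated_convergence_at_top[where w="\<lambda>y. 2 * \<bar>f y\<bar>"])
      show "\<forall>\<^sub>F t in at_top. AE y in lborel. norm (\<bar>f y\<bar> * min 2 \<bar>y \<bullet> ((1 / sqrt t) *\<^sub>R \<eta>)\<bar>) \<le> 2 * \<bar>f y\<bar>"
        by (intro always_eventually allI AE_I2) (auto simp: abs_mult mult.commute[of 2] intro!: mult_left_mono)
      show "AE y in lborel. ((\<lambda>t. \<bar>f y\<bar> * min 2 \<bar>y \<bullet> ((1 / sqrt t) *\<^sub>R \<eta>)\<bar>) \<longlongrightarrow> 0) at_top"
      proof (rule AE_I2)
        fix y
        have s: "((\<lambda>t. 1 / sqrt t) \<longlongrightarrow> (0::real)) at_top" by real_asymp
        have "((\<lambda>t. \<bar>f y\<bar> * min 2 \<bar>y \<bullet> ((1 / sqrt t) *\<^sub>R \<eta>)\<bar>) \<longlongrightarrow> \<bar>f y\<bar> * min 2 \<bar>y \<bullet> (0 *\<^sub>R \<eta>)\<bar>) at_top"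
          by (intro tendsto_intros s)
        then show "((\<lambda>t. \<bar>f y\<bar> * min 2 \<bar>y \<bullet> ((1 / sqrt t) *\<^sub>R \<eta>)\<bar>) \<longlongrightarrow> 0) at_top" by simp
      qed
    qed (use f in auto)
    then show ?thesis by (simp add: D_def)
  qed
  have wD: "\<bar>wave f \<xi> x - m * cos (x \<bullet> \<xi>)\<bar> \<le> D \<xi>" for \<xi> x
  proof -
    have ci: "integrable lborel (\<lambda>y. cos ((x - y) \<bullet> \<xi>) * f y)"
      by (rule integrable_mult_bbound(2)[OF f(1), of _ 1]) (auto simp: bbound_def)
    have "wave f \<xi> x - m * cos (x \<bullet> \<xi>) = (LINT y|lborel. cos ((x - y) \<bullet> \<xi>) * f y - cos (x \<bullet> \<xi>) * f y)"
      unfolding wave_def m_def using f(1) ci by (subst Bochner_Integration.integral_diff) auto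
    also have "\<bar>\<dots>\<bar> \<le> D \<xi>"
      unfolding D_def
    proof (rule Bochner_Integration.integral_abs_bound_integral)
      show "integrable lborel (\<lambda>y. cos ((x - y) \<bullet> \<xi>) * f y - cos (x \<bullet> \<xi>) * f y)" using f(1) ci by auto
      fix y
      have "\<bar>cos ((x - y) \<bullet> \<xi>) - cos (x \<bullet> \<xi>)\<bar> \<le> min 2 \<bar>y \<bullet> \<xi>\<bar>"
        using cos_lipschitz[of "(x - y) \<bullet> \<xi>" "x \<bullet> \<xi>"] by (simp add: inner_diff_left)
      from mult_left_mono[OF this, of "\<bar>f y\<bar>"]
      show "\<bar>cos ((x - y) \<bullet> \<xi>) * f y - cos (x \<bullet> \<xi>) * f y\<bar> \<le> \<bar>f y\<bar> * min 2 \<bar>y \<bullet> \<xi>\<bar>"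
        by (simp add: left_diff_distrib[symmetric] abs_mult) (simp add: mult.commute)
    qed (rule Di)
    finally show ?thesis .
  qed
  define b where "b t = t powr ?p * ((1 + t) * exp (- t)) * B
      + (L * (t powr ?p * (LINT \<xi>|lborel. \<bar>symbol t \<xi> - gauss_symbol t \<xi>\<bar>))
        + (LINT \<eta>|lborel. gauss_symbol 1 \<eta> * D ((1 / sqrt t) *\<^sub>R \<eta>))) / ?c" for t
  have lim2: "((\<lambda>t. LINT \<eta>|lborel. gauss_symbol 1 \<eta> * D ((1 / sqrt t) *\<^sub>R \<eta>)) \<longlongrightarrow> (LINT \<eta>|(lborel::'a measure). (0::real))) at_top"
  proof (rule integral_dominated_convergence_at_top[where w="\<lambda>\<eta>. gauss_symbol 1 \<eta> * (2 * L)"])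
    show "\<forall>\<^sub>F t in at_top. AE \<eta> in lborel. norm (gauss_symbol 1 \<eta> * D ((1 / sqrt t) *\<^sub>R \<eta>)) \<le> gauss_symbol 1 \<eta> * (2 * L)"
      by (intro always_eventually allI AE_I2)
         (auto simp: abs_mult gauss_symbol_def simp del: scaleR_scaleR intro!: mult_left_mono bboundD(2)[OF Db])
    show "AE \<eta> in lborel. ((\<lambda>t. gauss_symbol 1 \<eta> * D ((1 / sqrt t) *\<^sub>R \<eta>)) \<longlongrightarrow> 0) at_top"
      using tendsto_mult_left[OF D0] by (intro AE_I2) fastforce
  qed (use gauss_symbol_integrable[of 1] in auto)
  have "(b \<longlongrightarrow> 0 * B + (L * 0 + 0) / ?c) at_top"
    unfolding b_def using lim2 symbol_limit
    by (intro tendsto_add tendsto_divide tendsto_mult tendsto_const tendsto_powr_exp(2)[of 1]) auto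
  then have b0: "(b \<longlongrightarrow> 0) at_top" by simp
  have main: "t powr ?p * \<bar>free.heat t f x - m * heat_kernel (diffusivity J) x t\<bar> \<le> b t" if t: "0 < t" for t x
  proof -
    have si: "integrable lborel (symbol t)" using t by (intro symbol_integrable) auto
    note gi = gauss_symbol_integrable[OF t]
    have wb: "bbound (\<lambda>\<xi>. wave f \<xi> x) L"
      using wave_bound[OF f(1)] wave_slice[of f x] by (auto simp: bbound_def L_def)
    have cb: "bbound (\<lambda>\<xi>. m * cos (x \<bullet> \<xi>)) (\<bar>m\<bar> * 1)"
      by (rule bbound_cmult) (auto simp: bbound_def)
    have hk: "m * heat_kernel (diffusivity J) x t = (LINT \<xi>|lborel. gauss_symbol t \<xi> * (m * cos (x \<bullet> \<xi>))) / ?c"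
      unfolding heat_kernel_fourier[OF diffusivity_pos t] gauss_symbol_def
      by (simp add: mult.left_commute[of _ m])
    have i1: "integrable lborel (\<lambda>\<xi>. (symbol t \<xi> - gauss_symbol t \<xi>) * wave f \<xi> x)"
      using si gi by (intro integrable_mult_bbound(1)[OF _ wb]) auto
    have i2: "integrable lborel (\<lambda>\<xi>. gauss_symbol t \<xi> * (wave f \<xi> x - m * cos (x \<bullet> \<xi>)))"
      by (intro integrable_mult_bbound(1)[OF gi bbound_diff[OF wb cb]])
    have "(LINT \<xi>|lborel. symbol t \<xi> * wave f \<xi> x) - (LINT \<xi>|lborel. gauss_symbol t \<xi> * (m * cos (x \<bullet> \<xi>)))
       = (LINT \<xi>|lborel. symbol t \<xi> * wave f \<xi> x - gauss_symbol t \<xi> * (m * cos (x \<bullet> \<xi>)))"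
      by (intro Bochner_Integration.integral_diff[symmetric] integrable_mult_bbound(1)[OF si wb] integrable_mult_bbound(1)[OF gi cb])
    also have "\<dots> = (LINT \<xi>|lborel. (symbol t \<xi> - gauss_symbol t \<xi>) * wave f \<xi> x + gauss_symbol t \<xi> * (wave f \<xi> x - m * cos (x \<bullet> \<xi>)))"
      by (simp add: algebra_simps)
    also have "\<dots> = (LINT \<xi>|lborel. (symbol t \<xi> - gauss_symbol t \<xi>) * wave f \<xi> x) + (LINT \<xi>|lborel. gauss_symbol t \<xi> * (wave f \<xi> x - m * cos (x \<bullet> \<xi>)))"
      by (rule Bochner_Integration.integral_add[OF i1 i2])
    finally have split: "(LINT \<xi>|lborel. symbol t \<xi> * wave f \<xi> x) - (LINT \<xi>|lborel. gauss_symbol t \<xi> * (m * cos (x \<bullet> \<xi>)))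
      = (LINT \<xi>|lborel. (symbol t \<xi> - gauss_symbol t \<xi>) * wave f \<xi> x) + (LINT \<xi>|lborel. gauss_symbol t \<xi> * (wave f \<xi> x - m * cos (x \<bullet> \<xi>)))" .
    have A: "\<bar>LINT \<xi>|lborel. (symbol t \<xi> - gauss_symbol t \<xi>) * wave f \<xi> x\<bar> \<le> L * (LINT \<xi>|lborel. \<bar>symbol t \<xi> - gauss_symbol t \<xi>\<bar>)"
      using si gi by (intro integral_mult_bbound_le wb) auto
    have Bd: "\<bar>LINT \<xi>|lborel. gauss_symbol t \<xi> * (wave f \<xi> x - m * cos (x \<bullet> \<xi>))\<bar> \<le> (LINT \<xi>|lborel. gauss_symbol t \<xi> * D \<xi>)"
    proof (rule Bochner_Integration.integral_abs_bound_integral[OF i2 integrable_mult_bbound(1)[OF gi Db]])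
      show "\<bar>gauss_symbol t \<xi> * (wave f \<xi> x - m * cos (x \<bullet> \<xi>))\<bar> \<le> gauss_symbol t \<xi> * D \<xi>" for \<xi>
        using mult_left_mono[OF wD[of \<xi> x], of "gauss_symbol t \<xi>"] by (simp add: abs_mult gauss_symbol_def)
    qed
    have sc: "t powr ?p * (LINT \<xi>|lborel. gauss_symbol t \<xi> * D \<xi>) = (LINT \<eta>|lborel. gauss_symbol 1 \<eta> * D ((1 / sqrt t) *\<^sub>R \<eta>))"
      using scaled_integral[of "\<lambda>\<xi>. gauss_symbol t \<xi> * D \<xi>" t] t by (simp add: gauss_symbol_scale)
    have "free.heat t f x - m * heat_kernel (diffusivity J) x t
       = (exp (- t) * f x + t * exp (- t) * free.step f x)
       + ((LINT \<xi>|lborel. symbol t \<xi> * wave f \<xi> x) - (LINT \<xi>|lborel. gauss_symbol t \<xi> * (m * cos (x \<bullet> \<xi>)))) / ?c"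
      unfolding heat_representation[OF t f] hk diff_divide_distrib by simp
    then have "\<bar>free.heat t f x - m * heat_kernel (diffusivity J) x t\<bar>
       \<le> (1 + t) * exp (- t) * B + \<bar>(LINT \<xi>|lborel. symbol t \<xi> * wave f \<xi> x) - (LINT \<xi>|lborel. gauss_symbol t \<xi> * (m * cos (x \<bullet> \<xi>)))\<bar> / ?c"
      using low_jumps_bound[OF t f(2), of x]
      by (simp only:) (rule order_trans[OF abs_triangle_ineq], rule add_mono, simp_all)
    also have "\<dots> \<le> (1 + t) * exp (- t) * B + (L * (LINT \<xi>|lborel. \<bar>symbol t \<xi> - gauss_symbol t \<xi>\<bar>) + (LINT \<xi>|lborel. gauss_symbol t \<xi> * D \<xi>)) / ?c"
      unfolding split using A Bd by (intro add_left_mono divide_right_mono) auto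
    finally have "t powr ?p * \<bar>free.heat t f x - m * heat_kernel (diffusivity J) x t\<bar>
      \<le> t powr ?p * ((1 + t) * exp (- t) * B + (L * (LINT \<xi>|lborel. \<bar>symbol t \<xi> - gauss_symbol t \<xi>\<bar>) + (LINT \<xi>|lborel. gauss_symbol t \<xi> * D \<xi>)) / ?c)"
      by (rule mult_left_mono) auto
    also have "\<dots> = b t"
      unfolding b_def sc[symmetric] by (simp only: distrib_left times_divide_eq_right mult_ac)
    finally show ?thesis .
  qed
  show ?thesis using b0 main unfolding m_def by blast
qed

end

section \<open>The walk killed outside a set\<close>

text \<open>A jump counts only if it starts and ends in \<open>W\<close>. Restricting both arguments of the kernel, and not only the target, keeps the operator symmetric.\<close>

locale killed_walk = radial_density J for J :: "'a::euclidean_space \<Rightarrow> real" +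
  fixes W :: "'a set"
  assumes W_borel [measurable]: "W \<in> sets borel"
begin

definition killed :: "'a \<Rightarrow> 'a \<Rightarrow> real" where
  "killed x y = indicator W x * J (x - y) * indicator W y"

lemma killed_le: "killed x y \<le> J (x - y)"
  by (auto simp: killed_def indicator_def J_nonneg)

sublocale kill: symmetric_kernel killed
proof
  show int: "integrable lborel (killed x)" for x
  proof -
    have "integrable lborel (\<lambda>y. (indicator W x * J (x - y)) * indicator W y)"
      by (rule integrable_mult_bbound(1)[OF integrable_mult_right[OF J_shift_integrable] bbound_indicator[OF W_borel]])
    then show ?thesis by (simp add: killed_def[abs_def])
  qed
  show "(LINT y|lborel. killed x y) \<le> 1" for x
    using integral_mono[OF int J_shift_integrable killed_le, of x] by (simp add: J_shift_mass)
  show "killed x y = killed y x" for x y by (simp add: killed_def J_even(2)[of x y] mult_ac)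
  show "case_prod killed \<in> borel_measurable (borel \<Otimes>\<^sub>M borel)" unfolding killed_def by measurable
qed (auto simp: killed_def J_nonneg)

lemma kill_step_eq: "kill.step f x = indicator W x * free.step (\<lambda>y. indicator W y * f y) x"
  unfolding kill.step_def free.step_def killed_def by (simp add: mult.assoc)

lemma kill_le_free:
  "bbound f B \<Longrightarrow> (\<And>x. 0 \<le> f x) \<Longrightarrow> kill.heat t f x \<le> free.heat t f x"
  by (rule heat_domination[OF kill.symmetric_kernel_axioms free.symmetric_kernel_axioms killed_le])

lemma free_minus_kill_le:
  "bbound f B \<Longrightarrow> free.heat t f x - kill.heat t f x \<le> B * (1 - kill.heat t (\<lambda>_. 1) x)"
  by (rule heat_loss_le[OF kill.symmetric_kernel_axioms free.symmetric_kernel_axioms killed_le])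

end

section \<open>Borel representatives\<close>

text \<open>The given functions are Lebesgue measurable and determined almost everywhere. They are replaced by Borel functions, because Fubini's theorem needs measurability for the product of Borel measures.\<close>

lemma borel_representative:
  fixes f :: "'a::euclidean_space \<Rightarrow> real"
  assumes "f \<in> borel_measurable lebesgue"
  shows "\<exists>g. g \<in> borel_measurable borel \<and> (AE x in lborel. f x = g x)"
  using completion_ex_borel_measurable_real[OF assms] by auto

lemma representative_integral:
  fixes f g :: "'a::euclidean_space \<Rightarrow> real"
  assumes f: "f \<in> borel_measurable lebesgue" and g: "g \<in> borel_measurable borel"
    and fg: "AE x in lborel. f x = g x"
  shows "(LINT x|lebesgue. f x) = (LINT x|lborel. g x)" "integrable lebesgue f \<longleftrightarrow> integrable lborel g"
proof -
  have g': "g \<in> borel_measurable lborel" "g \<in> borel_measurable lebesgue"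
    using g by (auto intro: measurable_completion)
  have ae: "AE x in lebesgue. f x = g x" using fg by (simp add: AE_completion_iff)
  have "(LINT x|lebesgue. f x) = (LINT x|lebesgue. g x)"
    by (rule integral_cong_AE[OF f g'(2) ae])
  also have "\<dots> = (LINT x|lborel. g x)" by (rule integral_completion[OF g'(1)])
  finally show "(LINT x|lebesgue. f x) = (LINT x|lborel. g x)" .
  have "integrable lebesgue f \<longleftrightarrow> integrable lebesgue g"
    by (rule integrable_cong_AE[OF f g'(2) ae])
  also have "\<dots> \<longleftrightarrow> integrable lborel g" by (rule integrable_completion[OF g'(1)])
  finally show "integrable lebesgue f \<longleftrightarrow> integrable lborel g" .
qed

text \<open>Test with the sign of the function.\<close>

lemma AE_zero_of_orthogonal:
  assumes "f \<in> borel_measurable borel" "integrable lborel f"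
    and orth: "\<And>\<psi>. bbound \<psi> 1 \<Longrightarrow> (LINT x|lborel. f x * \<psi> x) = 0"
  shows "AE x in lborel. f x = 0"
proof -
  have [measurable]: "f \<in> borel_measurable borel" by fact
  have "bbound (\<lambda>x. sgn (f x)) 1" by (auto simp: bbound_def sgn_if)
  from orth[OF this] have "(LINT x|lborel. \<bar>f x\<bar>) = 0" by (simp only: abs_sgn)
  then show ?thesis using assms(2) by (subst (asm) integral_nonneg_eq_0_iff_AE) auto
qed

section \<open>The solution is the killed semigroup\<close>

text \<open>The remainder of order \<open>n\<close> is at most a constant times \<open>T^n/n!\<close>. Uniqueness for the evolution
  equation rests on this.\<close>

lemma taylor_sums_of_bounded_derivatives:
  fixes D :: "nat \<Rightarrow> real \<Rightarrow> real"
  assumes T: "0 < T"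
    and der: "\<And>m s. s \<in> {0..T} \<Longrightarrow> (D m has_vector_derivative D (Suc m) s) (at s within {0..T})"
    and K: "\<And>m s. s \<in> {0..T} \<Longrightarrow> \<bar>D m s\<bar> \<le> K"
  shows "(\<lambda>i. T ^ i / fact i * D i 0) sums D 0 T"
proof -
  have K0: "0 \<le> K" using K[of 0 0] T by auto
  have rem: "\<bar>D 0 T - (\<Sum>i<Suc n. T ^ i / fact i * D i 0)\<bar> \<le> (T ^ n / fact n) * (K * T)" for n
  proof -
    have "((\<lambda>x. ((T - x) ^ (Suc n - 1) / fact (Suc n - 1)) *\<^sub>R D (Suc n) x) has_integral
        D 0 T - (\<Sum>i<Suc n. ((T - 0) ^ i / fact i) *\<^sub>R D i 0)) {0..T}"
      by (rule Taylor_has_integral[where f="D 0" and Df=D]) (use T der in auto)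
    then have I: "((\<lambda>x. (T - x) ^ n / fact n * D (Suc n) x) has_integral
        D 0 T - (\<Sum>i<Suc n. T ^ i / fact i * D i 0)) (cbox 0 T)" by (simp del: sum.lessThan_Suc)
    have "norm (D 0 T - (\<Sum>i<Suc n. T ^ i / fact i * D i 0)) \<le> (T ^ n / fact n * K) * measure lborel (cbox 0 T)"
    proof (rule has_integral_bound[OF _ I])
      show "0 \<le> T ^ n / fact n * K" using T K0 by simp
      fix x assume x: "x \<in> cbox 0 T"
      have "\<bar>T - x\<bar> ^ n \<le> T ^ n" using x by (intro power_mono) auto
      then show "norm ((T - x) ^ n / fact n * D (Suc n) x) \<le> T ^ n / fact n * K"
        using K[of x "Suc n"] x T by (auto simp: abs_mult power_abs intro!: mult_mono divide_right_mono)
    qed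
    then show ?thesis using T by (simp add: mult_ac del: sum.lessThan_Suc)
  qed
  have lim: "(\<lambda>n. (T ^ n / fact n) * (K * T)) \<longlonglongrightarrow> 0 * (K * T)"
  proof (intro tendsto_mult tendsto_const)
    have "(\<lambda>n. inverse (fact n) * T ^ n) \<longlonglongrightarrow> 0"
      by (rule summable_LIMSEQ_zero[OF summable_exp])
    then show "(\<lambda>n. T ^ n / fact n) \<longlonglongrightarrow> 0" by (simp add: divide_inverse mult.commute)
  qed
  have "(\<lambda>n. D 0 T - (\<Sum>i<Suc n. T ^ i / fact i * D i 0)) \<longlonglongrightarrow> 0"
    by (rule Lim_null_comparison[OF always_eventually[OF allI]]) (use rem lim in \<open>auto simp del: sum.lessThan_Suc\<close>)
  then have "(\<lambda>n. D 0 T - (D 0 T - (\<Sum>i<Suc n. T ^ i / fact i * D i 0))) \<longlonglongrightarrow> D 0 T - 0"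
    by (intro tendsto_diff tendsto_const)
  then have "(\<lambda>n. \<Sum>i<Suc n. T ^ i / fact i * D i 0) \<longlonglongrightarrow> D 0 T" by simp
  then show ?thesis unfolding sums_def by (rule LIMSEQ_imp_Suc)
qed

text \<open>Convergence of tagged sums in L1 implies convergence of their pairings with a bounded function, so that the
  equation for the solution becomes an ordinary integral equation for numbers.\<close>

lemma has_L1_integral_pairing:
  fixes g :: "real \<Rightarrow> 'a::euclidean_space \<Rightarrow> real"
  assumes I: "has_L1_integral g G 0 t"
    and gm: "\<And>s. s \<in> {0..t} \<Longrightarrow> g s \<in> borel_measurable lebesgue"
    and gb: "\<And>s. s \<in> {0..t} \<Longrightarrow> integrable lborel (gb s)" "\<And>s. s \<in> {0..t} \<Longrightarrow> AE x in lborel. g s x = gb s x"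
    and Gb: "Gb \<in> borel_measurable borel" "AE x in lborel. G x = Gb x" and psi: "bbound \<psi> B"
  shows "((\<lambda>s. LINT x|lborel. gb s x * \<psi> x) has_integral (LINT x|lborel. Gb x * \<psi> x)) {0..t}"
proof -
  have Gi: "integrable lebesgue G" and lim: "((\<lambda>p. LINT x|lebesgue. \<bar>(\<Sum>(s, K)\<in>p. measure lborel K * g s x) - G x\<bar>) \<longlongrightarrow> 0) (division_filter {0..t})"
    using I by (auto simp: has_L1_integral_def)
  have Gbi: "integrable lborel Gb"
    using representative_integral(2)[OF _ Gb] Gi by auto
  define S where "S p x = (\<Sum>(s, K)\<in>p. measure lborel K * gb s x)" for p :: "(real \<times> real set) set" and x
  have tag: "\<forall>\<^sub>F p in division_filter {0..t}. p tagged_division_of {0..t}"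
    by (rule eventually_division_filter_tagged_division)
  have "\<forall>\<^sub>F p in division_filter {0..t}.
     norm ((\<Sum>(s, K)\<in>p. measure lborel K *\<^sub>R (LINT x|lborel. gb s x * \<psi> x)) - (LINT x|lborel. Gb x * \<psi> x))
       \<le> B * (LINT x|lebesgue. \<bar>(\<Sum>(s, K)\<in>p. measure lborel K * g s x) - G x\<bar>)"
    using tag
  proof eventually_elim
    fix p assume p: "p tagged_division_of {0..t}"
    have fin: "finite p" using p by auto
    have mem: "s \<in> {0..t}" if "(s, K) \<in> p" for s K
      using tagged_division_ofD(2,3)[OF p that] by blast
    have Si: "integrable lborel (S p)"
      unfolding S_def[abs_def] case_prod_unfold using gb(1) mem by (intro Bochner_Integration.integrable_sum integrable_mult_right) force
    have ae: "AE x in lborel. \<forall>z\<in>p. g (fst z) x = gb (fst z) x"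
      by (subst AE_finite_all[OF fin]) (use gb(2) mem in force)
    have ae2: "AE x in lborel. \<bar>(\<Sum>(s, K)\<in>p. measure lborel K * g s x) - G x\<bar> = \<bar>S p x - Gb x\<bar>"
      using ae Gb(2)
    proof eventually_elim
      fix x assume "\<forall>z\<in>p. g (fst z) x = gb (fst z) x" "G x = Gb x"
      then have "(\<Sum>(s, K)\<in>p. measure lborel K * g s x) = S p x"
        unfolding S_def case_prod_unfold by (intro sum.cong) auto
      then show "\<bar>(\<Sum>(s, K)\<in>p. measure lborel K * g s x) - G x\<bar> = \<bar>S p x - Gb x\<bar>" using \<open>G x = Gb x\<close> by simp
    qed
    have Sm: "(\<lambda>x. \<bar>S p x - Gb x\<bar>) \<in> borel_measurable borel" using Si Gb(1) by auto
    have "(\<lambda>x. \<bar>(\<Sum>(s, K)\<in>p. measure lborel K * g s x) - G x\<bar>) \<in> borel_measurable lebesgue"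
      using Gi gm mem unfolding case_prod_unfold
      by (intro borel_measurable_abs borel_measurable_diff borel_measurable_sum borel_measurable_times) force+
    then have eq: "(LINT x|lebesgue. \<bar>(\<Sum>(s, K)\<in>p. measure lborel K * g s x) - G x\<bar>) = (LINT x|lborel. \<bar>S p x - Gb x\<bar>)"
      by (rule representative_integral(1)[OF _ Sm ae2])
    have "(\<Sum>(s, K)\<in>p. measure lborel K *\<^sub>R (LINT x|lborel. gb s x * \<psi> x)) = (LINT x|lborel. S p x * \<psi> x)"
    proof -
      have "(LINT x|lborel. S p x * \<psi> x) = (LINT x|lborel. (\<Sum>z\<in>p. measure lborel (snd z) * (gb (fst z) x * \<psi> x)))"
        unfolding S_def case_prod_unfold sum_distrib_right by (simp only: mult.assoc)
      also have "\<dots> = (\<Sum>z\<in>p. (LINT x|lborel. measure lborel (snd z) * (gb (fst z) x * \<psi> x)))"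
        using gb(1) mem by (intro Bochner_Integration.integral_sum integrable_mult_right integrable_mult_bbound(1)[OF _ psi]) force
      finally show ?thesis by (simp add: case_prod_unfold)
    qed
    then have "(\<Sum>(s, K)\<in>p. measure lborel K *\<^sub>R (LINT x|lborel. gb s x * \<psi> x)) - (LINT x|lborel. Gb x * \<psi> x)
       = (LINT x|lborel. (S p x - Gb x) * \<psi> x)"
      using integrable_mult_bbound(1)[OF Si psi] integrable_mult_bbound(1)[OF Gbi psi] by (simp add: left_diff_distrib)
    then show "norm ((\<Sum>(s, K)\<in>p. measure lborel K *\<^sub>R (LINT x|lborel. gb s x * \<psi> x)) - (LINT x|lborel. Gb x * \<psi> x))
       \<le> B * (LINT x|lebesgue. \<bar>(\<Sum>(s, K)\<in>p. measure lborel K * g s x) - G x\<bar>)"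
      unfolding eq using integral_mult_bbound_le[OF Bochner_Integration.integrable_diff[OF Si Gbi] psi] by simp
  qed
  moreover have "((\<lambda>p. B * (LINT x|lebesgue. \<bar>(\<Sum>(s, K)\<in>p. measure lborel K * g s x) - G x\<bar>)) \<longlongrightarrow> 0) (division_filter {0..t})"
    using tendsto_mult[OF tendsto_const lim, of B] by simp
  ultimately have "((\<lambda>p. (\<Sum>(s, K)\<in>p. measure lborel K *\<^sub>R (LINT x|lborel. gb s x * \<psi> x)) - (LINT x|lborel. Gb x * \<psi> x)) \<longlongrightarrow> 0) (division_filter {0..t})"
    by (rule Lim_null_comparison)
  then have "((\<lambda>p. \<Sum>(s, K)\<in>p. measure lborel K *\<^sub>R (LINT x|lborel. gb s x * \<psi> x)) \<longlongrightarrow> (LINT x|lborel. Gb x * \<psi> x)) (division_filter (cbox 0 t))"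
    by (subst Lim_null) simp
  then show ?thesis unfolding has_integral_cbox[symmetric] by simp
qed

context killed_walk
begin

text \<open>Pair the solution with the iterates \<open>T^m \<psi>\<close> of a bounded function and multiply by \<open>exp s\<close>. By symmetry of \<open>T\<close>, each of these numbers is the derivative of the one before, and all have a common bound since \<open>T\<close> is a contraction. Their Taylor series at time 0 is the Poisson sum of the killed semigroup.\<close>

theorem solution_is_heat:
  assumes sol: "nonlocal_solution J H u0 u" and WH: "W = - H"
    and v0: "integrable lborel v0" "bbound v0 B" "AE x in lborel. u0 x = v0 x" "\<And>x. x \<notin> W \<Longrightarrow> v0 x = 0"
    and T: "0 < T"
  shows "AE x in lborel. u T x = kill.heat T v0 x"
proof -
  have ui: "integrable lebesgue (u s)" if "0 \<le> s" for s
    using sol that by (auto simp: nonlocal_solution_def L1_continuous_on_def)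
  have "\<forall>s. \<exists>g. 0 \<le> s \<longrightarrow> g \<in> borel_measurable borel \<and> (AE x in lborel. u s x = g x)"
    using borel_representative[OF borel_measurable_integrable[OF ui]] by blast
  from choice[OF this] obtain v where "\<forall>s. 0 \<le> s \<longrightarrow> v s \<in> borel_measurable borel \<and> (AE x in lborel. u s x = v s x)" ..
  then have v: "\<And>s. 0 \<le> s \<Longrightarrow> v s \<in> borel_measurable borel" "\<And>s. 0 \<le> s \<Longrightarrow> AE x in lborel. u s x = v s x"
    by auto
  have vi: "integrable lborel (v s)" if "0 \<le> s" for s
    using representative_integral(2)[OF borel_measurable_integrable[OF ui[OF that]] v(1)[OF that] v(2)[OF that]] ui[OF that] by simp
  define F where "F \<psi> s = (LINT x|lborel. v s x * \<psi> x)" for \<psi> s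
  have L1: "(LINT x|lebesgue. \<bar>u s x - u t x\<bar>) = (LINT x|lborel. \<bar>v s x - v t x\<bar>)" if "0 \<le> s" "0 \<le> t" for s t
  proof (rule representative_integral(1))
    show "(\<lambda>x. \<bar>u s x - u t x\<bar>) \<in> borel_measurable lebesgue" using ui that by auto
    show "(\<lambda>x. \<bar>v s x - v t x\<bar>) \<in> borel_measurable borel" using v(1)[OF that(1)] v(1)[OF that(2)] by auto
    show "AE x in lborel. \<bar>u s x - u t x\<bar> = \<bar>v s x - v t x\<bar>"
      using v(2)[OF that(1)] v(2)[OF that(2)] by eventually_elim simp
  qed
  have Lcont: "((\<lambda>s. LINT x|lebesgue. \<bar>u s x - u t x\<bar>) \<longlongrightarrow> 0) (at t within {0..})" if "0 \<le> t" for t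
    using sol that by (auto simp: nonlocal_solution_def L1_continuous_on_def)
  have within: "\<forall>\<^sub>F s in at t within {0..}. 0 \<le> s" for t :: real
    by (simp add: eventually_at_filter)
  have Fcont: "continuous_on {0..} (F \<psi>)" if psi: "bbound \<psi> C" for \<psi> C
    unfolding continuous_on_def
  proof
    fix t :: real assume t: "t \<in> {0..}"
    have "((\<lambda>s. F \<psi> s - F \<psi> t) \<longlongrightarrow> 0) (at t within {0..})"
    proof (rule Lim_null_comparison)
      show "((\<lambda>s. C * (LINT x|lebesgue. \<bar>u s x - u t x\<bar>)) \<longlongrightarrow> 0) (at t within {0..})"
        using tendsto_mult[OF tendsto_const Lcont[of t], of C] t by simp
      show "\<forall>\<^sub>F s in at t within {0..}. norm (F \<psi> s - F \<psi> t) \<le> C * (LINT x|lebesgue. \<bar>u s x - u t x\<bar>)"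
        using within
      proof eventually_elim
        fix s :: real assume s: "0 \<le> s"
        have "F \<psi> s - F \<psi> t = (LINT x|lborel. (v s x - v t x) * \<psi> x)"
          unfolding F_def left_diff_distrib using s t vi psi
          by (intro Bochner_Integration.integral_diff[symmetric] integrable_mult_bbound) auto
        then show "norm (F \<psi> s - F \<psi> t) \<le> C * (LINT x|lebesgue. \<bar>u s x - u t x\<bar>)"
          using integral_mult_bbound_le[OF Bochner_Integration.integrable_diff[OF vi vi] psi, of s t] s t by (simp add: L1)
      qed
    qed
    then show "(F \<psi> \<longlongrightarrow> F \<psi> t) (at t within {0..})" by (subst Lim_null)
  qed
  have vzero: "AE x in lborel. x \<notin> W \<longrightarrow> v s x = 0" if "0 < s" for s
  proof -
    have "AE x in lborel. x \<in> H \<longrightarrow> u s x = 0"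
      using sol that by (auto simp: nonlocal_solution_def AE_completion_iff)
    then show ?thesis using v(2)[of s] that WH by (auto elim!: eventually_elim2)
  qed
  have conv_eq: "conv J (u s) = free.step (v s)" if "0 \<le> s" for s
  proof
    fix x
    have m: "(\<lambda>y. J (x - y)) \<in> borel_measurable borel" by measurable
    have m': "(\<lambda>y. J (x - y)) \<in> borel_measurable lebesgue" by (rule measurable_completion) simp
    show "conv J (u s) x = free.step (v s) x"
      unfolding conv_def free.step_def
    proof (rule representative_integral(1))
      show "(\<lambda>y. J (x - y) * u s y) \<in> borel_measurable lebesgue" using m' ui[OF that] by auto
      show "(\<lambda>y. J (x - y) * v s y) \<in> borel_measurable borel" using m v(1)[OF that] by auto
      show "AE y in lborel. J (x - y) * u s y = J (x - y) * v s y" using v(2)[OF that] by eventually_elim simp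
    qed
  qed
  have fsi: "integrable lborel (free.step (v s))" if "0 \<le> s" for s
    by (rule free.integrable_step_L1[OF vi[OF that]])
  define c where "c \<psi> = (LINT x|lborel. v0 x * \<psi> x)" for \<psi>
  \<comment> \<open>The equation tested with a bounded function; the killed walk is symmetric, so it acts on the test function.\<close>
  have weak: "((\<lambda>s. F (kill.step \<psi>) s - F \<psi> s) has_integral (F \<psi> t - c \<psi>)) {0..t}"
    if t: "0 < t" and psi: "bbound \<psi> C" for t \<psi> C
  proof -
    obtain G where G: "has_L1_integral (\<lambda>s x. conv J (u s) x - u s x) G 0 t"
        and uG: "AE x in lborel. x \<in> - H \<longrightarrow> u t x = u0 x + G x"
      using sol t by (auto simp: nonlocal_solution_def AE_completion_iff)
    have Gi: "integrable lebesgue G" using G by (simp add: has_L1_integral_def)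
    obtain Gb where Gb: "Gb \<in> borel_measurable borel" "AE x in lborel. G x = Gb x"
      using borel_representative[OF borel_measurable_integrable[OF Gi]] by blast
    have Gbi: "integrable lborel Gb"
      using representative_integral(2)[OF borel_measurable_integrable[OF Gi] Gb] Gi by simp
    define \<omega> where "\<omega> x = indicator W x * \<psi> x" for x
    have chi: "bbound \<omega> (1 * C)" unfolding \<omega>_def by (rule bbound_mult[OF bbound_indicator[OF W_borel] psi])
    note chim = bboundD(1)[OF chi]
    have "((\<lambda>s. LINT x|lborel. (free.step (v s) x - v s x) * \<omega> x) has_integral (LINT x|lborel. Gb x * \<omega> x)) {0..t}"
    proof (rule has_L1_integral_pairing[OF G _ _ _ Gb chi])
      fix s assume "s \<in> {0..t}"
      then have s: "0 \<le> s" by simp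
      show "integrable lborel (\<lambda>x. free.step (v s) x - v s x)" using fsi[OF s] vi[OF s] by simp
      show "AE x in lborel. conv J (u s) x - u s x = free.step (v s) x - v s x"
        using v(2)[OF s] unfolding conv_eq[OF s] by eventually_elim simp
      have "free.step (v s) \<in> borel_measurable lebesgue" using fsi[OF s] by (intro measurable_completion) auto
      then show "(\<lambda>x. conv J (u s) x - u s x) \<in> borel_measurable lebesgue"
        unfolding conv_eq[OF s] using ui[OF s] by auto
    qed
    moreover have "(LINT x|lborel. (free.step (v s) x - v s x) * \<omega> x) = F (kill.step \<psi>) s - F \<psi> s" if s: "0 < s" for s
    proof -
      have s0: "0 \<le> s" using s by simp
      have "(LINT x|lborel. (free.step (v s) x - v s x) * \<omega> x) = (LINT x|lborel. free.step (v s) x * \<omega> x) - (LINT x|lborel. v s x * \<omega> x)"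
        unfolding left_diff_distrib
        by (intro Bochner_Integration.integral_diff integrable_mult_bbound(1)[OF fsi[OF s0] chi] integrable_mult_bbound(1)[OF vi[OF s0] chi])
      moreover have "(LINT x|lborel. free.step (v s) x * \<omega> x) = (LINT x|lborel. v s x * free.step \<omega> x)"
        by (rule free.step_symmetric[OF vi[OF s0] chi])
      moreover have "(LINT x|lborel. v s x * free.step \<omega> x) = F (kill.step \<psi>) s"
        unfolding F_def
      proof (rule integral_cong_AE)
        show "AE x in lborel. v s x * free.step \<omega> x = v s x * kill.step \<psi> x"
          using vzero[OF s] by eventually_elim (auto simp: kill_step_eq \<omega>_def[abs_def] indicator_def)
      qed (use v(1)[OF s0] bboundD(1)[OF free.bbound_step[OF chi]] bboundD(1)[OF kill.bbound_step[OF psi]] in auto)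
      moreover have "(LINT x|lborel. v s x * \<omega> x) = F \<psi> s"
        unfolding F_def
      proof (rule integral_cong_AE)
        show "AE x in lborel. v s x * \<omega> x = v s x * \<psi> x"
          using vzero[OF s] by eventually_elim (auto simp: \<omega>_def indicator_def)
      qed (use v(1)[OF s0] chim bboundD(1)[OF psi] in auto)
      ultimately show ?thesis by simp
    qed
    \<comment> \<open>The solution is not required to vanish in the hole at time 0, so that this one time is excluded.\<close>
    ultimately have "((\<lambda>s. F (kill.step \<psi>) s - F \<psi> s) has_integral (LINT x|lborel. Gb x * \<omega> x)) {0..t}"
      by (elim has_integral_spike[of "{0}", rotated 2]) auto
    moreover have "(LINT x|lborel. Gb x * \<omega> x) = F \<psi> t - c \<psi>"
    proof -
      have t0: "0 \<le> t" using t by simp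
      have "F \<psi> t = (LINT x|lborel. v0 x * \<psi> x + Gb x * \<omega> x)"
        unfolding F_def
      proof (rule integral_cong_AE)
        show "AE x in lborel. v t x * \<psi> x = v0 x * \<psi> x + Gb x * \<omega> x"
          using vzero[OF t] v(2)[OF t0] uG v0(3) Gb(2)
          by eventually_elim (use WH v0(4) in \<open>auto simp: \<omega>_def indicator_def distrib_right\<close>)
      qed (use v(1)[OF t0] Gb(1) chim bboundD(1)[OF psi] bboundD(1)[OF v0(2)] in auto)
      also have "\<dots> = c \<psi> + (LINT x|lborel. Gb x * \<omega> x)"
        unfolding c_def by (rule Bochner_Integration.integral_add[OF integrable_mult_bbound(1)[OF v0(1) psi] integrable_mult_bbound(1)[OF Gbi chi]])
      finally show ?thesis by simp
    qed
    ultimately show ?thesis by simp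
  qed
  have qcont: "continuous_on {0..} (\<lambda>s. F (kill.step \<psi>) s - F \<psi> s)" if "bbound \<psi> C" for \<psi> C
    by (intro continuous_intros Fcont[OF that] Fcont[OF kill.bbound_step[OF that]])
  have Feq: "F \<psi> t = c \<psi> + integral {0..t} (\<lambda>s. F (kill.step \<psi>) s - F \<psi> s)" if "0 < t" "bbound \<psi> C" for \<psi> C t
    using integral_unique[OF weak[OF that]] by simp
  have der0: "((\<lambda>t. c \<psi> + integral {0..t} (\<lambda>s. F (kill.step \<psi>) s - F \<psi> s)) has_vector_derivative (F (kill.step \<psi>) s - F \<psi> s)) (at s within {0..T})"
    if psi: "bbound \<psi> C" and s: "s \<in> {0..T}" for \<psi> C s
  proof -
    have "((\<lambda>t. integral {0..t} (\<lambda>s. F (kill.step \<psi>) s - F \<psi> s)) has_vector_derivative (F (kill.step \<psi>) s - F \<psi> s)) (at s within {0..T})"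
      by (rule integral_has_vector_derivative[OF _ s]) (rule continuous_on_subset[OF qcont[OF psi]], simp)
    from has_vector_derivative_add[OF has_vector_derivative_const this] show ?thesis by simp
  qed
  \<comment> \<open>The equation is assumed at positive times only; the initial value follows by continuity in L1.\<close>
  have F0: "F \<psi> 0 = c \<psi>" if psi: "bbound \<psi> C" for \<psi> C
  proof -
    let ?h = "\<lambda>t. c \<psi> + integral {0..t} (\<lambda>s. F (kill.step \<psi>) s - F \<psi> s)"
    have "continuous (at 0 within {0..T}) ?h"
      by (rule has_vector_derivative_continuous[OF der0[OF psi]]) (use T in simp)
    then have 1: "(?h \<longlongrightarrow> c \<psi>) (at 0 within {0..T})" by (simp add: continuous_within)
    have "(F \<psi> \<longlongrightarrow> F \<psi> 0) (at 0 within {0..T})"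
      using Fcont[OF psi] by (auto simp: continuous_on_def intro: tendsto_within_subset)
    moreover have "\<forall>\<^sub>F t in at 0 within {0..T}. F \<psi> t = ?h t"
      by (auto simp: eventually_at_filter intro!: always_eventually Feq[OF _ psi])
    ultimately have "(?h \<longlongrightarrow> F \<psi> 0) (at 0 within {0..T})"
      by (rule Lim_transform_eventually)
    moreover have "at (0::real) within {0..T} \<noteq> bot" using T by (simp add: trivial_limit_within islimpt_Icc)
    ultimately show ?thesis using 1 tendsto_unique by blast
  qed
  have Fder: "(F \<psi> has_vector_derivative (F (kill.step \<psi>) s - F \<psi> s)) (at s within {0..T})"
    if psi: "bbound \<psi> C" and s: "s \<in> {0..T}" for \<psi> C s
  proof (rule has_vector_derivative_transform[OF s _ der0[OF psi s]])
    fix t assume "t \<in> {0..T}"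
    then show "F \<psi> t = c \<psi> + integral {0..t} (\<lambda>s. F (kill.step \<psi>) s - F \<psi> s)"
      using Feq[OF _ psi, of t] F0[OF psi] by (cases "t = 0") auto
  qed
  have key: "F \<psi> T = (LINT x|lborel. kill.heat T v0 x * \<psi> x)" if psi: "bbound \<psi> 1" for \<psi>
  proof -
    define D where "D m s = exp s * F ((kill.step ^^ m) \<psi>) s" for m s
    note pm = kill.bbound_steps[OF psi]
    have D_der: "(D m has_vector_derivative D (Suc m) s) (at s within {0..T})" if "s \<in> {0..T}" for m s
    proof -
      have e: "(exp has_vector_derivative exp s) (at s within {0..T})"
        using has_field_derivative_at_within[OF DERIV_exp[of s]]
        by (simp only: has_real_derivative_iff_has_vector_derivative)
      have "((\<lambda>s. exp s * F ((kill.step ^^ m) \<psi>) s) has_vector_derivative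
          exp s * (F (kill.step ((kill.step ^^ m) \<psi>)) s - F ((kill.step ^^ m) \<psi>) s) + exp s * F ((kill.step ^^ m) \<psi>) s) (at s within {0..T})"
        by (rule has_vector_derivative_mult[OF e Fder[OF pm that]])
      then show ?thesis by (simp add: D_def[abs_def] algebra_simps)
    qed
    define N where "N s = (LINT x|lborel. \<bar>v s x\<bar>)" for s
    have "\<exists>K. \<forall>s\<in>{0..T}. N s \<le> K"
    proof -
      have "continuous_on {0..T} N"
        unfolding continuous_on_def
      proof
        fix t assume t: "t \<in> {0..T}"
        have "((\<lambda>s. N s - N t) \<longlongrightarrow> 0) (at t within {0..T})"
        proof (rule Lim_null_comparison)
          show "((\<lambda>s. LINT x|lebesgue. \<bar>u s x - u t x\<bar>) \<longlongrightarrow> 0) (at t within {0..T})"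
            using Lcont[of t] t by (auto intro: tendsto_within_subset)
          show "\<forall>\<^sub>F s in at t within {0..T}. norm (N s - N t) \<le> (LINT x|lebesgue. \<bar>u s x - u t x\<bar>)"
            unfolding eventually_at_filter
          proof (intro always_eventually allI impI)
            fix s assume "s \<in> {0..T}"
            then have s: "0 \<le> s" "0 \<le> t" using t by auto
            have "N s - N t = (LINT x|lborel. \<bar>v s x\<bar> - \<bar>v t x\<bar>)"
              unfolding N_def using vi s by (intro Bochner_Integration.integral_diff[symmetric]) auto
            also have "\<bar>\<dots>\<bar> \<le> (LINT x|lborel. \<bar>v s x - v t x\<bar>)"
              using vi[OF s(1)] vi[OF s(2)] by (intro Bochner_Integration.integral_abs_bound_integral) auto
            finally show "norm (N s - N t) \<le> (LINT x|lebesgue. \<bar>u s x - u t x\<bar>)" using L1[OF s] by simp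
          qed
        qed
        then show "(N \<longlongrightarrow> N t) (at t within {0..T})" by (subst Lim_null)
      qed
      then have "bounded (N ` {0..T})" by (intro compact_imp_bounded compact_continuous_image) auto
      then obtain K where "\<forall>y\<in>N ` {0..T}. norm y \<le> K" unfolding bounded_iff by blast
      then show ?thesis by (intro exI[of _ K]) auto
    qed
    then obtain K where K: "\<And>s. s \<in> {0..T} \<Longrightarrow> N s \<le> K" by blast
    have D_bd: "\<bar>D m s\<bar> \<le> exp T * K" if s: "s \<in> {0..T}" for m s
    proof -
      have "\<bar>F ((kill.step ^^ m) \<psi>) s\<bar> \<le> 1 * N s"
        unfolding F_def N_def using s by (intro integral_mult_bbound_le vi pm) auto
      then have "\<bar>F ((kill.step ^^ m) \<psi>) s\<bar> \<le> K" using K[OF s] by simp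
      then show ?thesis unfolding D_def abs_mult using s by (intro mult_mono) auto
    qed
    have "(\<lambda>i. T ^ i / fact i * D i 0) sums D 0 T"
    proof (rule taylor_sums_of_bounded_derivatives[where D=D and K="exp T * K", OF T])
      show "(D m has_vector_derivative D (Suc m) s) (at s within {0..T})" if "s \<in> {0..T}" for m s
        by (rule D_der[OF that])
      show "\<bar>D m s\<bar> \<le> exp T * K" if "s \<in> {0..T}" for m s by (rule D_bd[OF that])
    qed
    then have 1: "(\<lambda>i. exp (- T) * (T ^ i / fact i * D i 0)) sums (exp (- T) * D 0 T)" by (rule sums_mult)
    have 2: "(\<lambda>i. exp (- T) * (T ^ i / fact i * D i 0)) = (\<lambda>i. T ^ i / fact i * exp (- T) * c ((kill.step ^^ i) \<psi>))"
      unfolding D_def F0[OF pm] by (simp only: exp_zero mult_1 mult_ac)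
    have 3: "exp (- T) * D 0 T = F \<psi> T" by (simp add: D_def mult.assoc[symmetric] exp_add[symmetric])
    note 1 = 1[unfolded 2 3]
    have "\<bar>c ((kill.step ^^ i) \<psi>)\<bar> \<le> 1 * (LINT x|lborel. \<bar>v0 x\<bar>)" for i
      unfolding c_def by (rule integral_mult_bbound_le[OF v0(1) pm])
    from sums_unique2[OF 1 poisson_expectation_sums[OF T this]]
    have "F \<psi> T = measure_pmf.expectation (poisson_pmf T) (\<lambda>i. c ((kill.step ^^ i) \<psi>))" .
    then show ?thesis
      unfolding c_def kill.integral_heat_mult(2)[OF v0(1,2) psi] kill.steps_symmetric[OF v0(1) psi] .
  qed
  have T0: "0 \<le> T" using T by simp
  note hi = kill.integrable_heat[OF v0(1,2), of T]
  have "AE x in lborel. v T x - kill.heat T v0 x = 0"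
  proof (rule AE_zero_of_orthogonal)
    show "(\<lambda>x. v T x - kill.heat T v0 x) \<in> borel_measurable borel" using v(1)[OF T0] hi by auto
    show "integrable lborel (\<lambda>x. v T x - kill.heat T v0 x)" using vi[OF T0] hi by auto
    fix \<psi> :: "'a \<Rightarrow> real" assume psi: "bbound \<psi> 1"
    show "(LINT x|lborel. (v T x - kill.heat T v0 x) * \<psi> x) = 0"
      unfolding left_diff_distrib
      using key[OF psi] integrable_mult_bbound(1)[OF vi[OF T0] psi] integrable_mult_bbound(1)[OF hi psi]
      by (simp add: F_def)
  qed
  then show ?thesis using v(2)[OF T0] by eventually_elim simp
qed

end

section \<open>The stationary solution\<close>

context radial_density
begin

lemma dim_half_pos: "0 < real DIM('a) / 2"
  by simp

lemma free_decay:
  assumes f: "integrable lborel f" "bbound f B"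
  shows "\<exists>C>0. \<forall>\<^sub>F t in at_top. \<forall>x. t powr (real DIM('a) / 2) * \<bar>free.heat t f x\<bar> \<le> C"
proof -
  let ?p = "real DIM('a) / 2"
  obtain C where C: "C > 0" and ev: "\<forall>\<^sub>F t in at_top. \<forall>f B x. integrable lborel f \<longrightarrow> bbound f B \<longrightarrow>
    t powr ?p * \<bar>free.heat t f x\<bar> \<le> t powr ?p * ((1 + t) * exp (- t)) * B + C * (LINT y|lborel. \<bar>f y\<bar>)"
    using free_smoothing by blast
  have small: "\<forall>\<^sub>F t in at_top. t powr ?p * ((1 + t) * exp (- t)) < 1"
    using tendsto_powr_exp(2)[of 1 ?p] by (intro order_tendstoD) auto
  have B: "0 \<le> B" by (rule bbound_nonneg[OF f(2)])
  have "\<forall>\<^sub>F t in at_top. \<forall>x. t powr ?p * \<bar>free.heat t f x\<bar> \<le> B + C * (LINT y|lborel. \<bar>f y\<bar>) + 1"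
    using ev small
  proof (eventually_elim, intro allI)
    fix t x
    assume 1: "\<forall>f B x. integrable lborel f \<longrightarrow> bbound f B \<longrightarrow>
        t powr ?p * \<bar>free.heat t f x\<bar> \<le> t powr ?p * ((1 + t) * exp (- t)) * B + C * (LINT y|lborel. \<bar>f y\<bar>)"
      and 2: "t powr ?p * ((1 + t) * exp (- t)) < 1"
    have "t powr ?p * ((1 + t) * exp (- t)) * B \<le> 1 * B" using 2 B by (intro mult_right_mono) auto
    then show "t powr ?p * \<bar>free.heat t f x\<bar> \<le> B + C * (LINT y|lborel. \<bar>f y\<bar>) + 1"
      using 1[rule_format, OF f, of x] by linarith
  qed
  moreover have "0 < B + C * (LINT y|lborel. \<bar>f y\<bar>) + 1"
    using B C by (simp add: add_nonneg_pos)
  ultimately show ?thesis by blast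
qed

text \<open>The walk leaves every bounded set.\<close>

lemma free_vanishes:
  assumes f: "integrable lborel f" "bbound f B" and e: "0 < e"
  shows "\<forall>\<^sub>F t in at_top. \<forall>x. \<bar>free.heat t f x\<bar> \<le> e"
proof -
  let ?p = "real DIM('a) / 2"
  obtain C where C: "C > 0" and ev: "\<forall>\<^sub>F t in at_top. \<forall>x. t powr ?p * \<bar>free.heat t f x\<bar> \<le> C"
    using free_decay[OF f] by blast
  have "filterlim (\<lambda>t::real. t powr ?p) at_top at_top" using dim_half_pos by real_asymp
  then have "\<forall>\<^sub>F t in at_top. C / e \<le> t powr ?p" by (simp add: filterlim_at_top)
  with ev show ?thesis
  proof (eventually_elim, intro allI)
    fix t x assume 1: "\<forall>x. t powr ?p * \<bar>free.heat t f x\<bar> \<le> C" and 2: "C / e \<le> t powr ?p"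
    have "C / e * \<bar>free.heat t f x\<bar> \<le> t powr ?p * \<bar>free.heat t f x\<bar>" by (rule mult_right_mono[OF 2]) simp
    also have "\<dots> \<le> C" using 1 by blast
    finally show "\<bar>free.heat t f x\<bar> \<le> e" using C e by (simp add: field_simps)
  qed
qed

lemma ball_indicator: "integrable lborel (indicator (cball (0::'a) R) :: 'a \<Rightarrow> real)" "bbound (indicator (cball (0::'a) R)) 1"
  using emeasure_bounded_finite[OF bounded_cball[of "0::'a" R]]
  by (auto intro!: integrable_real_indicator bbound_indicator simp: less_top)

end

context killed_walk
begin

text \<open>The function is at most \<open>c\<close> outside a ball and bounded inside. After a long time the walk is not in the ball, and
  only \<open>c\<close> remains of the fixed point equation.\<close>

lemma fixpoint_le:
  assumes g: "bbound g B" "kill.step g = g" and c: "0 \<le> c" and out: "\<And>x. R < norm x \<Longrightarrow> g x \<le> c"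
  shows "g x \<le> c"
proof (rule field_le_epsilon)
  fix e :: real assume e: "0 < e"
  note B = bbound_nonneg[OF g(1)]
  let ?i = "indicator (cball (0::'a) R) :: 'a \<Rightarrow> real"
  have "\<forall>\<^sub>F t in at_top. \<forall>x. \<bar>free.heat t ?i x\<bar> \<le> e / (B + 1)"
    using B e by (intro free_vanishes[OF ball_indicator]) auto
  then obtain t where t: "\<And>x. \<bar>free.heat t ?i x\<bar> \<le> e / (B + 1)"
    unfolding eventually_at_top_linorder by blast
  have c1: "bbound (\<lambda>x. c * 1) (\<bar>c\<bar> * 1)" by (rule bbound_cmult) (use bbound_const[of 1] in simp)
  have b1: "bbound (\<lambda>x. B * ?i x) (\<bar>B\<bar> * 1)" by (rule bbound_cmult[OF ball_indicator(2)])
  have "g x = kill.heat t g x" by (simp add: kill.heat_fixpoint[OF g(2)])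
  also have "\<dots> \<le> kill.heat t (\<lambda>x. c * 1 + B * ?i x) x"
  proof (rule kill.heat_mono[OF g(1) bbound_add[OF c1 b1]])
    fix x show "g x \<le> c * 1 + B * ?i x"
      using out[of x] bboundD(3)[OF g(1), of x] c by (cases "norm x \<le> R") auto
  qed
  also have "\<dots> = c * kill.heat t (\<lambda>_. 1) x + B * kill.heat t ?i x"
    by (simp only: kill.heat_add[OF c1 b1] kill.heat_cmult)
  also have "\<dots> \<le> c * 1 + B * (e / (B + 1))"
  proof (intro add_mono mult_left_mono)
    show "kill.heat t ?i x \<le> e / (B + 1)"
      using kill_le_free[OF ball_indicator(2), of R t x] t[of x] by simp
  qed (use c B kill.heat_1_le in auto)
  also have "B * (e / (B + 1)) \<le> e" using B e by (simp add: field_simps)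
  finally show "g x \<le> c + e" by simp
qed

text \<open>Applying the killed step to a bounded version of \<open>\<phi>\<close> gives a version for which the equation and the limit at infinity hold at every point. That \<open>\<phi>\<close> is bounded near the hole follows from the equation and local integrability.\<close>

theorem stationary_representative:
  assumes stat: "stationary_solution J H \<phi>" and WH: "W = - H" and H: "bounded H"
  shows "\<phi> \<in> borel_measurable lebesgue"
    and "\<exists>\<psi>. bbound \<psi> 1 \<and> (\<forall>x. 0 \<le> \<psi> x) \<and> kill.step \<psi> = \<psi> \<and> (AE x in lborel. \<phi> x = \<psi> x)
      \<and> (\<forall>e>0. \<exists>R. \<forall>x. R < norm x \<longrightarrow> 1 - \<psi> x \<le> e)"
proof -
  have loc: "set_integrable lebesgue K \<phi>" if "compact K" for K
    using stat that by (auto simp: stationary_solution_def L1_loc_def)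
  show phim: "\<phi> \<in> borel_measurable lebesgue"
  proof (rule borel_measurable_LIMSEQ_real)
    show "(\<lambda>x. indicator (cball 0 (real n)) x *\<^sub>R \<phi> x) \<in> borel_measurable lebesgue" for n
      using loc[of "cball 0 (real n)"] by (auto simp: set_integrable_def)
    fix x
    have "\<forall>\<^sub>F n in sequentially. indicator (cball 0 (real n)) x *\<^sub>R \<phi> x = \<phi> x"
      using eventually_ge_at_top[of "nat \<lceil>norm x\<rceil>"] by eventually_elim (simp add: nat_ceiling_le_eq)
    then show "(\<lambda>n. indicator (cball 0 (real n)) x *\<^sub>R \<phi> x) \<longlonglongrightarrow> \<phi> x" by (rule tendsto_eventually)
  qed
  obtain \<phi>b where fb: "\<phi>b \<in> borel_measurable borel" "AE x in lborel. \<phi> x = \<phi>b x"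
    using borel_representative[OF phim] by blast
  note [measurable] = fb(1)
  have eqW: "AE x in lborel. x \<in> W \<longrightarrow> conv J \<phi> x = \<phi> x" and eqH: "AE x in lborel. x \<notin> W \<longrightarrow> \<phi> x = 0"
    using stat by (auto simp: stationary_solution_def AE_completion_iff WH)
  have lim: "\<exists>R. AE x in lborel. R < norm x \<longrightarrow> \<bar>\<phi> x - 1\<bar> < e" if "0 < e" for e
    using stat that by (auto simp: stationary_solution_def AE_completion_iff)
  have conv_b: "conv J \<phi> x = (LINT y|lborel. J (x - y) * \<phi>b y)" for x
    unfolding conv_def
  proof (rule representative_integral(1))
    have "(\<lambda>y. J (x - y)) \<in> borel_measurable lebesgue" by (rule measurable_completion) simp
    then show "(\<lambda>y. J (x - y) * \<phi> y) \<in> borel_measurable lebesgue" using phim by auto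
    show "AE y in lborel. J (x - y) * \<phi> y = J (x - y) * \<phi>b y" using fb(2) by eventually_elim simp
  qed measurable
  obtain C where C: "C > 0" "bbound J C" using J_bounded by blast
  obtain R where R: "AE x in lborel. R < norm x \<longrightarrow> \<bar>\<phi> x - 1\<bar> < 1" using lim[of 1] by auto
  define I where "I = (LINT y|lborel. indicator (cball 0 (R + 1)) y * \<bar>\<phi>b y\<bar>)"
  have Ii: "integrable lborel (\<lambda>y. indicator (cball 0 (R + 1)) y * \<bar>\<phi>b y\<bar>)"
  proof -
    have L: "integrable lebesgue (\<lambda>y. indicator (cball 0 (R + 1)) y *\<^sub>R \<phi> y)"
      using loc[of "cball 0 (R + 1)"] by (auto simp: set_integrable_def)
    have "integrable lborel (\<lambda>y. indicator (cball 0 (R + 1)) y *\<^sub>R \<phi>b y)"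
    proof (rule representative_integral(2)[THEN iffD1, OF borel_measurable_integrable[OF L] _ _ L])
      show "(\<lambda>y. indicator (cball 0 (R + 1)) y *\<^sub>R \<phi>b y) \<in> borel_measurable borel"
        by (intro borel_measurable_scaleR borel_measurable_indicator fb(1)) auto
      show "AE y in lborel. indicator (cball 0 (R + 1)) y *\<^sub>R \<phi> y = indicator (cball 0 (R + 1)) y *\<^sub>R \<phi>b y"
        using fb(2) by eventually_elim simp
    qed
    from integrable_abs[OF this] show ?thesis by (simp add: abs_mult)
  qed
  \<comment> \<open>The value at a point of the ball only involves the integral over a ball with radius larger by 1.\<close>
  have inner: "\<bar>conv J \<phi> x\<bar> \<le> C * I" if "norm x \<le> R" for x
  proof -
    have dom: "\<bar>J (x - y) * \<phi>b y\<bar> \<le> C * (indicator (cball 0 (R + 1)) y * \<bar>\<phi>b y\<bar>)" for y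
    proof (cases "norm (x - y) \<le> 1")
      case True
      have "norm y \<le> R + 1" using norm_triangle_ineq4[of x "x - y"] True that by simp
      then show ?thesis using bboundD(2)[OF C(2), of "x - y"] by (simp add: abs_mult mult_right_mono)
    next
      case False then show ?thesis using C(1) by (simp add: J_support)
    qed
    show ?thesis
      unfolding conv_b I_def integral_mult_right_zero[symmetric]
    proof (rule Bochner_Integration.integral_abs_bound_integral)
      show "integrable lborel (\<lambda>y. J (x - y) * \<phi>b y)"
        by (rule Bochner_Integration.integrable_bound[OF integrable_mult_right[OF Ii, of C]])
           (use dom in \<open>auto intro: order_trans[OF _ abs_ge_self]\<close>)
    qed (use dom Ii in auto)
  qed
  define B where "B = max 2 (C * I)"
  have bnd: "AE x in lborel. \<bar>\<phi>b x\<bar> \<le> B"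
    using fb(2) eqW eqH R
  proof eventually_elim
    fix x assume a: "\<phi> x = \<phi>b x" "x \<in> W \<longrightarrow> conv J \<phi> x = \<phi> x" "x \<notin> W \<longrightarrow> \<phi> x = 0" "R < norm x \<longrightarrow> \<bar>\<phi> x - 1\<bar> < 1"
    show "\<bar>\<phi>b x\<bar> \<le> B"
    proof (cases "R < norm x")
      case True then show ?thesis using a by (auto simp: B_def)
    next
      case False
      then show ?thesis using a inner[of x] by (cases "x \<in> W") (auto simp: B_def)
    qed
  qed
  have B0: "0 \<le> B" by (simp add: B_def)
  define \<phi>c where "\<phi>c x = max (- B) (min B (\<phi>b x))" for x
  have "\<phi>c \<in> borel_measurable borel" unfolding \<phi>c_def by measurable
  then have cb: "bbound \<phi>c B" using B0 by (auto simp: bbound_def \<phi>c_def abs_le_iff)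
  have cphi: "AE x in lborel. \<phi>c x = \<phi> x"
    using bnd fb(2) by eventually_elim (auto simp: \<phi>c_def abs_le_iff)
  define \<psi> where "\<psi> = kill.step \<phi>c"
  have pb: "bbound \<psi> B" unfolding \<psi>_def by (rule kill.bbound_step[OF cb])
  note cm = bboundD(1)[OF cb] and pm = bboundD(1)[OF pb]
  have conv_c: "conv J \<phi> = free.step (\<lambda>y. indicator W y * \<phi>c y)"
  proof
    fix x
    show "conv J \<phi> x = free.step (\<lambda>y. indicator W y * \<phi>c y) x"
      unfolding conv_b free.step_def
    proof (rule integral_cong_AE)
      show "AE y in lborel. J (x - y) * \<phi>b y = J (x - y) * (indicator W y * \<phi>c y)"
        using fb(2) cphi eqH by eventually_elim (auto simp: indicator_def)
    qed (use cm in measurable)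
  qed
  have psi_phi: "AE x in lborel. \<phi> x = \<psi> x"
    using eqW eqH by eventually_elim (auto simp: \<psi>_def kill_step_eq conv_c)
  have fix_psi: "kill.step \<psi> = \<psi>"
  proof -
    have "kill.step \<psi> = kill.step \<phi>c"
      by (rule kill.step_cong_AE[OF pm cm]) (use psi_phi cphi in eventually_elim, simp)
    then show ?thesis by (simp add: \<psi>_def)
  qed
  obtain RH where RH: "\<And>x. x \<in> H \<Longrightarrow> norm x \<le> RH" using H unfolding bounded_iff by blast
  have limp: "\<exists>R. \<forall>x. R < norm x \<longrightarrow> \<bar>\<psi> x - 1\<bar> \<le> e" if e: "0 < e" for e
  proof -
    obtain R where R: "AE x in lborel. R < norm x \<longrightarrow> \<bar>\<phi> x - 1\<bar> < e" using lim[OF e] by auto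
    have "\<bar>\<psi> x - 1\<bar> \<le> e" if x: "max R RH + 1 < norm x" for x
    proof -
      have xW: "x \<in> W" using RH[of x] x WH by auto
      have wb: "bbound (\<lambda>y. indicator W y * \<psi> y) (1 * B)"
        by (rule bbound_mult[OF bbound_indicator[OF W_borel] pb])
      have "\<psi> x - 1 = free.step (\<lambda>y. indicator W y * \<psi> y) x - free.step (\<lambda>_. 1) x"
        using fun_cong[OF fix_psi, of x] xW by (simp add: kill_step_eq free_step_1)
      also have "\<dots> = free.step (\<lambda>y. indicator W y * \<psi> y - 1) x"
        by (rule free.step_diff[OF wb bbound_const, symmetric])
      finally have eq: "\<psi> x - 1 = (LINT y|lborel. J (x - y) * (indicator W y * \<psi> y - 1))"
        by (simp add: free.step_def)
      have "\<bar>LINT y|lborel. J (x - y) * (indicator W y * \<psi> y - 1)\<bar> \<le> (LINT y|lborel. \<bar>J (x - y) * (indicator W y * \<psi> y - 1)\<bar>)"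
        by (rule integral_abs_bound)
      also have "\<dots> \<le> (LINT y|lborel. e * J (x - y))"
      proof (rule integral_mono_AE)
        show "integrable lborel (\<lambda>y. \<bar>J (x - y) * (indicator W y * \<psi> y - 1)\<bar>)"
          by (rule integrable_abs[OF free.integrable_step[OF bbound_diff[OF wb bbound_const]]])
        show "integrable lborel (\<lambda>y. e * J (x - y))" using J_shift_integrable by simp
        show "AE y in lborel. \<bar>J (x - y) * (indicator W y * \<psi> y - 1)\<bar> \<le> e * J (x - y)"
          using R psi_phi
        proof eventually_elim
          fix y assume a: "R < norm y \<longrightarrow> \<bar>\<phi> y - 1\<bar> < e" "\<phi> y = \<psi> y"
          show "\<bar>J (x - y) * (indicator W y * \<psi> y - 1)\<bar> \<le> e * J (x - y)"
          proof (cases "norm (x - y) \<le> 1")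
            case True
            have "norm x \<le> norm y + 1" using norm_triangle_ineq[of "x - y" y] True by simp
            then have "R < norm y" "y \<in> W" using x RH[of y] WH by auto
            then show ?thesis using a by (simp add: abs_mult J_nonneg mult.commute[of e] mult_left_mono)
          qed (simp add: J_support)
        qed
      qed
      also have "\<dots> = e" by (simp add: J_shift_mass)
      finally show ?thesis unfolding eq .
    qed
    then show ?thesis by blast
  qed
  have nn: "0 \<le> \<psi> x" for x
  proof -
    obtain R where R: "\<And>x. R < norm x \<Longrightarrow> \<bar>\<psi> x - 1\<bar> \<le> 1" using limp[of 1] by auto
    have "bbound (\<lambda>x. - 1 * \<psi> x) (\<bar>- 1\<bar> * B)" by (rule bbound_cmult[OF pb])
    moreover have "kill.step (\<lambda>x. - 1 * \<psi> x) = (\<lambda>x. - 1 * \<psi> x)"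
      by (intro ext) (simp only: kill.step_cmult fix_psi)
    ultimately have "- 1 * \<psi> x \<le> 0"
    proof (rule fixpoint_le[where R=R])
      show "- 1 * \<psi> x \<le> 0" if "R < norm x" for x using R[OF that] by (simp add: abs_le_iff)
    qed simp
    then show ?thesis by simp
  qed
  have le1: "\<psi> x \<le> 1" for x
  proof (rule field_le_epsilon)
    fix e :: real assume e: "0 < e"
    obtain R where R: "\<And>x. R < norm x \<Longrightarrow> \<bar>\<psi> x - 1\<bar> \<le> e" using limp[OF e] by auto
    show "\<psi> x \<le> 1 + e"
    proof (rule fixpoint_le[OF pb fix_psi, where R=R])
      show "\<psi> x \<le> 1 + e" if "R < norm x" for x using R[OF that] by linarith
    qed (use e in simp)
  qed
  have "bbound \<psi> 1" using pm nn le1 by (auto simp: bbound_def)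
  moreover have "\<forall>e>0. \<exists>R. \<forall>x. R < norm x \<longrightarrow> 1 - \<psi> x \<le> e"
    using limp by (simp add: abs_le_iff) blast
  ultimately show "\<exists>\<psi>. bbound \<psi> 1 \<and> (\<forall>x. 0 \<le> \<psi> x) \<and> kill.step \<psi> = \<psi> \<and> (AE x in lborel. \<phi> x = \<psi> x)
      \<and> (\<forall>e>0. \<exists>R. \<forall>x. R < norm x \<longrightarrow> 1 - \<psi> x \<le> e)"
    using nn fix_psi psi_phi by blast
qed

end

section \<open>Asymptotics of the killed semigroup\<close>

lemma eventually_at_top_shift:
  fixes c :: real
  assumes "eventually P at_top" shows "\<forall>\<^sub>F t in at_top. P (t - c)"
  using filterlim_tendsto_add_at_top[OF tendsto_const[of "- c"] filterlim_ident] assms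
  by (simp add: filterlim_iff)

lemma eventually_at_top_half:
  assumes "eventually P at_top" shows "\<forall>\<^sub>F t::real in at_top. P (t / 2)"
proof -
  have "filterlim (\<lambda>t::real. t / 2) at_top at_top" by real_asymp
  then show ?thesis using assms by (simp add: filterlim_iff)
qed

lemma powr_half: "0 \<le> t \<Longrightarrow> t powr p = 2 powr p * (t / 2) powr p" for t :: real
  using powr_mult[of 2 "t / 2" p] by simp

context radial_density
begin

definition hk :: "'a \<Rightarrow> real \<Rightarrow> real" where
  "hk = heat_kernel (diffusivity J)"

definition hk_peak :: real where
  "hk_peak = (4 * pi * diffusivity J) powr (- (real DIM('a) / 2))"

lemma hk_peak_nonneg: "0 \<le> hk_peak"
  by (simp add: hk_peak_def)

lemma hk_normalised:
  assumes "0 < t"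
  shows "t powr (real DIM('a) / 2) * hk x t = hk_peak * exp (- ((norm x)\<^sup>2 / (4 * diffusivity J * t)))"
proof -
  have "(4 * pi * diffusivity J * t) powr (- real DIM('a) / 2) = hk_peak * t powr (- (real DIM('a) / 2))"
    unfolding hk_peak_def using assms diffusivity_pos by (subst powr_mult) auto
  moreover have "t powr (real DIM('a) / 2) * t powr (- (real DIM('a) / 2)) = 1"
    using assms by (simp add: powr_add[symmetric])
  ultimately show ?thesis by (simp add: hk_def heat_kernel_def mult_ac)
qed

lemma hk_nonneg: "0 \<le> hk x t"
  by (simp add: hk_def heat_kernel_nonneg)

lemma hk_normalised_le: "0 < t \<Longrightarrow> t powr (real DIM('a) / 2) * hk x t \<le> hk_peak"
  unfolding hk_normalised using diffusivity_pos by (intro mult_right_le_one_le hk_peak_nonneg) auto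

lemma hk_locally_flat:
  assumes "0 < d"
  shows "\<forall>\<^sub>F t in at_top. \<forall>x. norm x \<le> \<rho> \<longrightarrow> \<bar>t powr (real DIM('a) / 2) * hk x t - hk_peak\<bar> \<le> d"
proof -
  let ?b = "\<lambda>t. hk_peak * (\<rho>\<^sup>2 / (4 * diffusivity J * t))"
  have "(?b \<longlongrightarrow> 0) at_top"
  proof -
    have "((\<lambda>t. (hk_peak * \<rho>\<^sup>2 / (4 * diffusivity J)) * (1 / t)) \<longlongrightarrow> (hk_peak * \<rho>\<^sup>2 / (4 * diffusivity J)) * 0) at_top"
      by (rule tendsto_mult[OF tendsto_const]) real_asymp
    then show ?thesis by simp
  qed
  then have "\<forall>\<^sub>F t in at_top. ?b t < d" using assms by (rule order_tendstoD)
  then show ?thesis using eventually_gt_at_top[of "0::real"]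
  proof (eventually_elim, intro allI impI)
    fix t :: real and x :: 'a assume b: "?b t < d" and t: "0 < t" and x: "norm x \<le> \<rho>"
    let ?s = "(norm x)\<^sup>2 / (4 * diffusivity J * t)"
    have s: "0 \<le> ?s" using t diffusivity_pos by simp
    have "1 - exp (- ?s) \<le> ?s" using exp_ge_add_one_self[of "- ?s"] by linarith
    also have "?s \<le> \<rho>\<^sup>2 / (4 * diffusivity J * t)"
      using x t diffusivity_pos by (intro divide_right_mono power_mono) auto
    finally have "hk_peak * (1 - exp (- ?s)) \<le> ?b t" by (rule mult_left_mono) (rule hk_peak_nonneg)
    moreover have "0 \<le> hk_peak * (1 - exp (- ?s))" using s by (intro mult_nonneg_nonneg hk_peak_nonneg) auto
    ultimately show "\<bar>t powr (real DIM('a) / 2) * hk x t - hk_peak\<bar> \<le> d"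
      unfolding hk_normalised[OF t] using b by (simp add: right_diff_distrib)
  qed
qed

lemma free_heat_mass: "integrable lborel f \<Longrightarrow> bbound f B \<Longrightarrow> (LINT x|lborel. free.heat t f x) = (LINT x|lborel. f x)"
  by (rule free.heat_mass[OF free_step_1])

lemma powr_shift_le:
  fixes t K p :: real
  assumes "0 \<le> p" "0 < K" "2 * K \<le> t"
  shows "t powr p \<le> 2 powr p * (t - K) powr p"
proof -
  have "t powr p \<le> (2 * (t - K)) powr p" using assms by (intro powr_mono2) auto
  also have "\<dots> = 2 powr p * (t - K) powr p" using assms by (subst powr_mult) auto
  finally show ?thesis .
qed

text \<open>A bounded shift of time does not matter for the heat kernel (\<open>hk_shift\<close>). This is read off from the local limit
  theorem: \<open>S(t) J\<close> and \<open>S(t - K) (S(K) J)\<close> are the same function, and the theorem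
  compares it with the kernel at either time.\<close>

lemma free_local_limit_eventually:
  assumes f: "integrable lborel f" "bbound f B" and e: "0 < e"
  shows "\<forall>\<^sub>F t in at_top. \<forall>x. t powr (real DIM('a) / 2) * \<bar>free.heat t f x - (LINT y|lborel. f y) * hk x t\<bar> \<le> e"
proof -
  obtain b where b: "(b \<longlongrightarrow> 0) at_top" "\<And>t x. 0 < t \<Longrightarrow> t powr (real DIM('a) / 2) *
    \<bar>free.heat t f x - (LINT y|lborel. f y) * heat_kernel (diffusivity J) x t\<bar> \<le> b t"
    using free_local_limit[OF f] by blast
  have "\<forall>\<^sub>F t in at_top. b t < e" using b(1) e by (rule order_tendstoD)
  then show ?thesis using eventually_gt_at_top[of "0::real"]
  proof (eventually_elim, intro allI)
    fix t x assume "b t < e" "0 < t"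
    then show "t powr (real DIM('a) / 2) * \<bar>free.heat t f x - (LINT y|lborel. f y) * hk x t\<bar> \<le> e"
      using b(2)[of t x] unfolding hk_def by linarith
  qed
qed

lemma free_local_limit_early:
  assumes f: "integrable lborel f" "bbound f B" and e: "0 < e" and K: "0 < K"
  shows "\<forall>\<^sub>F t in at_top. \<forall>x. t powr (real DIM('a) / 2) * \<bar>free.heat (t - K) f x - (LINT y|lborel. f y) * hk x (t - K)\<bar> \<le> e"
proof -
  let ?p = "real DIM('a) / 2"
  have "\<forall>\<^sub>F t in at_top. \<forall>x. (t - K) powr ?p * \<bar>free.heat (t - K) f x - (LINT y|lborel. f y) * hk x (t - K)\<bar> \<le> e / 2 powr ?p"
    using e by (intro eventually_at_top_shift free_local_limit_eventually[OF f]) auto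
  then show ?thesis using eventually_ge_at_top[of "2 * K"]
  proof (eventually_elim, intro allI)
    fix t x
    let ?d = "\<bar>free.heat (t - K) f x - (LINT y|lborel. f y) * hk x (t - K)\<bar>"
    assume "\<forall>x. (t - K) powr ?p * \<bar>free.heat (t - K) f x - (LINT y|lborel. f y) * hk x (t - K)\<bar> \<le> e / 2 powr ?p" and t: "2 * K \<le> t"
    then have 1: "(t - K) powr ?p * ?d \<le> e / 2 powr ?p" by blast
    have "t powr ?p * ?d \<le> (2 powr ?p * (t - K) powr ?p) * ?d"
      using K t by (intro mult_right_mono powr_shift_le) auto
    also have "\<dots> \<le> 2 powr ?p * (e / 2 powr ?p)"
      unfolding mult.assoc using 1 by (rule mult_left_mono) simp
    finally show "t powr ?p * ?d \<le> e" by simp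
  qed
qed

lemma hk_shift:
  assumes K: "0 < K" and e: "0 < e"
  shows "\<forall>\<^sub>F t in at_top. \<forall>x. t powr (real DIM('a) / 2) * \<bar>hk x (t - K) - hk x t\<bar> \<le> e"
proof -
  let ?p = "real DIM('a) / 2"
  obtain C where C: "bbound J C" using J_bounded by blast
  note KJ = free.integrable_heat[OF J_integrable C, of K] free.bbound_heat[OF C, of K]
  have "\<forall>\<^sub>F t in at_top. \<forall>x. t powr ?p * \<bar>free.heat (t - K) (free.heat K J) x - (LINT y|lborel. free.heat K J y) * hk x (t - K)\<bar> \<le> e / 2"
    using e by (intro free_local_limit_early[OF KJ] K) auto
  moreover have "\<forall>\<^sub>F t in at_top. \<forall>x. t powr ?p * \<bar>free.heat t J x - (LINT y|lborel. J y) * hk x t\<bar> \<le> e / 2"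
    using e by (intro free_local_limit_eventually[OF J_integrable C]) auto
  ultimately show ?thesis using eventually_gt_at_top[of K]
  proof (eventually_elim, intro allI)
    fix t x
    assume 1: "\<forall>x. t powr ?p * \<bar>free.heat (t - K) (free.heat K J) x - (LINT y|lborel. free.heat K J y) * hk x (t - K)\<bar> \<le> e / 2"
      and 2: "\<forall>x. t powr ?p * \<bar>free.heat t J x - (LINT y|lborel. J y) * hk x t\<bar> \<le> e / 2" and t: "K < t"
    have sg: "free.heat (t - K) (free.heat K J) x = free.heat t J x"
      using free.heat_semigroup[OF _ K C, of "t - K" x] t by simp
    have "\<bar>hk x (t - K) - hk x t\<bar> \<le> \<bar>free.heat t J x - hk x (t - K)\<bar> + \<bar>free.heat t J x - hk x t\<bar>" by linarith
    then have "t powr ?p * \<bar>hk x (t - K) - hk x t\<bar> \<le> t powr ?p * (\<bar>free.heat t J x - hk x (t - K)\<bar> + \<bar>free.heat t J x - hk x t\<bar>)"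
      by (rule mult_left_mono) auto
    also have "\<dots> \<le> e / 2 + e / 2"
      unfolding distrib_left using 1[rule_format, of x] 2[rule_format, of x]
      by (intro add_mono) (simp_all add: sg free_heat_mass[OF J_integrable C] J_mass)
    finally show "t powr ?p * \<bar>hk x (t - K) - hk x t\<bar> \<le> e" by simp
  qed
qed

text \<open>A jump has length at most 1, so that the walk moves at most as far as its number of jumps.\<close>

lemma steps_far_zero: "norm x + real n \<le> \<rho> \<Longrightarrow> (free.step ^^ n) (indicator (- cball 0 \<rho>)) x = 0"
proof (induction n arbitrary: x)
  case 0
  then show ?case by simp
next
  case (Suc n)
  have "J (x - y) * (free.step ^^ n) (indicator (- cball 0 \<rho>)) y = 0" for y
  proof (cases "norm (x - y) \<le> 1")
    case True
    have "norm y \<le> norm x + 1" using norm_triangle_ineq4[of x "x - y"] True by simp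
    then show ?thesis using Suc by simp
  qed (simp add: J_support)
  then have "(LINT y|lborel. J (x - y) * (free.step ^^ n) (indicator (- cball 0 \<rho>)) y) = 0" by (simp only: integral_zero)
  then show ?case by (simp add: free.step_def[of "(free.step ^^ n) _"])
qed

lemma free_heat_tail:
  assumes "0 < e"
  shows "\<exists>\<rho>. \<forall>x. norm x \<le> R \<longrightarrow> free.heat K (indicator (- cball 0 \<rho>)) x \<le> e"
proof -
  let ?P = "measure_pmf (poisson_pmf K)"
  have "(\<lambda>n. measure ?P {n<..}) \<longlonglongrightarrow> measure ?P (\<Inter>n. {n<..})"
    by (intro measure_pmf.finite_Lim_measure_decseq) (auto simp: decseq_def)
  moreover have "(\<Inter>n::nat. {n<..}) = {}" by auto
  ultimately have "(\<lambda>n. measure ?P {n<..}) \<longlonglongrightarrow> 0" by simp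
  then have "\<forall>\<^sub>F n in sequentially. measure ?P {n<..} < e" using assms by (rule order_tendstoD)
  then obtain N where N: "measure ?P {N<..} < e" unfolding eventually_sequentially by blast
  have b: "bbound (indicator (- cball (0::'a) (R + real N))) 1" by (rule bbound_indicator) auto
  have "free.heat K (indicator (- cball 0 (R + real N))) x \<le> e" if x: "norm x \<le> R" for x
  proof -
    have "free.heat K (indicator (- cball 0 (R + real N))) x \<le> measure_pmf.expectation (poisson_pmf K) (indicator {N<..})"
      unfolding free.heat_def
    proof (rule integral_mono[OF free.integrable_poisson_steps[OF b]])
      show "integrable ?P (indicator {N<..} :: nat \<Rightarrow> real)"
        by (rule measure_pmf.integrable_const_bound[where B=1]) auto
      show "(free.step ^^ n) (indicator (- cball 0 (R + real N))) x \<le> indicator {N<..} n" for n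
        using steps_far_zero[of x n "R + real N"] x bboundD(3)[OF free.bbound_steps[OF b, of n], of x]
        by (cases "n \<le> N") auto
    qed
    then show ?thesis using N by simp
  qed
  then show ?thesis by blast
qed

end

text \<open>The data of the problem after all exceptional null sets have been removed.\<close>

locale killed_problem = killed_walk J W for J :: "'a::euclidean_space \<Rightarrow> real" and W +
  fixes v0 \<psi> :: "'a \<Rightarrow> real" and B :: real
  assumes v0_integrable: "integrable lborel v0" and v0_bound: "bbound v0 B" and v0_nonneg: "0 \<le> v0 x"
    and psi_bound: "bbound \<psi> 1" and psi_nonneg: "0 \<le> \<psi> x" and psi_fix: "kill.step \<psi> = \<psi>"
    and psi_limit: "0 < e \<Longrightarrow> \<exists>R. \<forall>x. R < norm x \<longrightarrow> 1 - \<psi> x \<le> e"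
begin

definition w :: "real \<Rightarrow> 'a \<Rightarrow> real" where "w t = kill.heat t v0"

definition M :: real where "M = (LINT x|lborel. v0 x * \<psi> x)"

lemma w_facts: "integrable lborel (w t)" "bbound (w t) B" "0 \<le> w t x"
  unfolding w_def
  by (rule kill.integrable_heat[OF v0_integrable v0_bound], rule kill.bbound_heat[OF v0_bound], rule kill.heat_nonneg[OF v0_nonneg])

lemma w_semigroup: "0 < s \<Longrightarrow> 0 < t \<Longrightarrow> kill.heat s (w t) x = w (s + t) x"
  unfolding w_def by (rule kill.heat_semigroup[OF _ _ v0_bound])

lemma psi_le_1: "\<psi> x \<le> 1"
  using bboundD(3)[OF psi_bound] .

lemma M_nonneg: "0 \<le> M"
  unfolding M_def by (rule integral_nonneg_AE) (auto intro!: mult_nonneg_nonneg v0_nonneg psi_nonneg)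

lemma psi_le_survival: "\<psi> x \<le> kill.heat t (\<lambda>_. 1) x"
  using kill.heat_mono[OF psi_bound bbound_const[of 1] psi_le_1, of t x] by (simp add: kill.heat_fixpoint[OF psi_fix])

lemma weighted_mass: "(LINT x|lborel. w t x * \<psi> x) = M"
  unfolding w_def M_def kill.heat_symmetric[OF v0_integrable v0_bound psi_bound] kill.heat_fixpoint[OF psi_fix] ..

lemma mass_ge: "M \<le> (LINT x|lborel. w t x)"
  unfolding weighted_mass[of t, symmetric]
  using psi_le_1 w_facts(3) by (intro integral_mono integrable_mult_bbound(1)[OF w_facts(1) psi_bound] w_facts(1) mult_right_le_one_le psi_nonneg) auto

lemma decay: "\<exists>C>0. \<forall>\<^sub>F t in at_top. \<forall>x. t powr (real DIM('a) / 2) * w t x \<le> C"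
proof -
  obtain C where C: "C > 0" and ev: "\<forall>\<^sub>F t in at_top. \<forall>x. t powr (real DIM('a) / 2) * \<bar>free.heat t v0 x\<bar> \<le> C"
    using free_decay[OF v0_integrable v0_bound] by blast
  from ev have "\<forall>\<^sub>F t in at_top. \<forall>x. t powr (real DIM('a) / 2) * w t x \<le> C"
  proof (eventually_elim, intro allI)
    fix t x assume 1: "\<forall>x. t powr (real DIM('a) / 2) * \<bar>free.heat t v0 x\<bar> \<le> C"
    have "w t x \<le> \<bar>free.heat t v0 x\<bar>" unfolding w_def using kill_le_free[OF v0_bound v0_nonneg, of t x] by simp
    from mult_left_mono[OF this, of "t powr (real DIM('a) / 2)"] show "t powr (real DIM('a) / 2) * w t x \<le> C"
      using 1[rule_format, of x] by simp
  qed
  then show ?thesis using C by blast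
qed

text \<open>The mass that is still to be lost is the integral of \<open>w(t) (1 - \<psi>)\<close>. Outside a ball the second factor is small; by symmetry the integral over the ball is that of the data against the killed semigroup of the ball, which tends to 0.\<close>

lemma mass_limit:
  assumes e: "0 < e" shows "\<forall>\<^sub>F t in at_top. (LINT x|lborel. w t x) - M \<le> e"
proof -
  define m0 where "m0 = (LINT x|lborel. v0 x)"
  have m0: "0 \<le> m0" unfolding m0_def by (rule integral_nonneg_AE) (simp add: v0_nonneg)
  define d where "d = e / (2 * (m0 + 1))"
  have d: "0 < d" using e m0 by (simp add: d_def)
  obtain R where R: "\<And>x. R < norm x \<Longrightarrow> 1 - \<psi> x \<le> d" using psi_limit[OF d] by blast
  let ?i = "indicator (cball (0::'a) R) :: 'a \<Rightarrow> real"
  note i = ball_indicator[where R=R]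
  have "\<forall>\<^sub>F t in at_top. \<forall>x. \<bar>free.heat t ?i x\<bar> \<le> d" by (rule free_vanishes[OF i d])
  then show ?thesis
  proof eventually_elim
    fix t assume fv: "\<forall>x. \<bar>free.heat t ?i x\<bar> \<le> d"
    have c: "kill.heat t (\<lambda>_. 1) x \<le> 1" "kill.heat t ?i x \<le> d" for x
      using kill.heat_1_le kill_le_free[OF i(2), of t x] fv[rule_format, of x] by auto
    have wi: "integrable lborel (\<lambda>x. w t x * ?i x)" by (rule integrable_mult_bbound(1)[OF w_facts(1) i(2)])
    have dc: "d * (LINT x|lborel. w t x) + (LINT x|lborel. w t x * ?i x) \<le> d * m0 + d * m0"
    proof (intro add_mono mult_left_mono)
      have "(LINT x|lborel. w t x * 1) = (LINT x|lborel. v0 x * kill.heat t (\<lambda>_. 1) x)"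
        unfolding w_def by (rule kill.heat_symmetric[OF v0_integrable v0_bound bbound_const])
      also have "\<dots> \<le> (LINT x|lborel. v0 x)"
        using c(1) v0_nonneg by (intro integral_mono integrable_mult_bbound(1)[OF v0_integrable kill.bbound_heat[OF bbound_const]]
            v0_integrable mult_right_le_one_le kill.heat_nonneg) auto
      finally show "(LINT x|lborel. w t x) \<le> m0" by (simp add: m0_def)
      have "(LINT x|lborel. w t x * ?i x) = (LINT x|lborel. v0 x * kill.heat t ?i x)"
        unfolding w_def by (rule kill.heat_symmetric[OF v0_integrable v0_bound i(2)])
      also have "\<dots> \<le> (LINT x|lborel. v0 x * d)"
        using c(2) v0_nonneg v0_integrable
        by (intro integral_mono integrable_mult_bbound(1)[OF v0_integrable kill.bbound_heat[OF i(2)]] mult_left_mono) auto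
      finally show "(LINT x|lborel. w t x * ?i x) \<le> d * m0" by (simp add: m0_def mult.commute)
    qed (use d in auto)
    have "(LINT x|lborel. w t x) - M = (LINT x|lborel. w t x - w t x * \<psi> x)"
      unfolding weighted_mass[of t, symmetric]
      by (rule Bochner_Integration.integral_diff[symmetric, OF w_facts(1) integrable_mult_bbound(1)[OF w_facts(1) psi_bound]])
    also have "\<dots> \<le> (LINT x|lborel. d * w t x + w t x * ?i x)"
    proof (rule integral_mono)
      show "integrable lborel (\<lambda>x. w t x - w t x * \<psi> x)"
        by (rule Bochner_Integration.integrable_diff[OF w_facts(1) integrable_mult_bbound(1)[OF w_facts(1) psi_bound]])
      show "integrable lborel (\<lambda>x. d * w t x + w t x * ?i x)" using wi w_facts(1) by auto
      fix x
      have "1 - \<psi> x \<le> d + ?i x" using R[of x] psi_nonneg[of x] d by (cases "norm x \<le> R") auto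
      from mult_left_mono[OF this w_facts(3)[of t x]]
      show "w t x - w t x * \<psi> x \<le> d * w t x + w t x * ?i x" by (simp add: algebra_simps)
    qed
    also have "\<dots> = d * (LINT x|lborel. w t x) + (LINT x|lborel. w t x * ?i x)"
      using wi w_facts(1) by (subst Bochner_Integration.integral_add) auto
    also note dc
    also have "d * m0 + d * m0 \<le> 2 * (d * (m0 + 1))" using d by (simp add: algebra_simps)
    also have "\<dots> = e" using m0 by (simp add: d_def field_simps)
    finally show "(LINT x|lborel. w t x) - M \<le> e" .
  qed
qed

text \<open>The loss between times \<open>K\<close> and \<open>t/2\<close> is small in L1 and the smoothing in the second half of the time turns this into a bound of order \<open>t^(-p)\<close>. The loss in the second half is not small, but it is localised near the hole, like \<open>1 - \<psi>\<close>.\<close>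

lemma outer_limit:
  assumes e: "0 < e"
  shows "\<exists>R. \<forall>\<^sub>F t in at_top. \<forall>x. R < norm x \<longrightarrow> t powr (real DIM('a) / 2) * \<bar>w t x - M * hk x t\<bar> \<le> e"
proof -
  let ?p = "real DIM('a) / 2"
  define q where "q = (2::real) powr ?p"
  have q: "0 < q" by (simp add: q_def)
  obtain C1 where C1: "C1 > 0" and ev1: "\<forall>\<^sub>F t in at_top. \<forall>x. t powr ?p * w t x \<le> C1"
    using decay by blast
  obtain Cs where Cs: "Cs > 0" and ev2: "\<forall>\<^sub>F t in at_top. \<forall>f B x. integrable lborel f \<longrightarrow> bbound f B \<longrightarrow>
    t powr ?p * \<bar>free.heat t f x\<bar> \<le> t powr ?p * ((1 + t) * exp (- t)) * B + Cs * (LINT y|lborel. \<bar>f y\<bar>)"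
    using free_smoothing by blast
  have B: "0 \<le> B" by (rule bbound_nonneg[OF v0_bound])
  define D where "D = q * Cs + hk_peak + 1"
  have D: "0 < D" using q Cs hk_peak_nonneg by (simp add: D_def add_nonneg_pos)
  have "\<forall>\<^sub>F t in at_top. (LINT x|lborel. w t x) - M \<le> e / (4 * D)" using e D by (intro mass_limit) auto
  then have "\<forall>\<^sub>F t in at_top. (LINT x|lborel. w t x) - M \<le> e / (4 * D) \<and> 0 < t"
    using eventually_gt_at_top[of "0::real"] by eventually_elim simp
  then obtain K where K: "0 < K" "(LINT x|lborel. w K x) - M \<le> e / (4 * D)"
    unfolding eventually_at_top_linorder by blast
  define m where "m = (LINT x|lborel. w K x)"
  have m: "0 \<le> m - M" "0 \<le> m" using mass_ge[of K] M_nonneg by (auto simp: m_def)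
  have mu: "(q * Cs + hk_peak) * (m - M) \<le> e / 4"
  proof -
    have "(q * Cs + hk_peak) * (m - M) \<le> D * (m - M)" using m by (intro mult_right_mono) (auto simp: D_def)
    also have "\<dots> \<le> D * (e / (4 * D))" using K(2) D by (intro mult_left_mono) (auto simp: m_def)
    finally show ?thesis using D by simp
  qed
  have "0 < e / (4 * (q * C1))" using e q C1 by simp
  from psi_limit[OF this] obtain R where R: "\<And>x. R < norm x \<Longrightarrow> 1 - \<psi> x \<le> e / (4 * (q * C1))" by blast
  have E3: "\<forall>\<^sub>F t in at_top. t powr ?p * ((1 + t) * exp (- t)) < e / (8 * (q * (B + 1)))"
    using tendsto_powr_exp(2)[of 1 ?p] e q B by (intro order_tendstoD) auto
  have E4: "\<forall>\<^sub>F t in at_top. \<forall>x. t powr ?p * \<bar>free.heat (t - K) (w K) x - m * hk x (t - K)\<bar> \<le> e / 8"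
    using free_local_limit_early[OF w_facts(1,2), of "e / 8" K] e K(1) by (simp add: m_def)
  have E5: "\<forall>\<^sub>F t in at_top. \<forall>x. t powr ?p * \<bar>hk x (t - K) - hk x t\<bar> \<le> e / (8 * (m + 1))"
    using e m by (intro hk_shift K(1)) auto
  have "\<forall>\<^sub>F t in at_top. \<forall>x. R < norm x \<longrightarrow> t powr ?p * \<bar>w t x - M * hk x t\<bar> \<le> e"
    using eventually_at_top_half[OF ev1] eventually_at_top_half[OF ev2] eventually_at_top_half[OF E3] E4 E5
      eventually_gt_at_top[of "2 * K"]
  proof (eventually_elim, intro allI impI)
    fix t and x :: 'a
    assume a1: "\<forall>x. (t / 2) powr ?p * w (t / 2) x \<le> C1"
      and a2: "\<forall>f B x. integrable lborel f \<longrightarrow> bbound f B \<longrightarrow>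
        (t / 2) powr ?p * \<bar>free.heat (t / 2) f x\<bar> \<le> (t / 2) powr ?p * ((1 + t / 2) * exp (- (t / 2))) * B + Cs * (LINT y|lborel. \<bar>f y\<bar>)"
      and a3: "(t / 2) powr ?p * ((1 + t / 2) * exp (- (t / 2))) < e / (8 * (q * (B + 1)))"
      and a4: "\<forall>x. t powr ?p * \<bar>free.heat (t - K) (w K) x - m * hk x (t - K)\<bar> \<le> e / 8"
      and a5: "\<forall>x. t powr ?p * \<bar>hk x (t - K) - hk x t\<bar> \<le> e / (8 * (m + 1))"
      and t: "2 * K < t" and x: "R < norm x"
    define s where "s = t / 2"
    have s: "0 < s" "K < s" "0 < s - K" "0 < t" "s + s = t" using t K(1) by (auto simp: s_def)
    have tp: "t powr ?p = q * s powr ?p" unfolding q_def s_def using s by (intro powr_half) auto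
    have sp: "0 < s powr ?p" using s by simp
    \<comment> \<open>What is killed in the second half of the time.\<close>
    define A where "A = free.heat s (w s) x - w t x"
    have wb: "bbound (w s) (C1 / s powr ?p)"
      using a1 w_facts(3)[of s] bboundD(1)[OF w_facts(2)] sp by (auto simp: bbound_def s_def[symmetric] field_simps)
    have wt: "w t x = kill.heat s (w s) x" using w_semigroup[OF s(1) s(1), of x] s(5) by simp
    have A0: "0 \<le> A" unfolding A_def wt using kill_le_free[OF wb w_facts(3), of s x] by simp
    have A1: "t powr ?p * A \<le> e / 4"
    proof -
      have "A \<le> C1 / s powr ?p * (1 - kill.heat s (\<lambda>_. 1) x)"
        unfolding A_def wt by (rule free_minus_kill_le[OF wb])
      also have "\<dots> \<le> C1 / s powr ?p * (e / (4 * (q * C1)))"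
        using psi_le_survival[of x s] R[OF x] C1 sp by (intro mult_left_mono) auto
      finally have "t powr ?p * A \<le> t powr ?p * (C1 / s powr ?p * (e / (4 * (q * C1))))" by (rule mult_left_mono) simp
      also have "\<dots> = e / 4" unfolding tp using q sp C1 by (simp add: field_simps)
      finally show ?thesis .
    qed
    \<comment> \<open>What is killed in the first half, after time K: small in L1, and then smoothed.\<close>
    define f where "f y = free.heat (s - K) (w K) y - w s y" for y
    have ws: "w s y = kill.heat (s - K) (w K) y" for y using w_semigroup[OF s(3) K(1), of y] by simp
    have f0: "0 \<le> f y" for y unfolding f_def ws using kill_le_free[OF w_facts(2,3), of "s - K" K y] by simp
    note fh = free.bbound_heat[OF w_facts(2), of "s - K" K] free.integrable_heat[OF w_facts(1,2), of "s - K" K]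
    have fb: "bbound f B"
    proof -
      have "f \<in> borel_measurable borel"
        unfolding f_def using bboundD(1)[OF fh(1)] bboundD(1)[OF w_facts(2)] by measurable
      moreover have "f y \<le> B" for y unfolding f_def using bboundD(3)[OF fh(1), of y] w_facts(3)[of s y] by linarith
      ultimately show ?thesis using f0 by (auto simp: bbound_def)
    qed
    have fi: "integrable lborel f" unfolding f_def using fh(2) w_facts(1) by auto
    have fm: "(LINT y|lborel. \<bar>f y\<bar>) \<le> m - M"
    proof -
      have "(LINT y|lborel. \<bar>f y\<bar>) = (LINT y|lborel. f y)" using f0 by simp
      also have "\<dots> = m - (LINT y|lborel. w s y)"
        unfolding f_def m_def using fh(2) w_facts(1) by (simp add: free_heat_mass[OF w_facts(1,2)])
      finally show ?thesis using mass_ge[of s] by simp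
    qed
    have hf: "free.heat s f x = free.heat (t - K) (w K) x - free.heat s (w s) x"
    proof -
      have "free.heat s (free.heat (s - K) (w K)) x = free.heat (t - K) (w K) x"
        using free.heat_semigroup[OF s(1,3) w_facts(2), of K x] s(5) by (simp add: algebra_simps)
      then show ?thesis unfolding f_def[abs_def] free.heat_diff[OF fh(1) w_facts(2)] by simp
    qed
    have F1: "t powr ?p * \<bar>free.heat s f x\<bar> \<le> e / 8 + q * Cs * (m - M)"
    proof -
      have "s powr ?p * \<bar>free.heat s f x\<bar> \<le> s powr ?p * ((1 + s) * exp (- s)) * B + Cs * (LINT y|lborel. \<bar>f y\<bar>)"
        using a2[rule_format, OF fi fb, of x] unfolding s_def .
      also have "\<dots> \<le> e / (8 * (q * (B + 1))) * (B + 1) + Cs * (m - M)"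
        using a3 fm B Cs e q s(1) unfolding s_def[symmetric] by (intro add_mono mult_mono) auto
      also have "e / (8 * (q * (B + 1))) * (B + 1) = e / (8 * q)"
      proof -
        have "e / (8 * (q * b)) * b = e / (8 * q)" if "b \<noteq> 0" for b using that by simp
        then show ?thesis using B by force
      qed
      finally have "q * (s powr ?p * \<bar>free.heat s f x\<bar>) \<le> q * (e / (8 * q) + Cs * (m - M))"
        using q by (intro mult_left_mono) auto
      then show ?thesis unfolding tp using q by (simp add: distrib_left mult.assoc)
    qed
    have E: "\<bar>w t x - M * hk x t\<bar> \<le> A + \<bar>free.heat s f x\<bar> + \<bar>free.heat (t - K) (w K) x - m * hk x (t - K)\<bar>
        + m * \<bar>hk x (t - K) - hk x t\<bar> + (m - M) * hk x t"
    proof -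
      have "m * \<bar>hk x (t - K) - hk x t\<bar> = \<bar>m * hk x (t - K) - m * hk x t\<bar>"
        using m(2) by (simp add: abs_mult right_diff_distrib[symmetric])
      moreover have "(m - M) * hk x t = m * hk x t - M * hk x t" by (simp add: left_diff_distrib)
      moreover have "0 \<le> (m - M) * hk x t" using m(1) hk_nonneg by simp
      ultimately show ?thesis using A0 unfolding hf A_def by linarith
    qed
    have P5: "t powr ?p * (m * \<bar>hk x (t - K) - hk x t\<bar>) \<le> e / 8"
    proof -
      have "m * (t powr ?p * \<bar>hk x (t - K) - hk x t\<bar>) \<le> (m + 1) * (e / (8 * (m + 1)))"
        using a5 m(2) e by (intro mult_mono) auto
      also have "(m + 1) * (e / (8 * (m + 1))) = e / 8" using m(2) by (simp add: field_simps)
      finally show ?thesis by (simp only: mult.left_commute)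
    qed
    have P6: "t powr ?p * ((m - M) * hk x t) \<le> hk_peak * (m - M)"
      using mult_left_mono[OF hk_normalised_le[OF s(4), of x] m(1)] by (simp add: mult_ac)
    have "t powr ?p * \<bar>w t x - M * hk x t\<bar> \<le> t powr ?p * (A + \<bar>free.heat s f x\<bar> + \<bar>free.heat (t - K) (w K) x - m * hk x (t - K)\<bar>
        + m * \<bar>hk x (t - K) - hk x t\<bar> + (m - M) * hk x t)"
      by (rule mult_left_mono[OF E]) simp
    also have "\<dots> \<le> e / 4 + (e / 8 + q * Cs * (m - M)) + e / 8 + e / 8 + hk_peak * (m - M)"
      unfolding distrib_left by (intro add_mono A1 F1 a4[rule_format] P5 P6)
    also have "\<dots> \<le> e" using mu e unfolding distrib_right by linarith
    finally show "t powr ?p * \<bar>w t x - M * hk x t\<bar> \<le> e" .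
  qed
  then show ?thesis by blast
qed

text \<open>The fixed duration \<open>K\<close> is chosen after the inner radius \<open>R1\<close>, and the outer radius \<open>\<rho>\<close> after \<open>K\<close>; the time \<open>t\<close> comes last.\<close>

lemma inner_limit:
  assumes e: "0 < e"
  shows "\<forall>\<^sub>F t in at_top. \<forall>x. norm x \<le> R0 \<longrightarrow> t powr (real DIM('a) / 2) * \<bar>w t x - M * \<psi> x * hk x t\<bar> \<le> e"
proof -
  let ?p = "real DIM('a) / 2"
  define q where "q = (2::real) powr ?p"
  have q: "0 < q" by (simp add: q_def)
  obtain C1 where C1: "C1 > 0" and ev1: "\<forall>\<^sub>F t in at_top. \<forall>x. t powr ?p * w t x \<le> C1"
    using decay by blast
  define c where "c = M * hk_peak"
  have c: "0 \<le> c" using M_nonneg hk_peak_nonneg by (simp add: c_def)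
  define C2 where "C2 = q * C1 + c"
  have C2: "0 \<le> C2" using q C1 c by (simp add: C2_def)
  define d where "d = e / 7"
  have d: "0 < d" using e by (simp add: d_def)
  obtain Ra where Ra: "\<forall>\<^sub>F t in at_top. \<forall>x. Ra < norm x \<longrightarrow> t powr ?p * \<bar>w t x - M * hk x t\<bar> \<le> d / q"
    using outer_limit[of "d / q"] d q by auto
  have "0 < d / (c + 1)" using d c by simp
  from psi_limit[OF this] obtain Rb where Rb: "\<And>x. Rb < norm x \<Longrightarrow> 1 - \<psi> x \<le> d / (c + 1)" by blast
  define R1 where "R1 = max Ra Rb"
  let ?near = "indicator (cball (0::'a) R1) :: 'a \<Rightarrow> real"
  note near = ball_indicator[where R=R1]
  have dC: "0 < d / (C2 + 1)" using d C2 by simp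
  have "\<forall>\<^sub>F t in at_top. (\<forall>x. \<bar>free.heat t ?near x\<bar> \<le> d / (C2 + 1)) \<and> 0 < t"
    using free_vanishes[OF near dC] eventually_gt_at_top[of "0::real"] by eventually_elim simp
  then obtain K where K: "0 < K" "\<And>x. \<bar>free.heat K ?near x\<bar> \<le> d / (C2 + 1)"
    unfolding eventually_at_top_linorder by blast
  obtain \<rho> where rho: "\<And>x. norm x \<le> R0 \<Longrightarrow> free.heat K (indicator (- cball 0 \<rho>)) x \<le> d / (C2 + 1)"
    using free_heat_tail[OF dC] by blast
  let ?far = "indicator (- cball (0::'a) \<rho>) :: 'a \<Rightarrow> real"
  have far: "bbound ?far 1" by (rule bbound_indicator) auto
  have dM: "0 < d / (M + 1)" using d M_nonneg by simp
  show ?thesis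
    using eventually_at_top_shift[OF Ra, of K] eventually_at_top_shift[OF ev1, of K] hk_shift[OF K(1) dM]
      hk_locally_flat[OF dM, of "max \<rho> R0"] eventually_gt_at_top[of "2 * K"]
  proof (eventually_elim, intro allI impI)
    fix t and x :: 'a
    assume a1: "\<forall>x. Ra < norm x \<longrightarrow> (t - K) powr ?p * \<bar>w (t - K) x - M * hk x (t - K)\<bar> \<le> d / q"
      and a2: "\<forall>x. (t - K) powr ?p * w (t - K) x \<le> C1"
      and a3: "\<forall>x. t powr ?p * \<bar>hk x (t - K) - hk x t\<bar> \<le> d / (M + 1)"
      and a4: "\<forall>x. norm x \<le> max \<rho> R0 \<longrightarrow> \<bar>t powr ?p * hk x t - hk_peak\<bar> \<le> d / (M + 1)"
      and t: "2 * K < t" and x: "norm x \<le> R0"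
    have t0: "0 < t" "0 < t - K" using t K(1) by auto
    define T where "T = t powr ?p"
    have T: "0 < T" using t0 by (simp add: T_def)
    have Tle: "T \<le> q * (t - K) powr ?p" unfolding T_def q_def using K(1) t by (intro powr_shift_le) auto
    have Md: "M * (d / (M + 1)) \<le> d" using M_nonneg d by (simp add: field_simps)
    \<comment> \<open>The error at the time t - K, already multiplied by the power of t that belongs to the later time t.\<close>
    define z where "z y = T * w (t - K) y - c * \<psi> y" for y
    define G where "G y = 4 * d * 1 + (C2 * ?near y + C2 * ?far y)" for y
    have b1: "bbound (\<lambda>y. T * w (t - K) y) (\<bar>T\<bar> * B)" by (rule bbound_cmult[OF w_facts(2)])
    have b2: "bbound (\<lambda>y. c * \<psi> y) (\<bar>c\<bar> * 1)" by (rule bbound_cmult[OF psi_bound])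
    have b3: "bbound (\<lambda>y::'a. 4 * d * 1) (\<bar>4 * d\<bar> * \<bar>1\<bar>)" by (rule bbound_cmult[OF bbound_const])
    have b4: "bbound (\<lambda>y. C2 * ?near y) (\<bar>C2\<bar> * 1)" by (rule bbound_cmult[OF near(2)])
    have b5: "bbound (\<lambda>y. C2 * ?far y) (\<bar>C2\<bar> * 1)" by (rule bbound_cmult[OF far])
    have zG: "\<bar>z y\<bar> \<le> G y" for y
    proof -
      have w0: "0 \<le> T * w (t - K) y" using T w_facts(3) by simp
      have "T * w (t - K) y \<le> q * ((t - K) powr ?p * w (t - K) y)"
        using mult_right_mono[OF Tle w_facts(3)[of "t - K" y]] by (simp add: mult.assoc)
      also have "\<dots> \<le> q * C1" using a2 q by (intro mult_left_mono) auto
      finally have w1: "T * w (t - K) y \<le> q * C1" .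
      have p1: "0 \<le> c * \<psi> y" "c * \<psi> y \<le> c" using c psi_nonneg[of y] psi_le_1[of y] by (auto intro: mult_left_le)
      have C2b: "\<bar>z y\<bar> \<le> C2" unfolding z_def C2_def using w0 w1 p1 q C1 by (auto simp: abs_le_iff)
      show ?thesis
      proof (cases "norm y \<le> R1 \<or> \<rho> < norm y")
        case True
        then have "C2 \<le> C2 * ?near y + C2 * ?far y" using C2 by (auto simp: indicator_def)
        then show ?thesis unfolding G_def using C2b d by linarith
      next
        case False
        then have y: "Ra < norm y" "Rb < norm y" "norm y \<le> max \<rho> R0" by (auto simp: R1_def)
        have e1: "T * \<bar>w (t - K) y - M * hk y (t - K)\<bar> \<le> d"
        proof -
          have "T * \<bar>w (t - K) y - M * hk y (t - K)\<bar> \<le> q * ((t - K) powr ?p * \<bar>w (t - K) y - M * hk y (t - K)\<bar>)"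
            using mult_right_mono[OF Tle abs_ge_zero] by (simp add: mult.assoc)
          also have "\<dots> \<le> q * (d / q)" using a1 y(1) q by (intro mult_left_mono) auto
          finally show ?thesis using q by simp
        qed
        have e2: "M * (T * \<bar>hk y (t - K) - hk y t\<bar>) \<le> d"
          using mult_left_mono[OF a3[rule_format, of y] M_nonneg] Md unfolding T_def by linarith
        have e3: "M * \<bar>T * hk y t - hk_peak\<bar> \<le> d"
          using mult_left_mono[OF a4[rule_format, OF y(3)] M_nonneg] Md unfolding T_def by linarith
        have e4: "c * (1 - \<psi> y) \<le> d"
        proof -
          have "c * (1 - \<psi> y) \<le> c * (d / (c + 1))" using Rb[OF y(2)] c by (intro mult_left_mono) auto
          also have "\<dots> \<le> d" using c d by (simp add: field_simps)
          finally show ?thesis .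
        qed
        \<comment> \<open>Replace in turn the solution by the heat kernel, the time t - K by t, the kernel by its peak, and 1 by the profile.\<close>
        have dec: "z y = T * (w (t - K) y - M * hk y (t - K)) + M * (T * (hk y (t - K) - hk y t)) + M * (T * hk y t - hk_peak) + c * (1 - \<psi> y)"
          unfolding z_def c_def by (simp add: algebra_simps)
        have "\<bar>z y\<bar> \<le> \<bar>T * (w (t - K) y - M * hk y (t - K))\<bar> + \<bar>M * (T * (hk y (t - K) - hk y t))\<bar> + \<bar>M * (T * hk y t - hk_peak)\<bar> + \<bar>c * (1 - \<psi> y)\<bar>"
          unfolding dec by linarith
        also have "\<dots> = T * \<bar>w (t - K) y - M * hk y (t - K)\<bar> + M * (T * \<bar>hk y (t - K) - hk y t\<bar>) + M * \<bar>T * hk y t - hk_peak\<bar> + c * (1 - \<psi> y)"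
          using T M_nonneg c psi_le_1[of y] by (simp add: abs_mult)
        also have "\<dots> \<le> 4 * d" using e1 e2 e3 e4 by linarith
        also have "\<dots> \<le> G y" unfolding G_def using C2 by simp
        finally show ?thesis .
      qed
    qed
    have hz: "kill.heat K z x = T * w t x - c * \<psi> x"
      unfolding z_def[abs_def] kill.heat_diff[OF b1 b2] kill.heat_cmult
      using w_semigroup[OF K(1) t0(2), of x] by (simp add: kill.heat_fixpoint[OF psi_fix])
    have "\<bar>kill.heat K z x\<bar> \<le> kill.heat K G x"
      unfolding z_def[abs_def] G_def[abs_def]
      by (rule kill.heat_abs_le[OF bbound_diff[OF b1 b2] bbound_add[OF b3 bbound_add[OF b4 b5]]]) (use zG in \<open>simp only: z_def G_def\<close>)
    also have "\<dots> = 4 * d * kill.heat K (\<lambda>_. 1) x + (C2 * kill.heat K ?near x + C2 * kill.heat K ?far x)"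
      unfolding G_def[abs_def] by (simp only: kill.heat_add[OF b3 bbound_add[OF b4 b5]] kill.heat_add[OF b4 b5] kill.heat_cmult)
    also have "\<dots> \<le> 4 * d * 1 + (C2 * (d / (C2 + 1)) + C2 * (d / (C2 + 1)))"
    proof (intro add_mono mult_left_mono C2 kill.heat_1_le)
      show "kill.heat K ?near x \<le> d / (C2 + 1)" using kill_le_free[OF near(2), of K x] K(2)[of x] by simp
      show "kill.heat K ?far x \<le> d / (C2 + 1)" using kill_le_free[OF far, of K x] rho[OF x] by simp
    qed (use d in simp)
    also have "\<dots> \<le> 6 * d"
    proof -
      have "C2 * (d / (C2 + 1)) \<le> d" using C2 d by (simp add: field_simps)
      then show ?thesis by linarith
    qed
    finally have 1: "\<bar>T * w t x - c * \<psi> x\<bar> \<le> 6 * d" unfolding hz .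
    have 2: "\<bar>M * \<psi> x * (hk_peak - T * hk x t)\<bar> \<le> d"
    proof -
      have "\<bar>hk_peak - T * hk x t\<bar> \<le> d / (M + 1)"
        using a4[rule_format, of x] x unfolding T_def by (simp add: abs_minus_commute)
      then have "M * \<psi> x * \<bar>hk_peak - T * hk x t\<bar> \<le> M * (d / (M + 1))"
        using M_nonneg psi_nonneg[of x] psi_le_1[of x] d by (intro mult_mono) (auto intro: mult_left_le)
      then show ?thesis using Md M_nonneg psi_nonneg[of x] by (simp add: abs_mult)
    qed
    have "T * (w t x - M * \<psi> x * hk x t) = (T * w t x - c * \<psi> x) + M * \<psi> x * (hk_peak - T * hk x t)"
      unfolding c_def by (simp add: algebra_simps)
    then have "\<bar>T * (w t x - M * \<psi> x * hk x t)\<bar> \<le> 7 * d" using 1 2 by linarith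
    then show "t powr ?p * \<bar>w t x - M * \<psi> x * hk x t\<bar> \<le> e"
      using T unfolding T_def[symmetric] by (simp add: abs_mult d_def)
  qed
qed

theorem killed_asymptotics:
  assumes e: "0 < e"
  shows "\<forall>\<^sub>F t in at_top. \<forall>x. t powr (real DIM('a) / 2) * \<bar>w t x - M * \<psi> x * hk x t\<bar> \<le> e"
proof -
  let ?p = "real DIM('a) / 2"
  define c where "c = M * hk_peak"
  have c: "0 \<le> c" using M_nonneg hk_peak_nonneg by (simp add: c_def)
  obtain Ra where Ra: "\<forall>\<^sub>F t in at_top. \<forall>x. Ra < norm x \<longrightarrow> t powr ?p * \<bar>w t x - M * hk x t\<bar> \<le> e / 2"
    using outer_limit[of "e / 2"] e by auto
  have "0 < e / (2 * (c + 1))" using e c by simp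
  from psi_limit[OF this] obtain Rb where Rb: "\<And>x. Rb < norm x \<Longrightarrow> 1 - \<psi> x \<le> e / (2 * (c + 1))" by blast
  show ?thesis
    using Ra inner_limit[OF e, of "max Ra Rb"] eventually_gt_at_top[of "0::real"]
  proof (eventually_elim, intro allI)
    fix t and x :: 'a
    assume a1: "\<forall>x. Ra < norm x \<longrightarrow> t powr ?p * \<bar>w t x - M * hk x t\<bar> \<le> e / 2"
      and a2: "\<forall>x. norm x \<le> max Ra Rb \<longrightarrow> t powr ?p * \<bar>w t x - M * \<psi> x * hk x t\<bar> \<le> e" and t: "0 < t"
    show "t powr ?p * \<bar>w t x - M * \<psi> x * hk x t\<bar> \<le> e"
    proof (cases "norm x \<le> max Ra Rb")
      case True then show ?thesis using a2 by blast
    next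
      case False
      then have x: "Ra < norm x" "Rb < norm x" by auto
      let ?T = "t powr ?p"
      have "M * (?T * hk x t) \<le> c" unfolding c_def by (rule mult_left_mono[OF hk_normalised_le[OF t] M_nonneg])
      then have "M * (?T * hk x t) * (1 - \<psi> x) \<le> (c + 1) * (e / (2 * (c + 1)))"
        using Rb[OF x(2)] psi_le_1[of x] c e by (intro mult_mono) auto
      also have "(c + 1) * (e / (2 * (c + 1))) = e / 2" using c by (simp add: field_simps)
      finally have 1: "M * (?T * hk x t) * (1 - \<psi> x) \<le> e / 2" .
      have n: "0 \<le> M * (?T * hk x t) * (1 - \<psi> x)" using M_nonneg hk_nonneg psi_le_1[of x] by simp
      have "?T * (w t x - M * \<psi> x * hk x t) = ?T * (w t x - M * hk x t) + M * (?T * hk x t) * (1 - \<psi> x)"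
        by (simp add: algebra_simps)
      moreover have "\<bar>?T * (w t x - M * hk x t)\<bar> \<le> e / 2" using a1[rule_format, OF x(1)] by (simp add: abs_mult)
      ultimately have "\<bar>?T * (w t x - M * \<psi> x * hk x t)\<bar> \<le> e" using 1 n by linarith
      then show ?thesis by (simp add: abs_mult)
    qed
  qed
qed

end

section \<open>The theorem\<close>

lemma nonlocal_kernel_radial_density:
  assumes "nonlocal_kernel J" shows "radial_density J"
proof -
  have nn: "\<forall>z. 0 \<le> J z" and sm: "smooth J" and rad: "\<forall>y z. norm y = norm z \<longrightarrow> J y = J z"
    and supp: "closure {z. J z \<noteq> 0} \<subseteq> cball 0 1"
    and J: "integrable lebesgue J" "(LINT z|lebesgue. J z) = 1"
    using assms unfolding nonlocal_kernel_def by - (elim conjE, assumption)+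
  have "C_k 0 J" using sm unfolding smooth_def by (rule spec)
  then have c: "continuous_on UNIV J" by simp
  have m: "J \<in> borel_measurable lborel" using borel_measurable_continuous_onI[OF c] by simp
  show ?thesis
  proof (rule radial_density.intro)
    show "J y = J z" if "norm y = norm z" for y z using rad[rule_format, OF that] .
    show "0 \<le> J z" for z using nn[rule_format] .
    show "integrable lborel J" using J(1) unfolding integrable_completion[OF m] .
    show "(LINT z|lborel. J z) = 1" using J(2) unfolding integral_completion[OF m] .
    show "J z = 0" if "1 < norm z" for z
    proof (rule ccontr)
      assume "J z \<noteq> 0"
      then have "z \<in> closure {z. J z \<noteq> 0}" by (intro subsetD[OF closure_subset]) simp
      then have "z \<in> cball 0 1" using supp by blast
      then show False using that by simp
    qed
  qed (rule c)
qed

lemma bounded_representative: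
  fixes u0 :: "'a::euclidean_space \<Rightarrow> real"
  assumes i: "integrable lebesgue u0" and bd: "esssup lebesgue (\<lambda>x. ereal \<bar>u0 x\<bar>) < \<infinity>"
    and nn: "AE x in lebesgue. 0 \<le> u0 x" and z: "AE x in lebesgue. x \<notin> W \<longrightarrow> u0 x = 0" and W: "W \<in> sets borel"
  shows "\<exists>v0 B. integrable lborel v0 \<and> bbound v0 B \<and> (\<forall>x. 0 \<le> v0 x) \<and> (\<forall>x. x \<notin> W \<longrightarrow> v0 x = 0) \<and> (AE x in lborel. u0 x = v0 x)"
proof -
  obtain g where g: "g \<in> borel_measurable borel" "AE x in lborel. u0 x = g x"
    using borel_representative[OF borel_measurable_integrable[OF i]] by blast
  have "\<exists>B::real. esssup lebesgue (\<lambda>x. ereal \<bar>u0 x\<bar>) \<le> ereal B"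
    using bd by (cases "esssup lebesgue (\<lambda>x. ereal \<bar>u0 x\<bar>)") auto
  then obtain B0 where B0: "esssup lebesgue (\<lambda>x. ereal \<bar>u0 x\<bar>) \<le> ereal B0" by blast
  define B where "B = \<bar>B0\<bar>"
  have "AE x in lebesgue. ereal \<bar>u0 x\<bar> \<le> esssup lebesgue (\<lambda>x. ereal \<bar>u0 x\<bar>)" by (rule esssup_AE)
  then have "AE x in lebesgue. \<bar>u0 x\<bar> \<le> B"
  proof eventually_elim
    fix x assume "ereal \<bar>u0 x\<bar> \<le> esssup lebesgue (\<lambda>x. ereal \<bar>u0 x\<bar>)"
    then have "ereal \<bar>u0 x\<bar> \<le> ereal B0" using B0 order_trans by blast
    then show "\<bar>u0 x\<bar> \<le> B" by (simp add: B_def)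
  qed
  then have ub: "AE x in lborel. \<bar>u0 x\<bar> \<le> B" by (simp add: AE_completion_iff)
  define v0 where "v0 x = indicator W x * max 0 (min B (g x))" for x
  have m: "v0 \<in> borel_measurable borel" unfolding v0_def using g(1) W by measurable
  have B: "0 \<le> B" by (simp add: B_def)
  have ae: "AE x in lborel. u0 x = v0 x"
    using g(2) ub nn[unfolded AE_completion_iff] z[unfolded AE_completion_iff]
    by eventually_elim (auto simp: v0_def indicator_def)
  have "integrable lborel v0"
    using representative_integral(2)[OF borel_measurable_integrable[OF i] m ae] i by simp
  moreover have "bbound v0 B" using m B by (auto simp: bbound_def v0_def indicator_def)
  moreover have "\<forall>x. 0 \<le> v0 x" "\<forall>x. x \<notin> W \<longrightarrow> v0 x = 0" by (auto simp: v0_def)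
  ultimately show ?thesis using ae by blast
qed

text \<open>The bound is required with a threshold in time that is common to almost all points; measurability matters because \<open>esssup\<close> of a function that is not measurable is infinite.\<close>

lemma esssup_tendsto_zero:
  fixes f :: "real \<Rightarrow> 'a::euclidean_space \<Rightarrow> real" and p :: real
  assumes m: "\<And>t. 0 < t \<Longrightarrow> f t \<in> borel_measurable lebesgue"
    and b: "\<And>e. 0 < e \<Longrightarrow> \<forall>\<^sub>F t in at_top. AE x in lebesgue. t powr p * \<bar>f t x\<bar> \<le> e"
  shows "((\<lambda>t. ereal (t powr p) * esssup lebesgue (\<lambda>x. ereal \<bar>f t x\<bar>)) \<longlongrightarrow> 0) at_top"
proof -
  have nn: "0 \<le> esssup lebesgue (\<lambda>x. ereal \<bar>f t x\<bar>)" if t: "0 < t" for t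
  proof -
    have "esssup lebesgue (\<lambda>x::'a. 0::ereal) = 0" by (rule esssup_const) simp
    moreover have "esssup lebesgue (\<lambda>x::'a. 0::ereal) \<le> esssup lebesgue (\<lambda>x. ereal \<bar>f t x\<bar>)"
      by (rule esssup_mono) auto
    ultimately show ?thesis by simp
  qed
  have up: "\<forall>\<^sub>F t in at_top. ereal (t powr p) * esssup lebesgue (\<lambda>x. ereal \<bar>f t x\<bar>) \<le> ereal e" if e: "0 < e" for e
    using b[OF e] eventually_gt_at_top[of "0::real"]
  proof eventually_elim
    fix t :: real assume ae: "AE x in lebesgue. t powr p * \<bar>f t x\<bar> \<le> e" and t: "0 < t"
    have tp: "0 < t powr p" using t by simp
    have fm: "(\<lambda>x. ereal \<bar>f t x\<bar>) \<in> borel_measurable lebesgue" using m[OF t] by auto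
    have "esssup lebesgue (\<lambda>x. ereal \<bar>f t x\<bar>) \<le> ereal (e / t powr p)"
      by (rule esssup_I[OF fm]) (use ae tp in \<open>auto elim!: eventually_mono simp: field_simps\<close>)
    then have "ereal (t powr p) * esssup lebesgue (\<lambda>x. ereal \<bar>f t x\<bar>) \<le> ereal (t powr p) * ereal (e / t powr p)"
      using tp by (intro ereal_mult_left_mono) auto
    also have "\<dots> = ereal e" using tp by simp
    finally show "ereal (t powr p) * esssup lebesgue (\<lambda>x. ereal \<bar>f t x\<bar>) \<le> ereal e" .
  qed
  show ?thesis
  proof (rule order_tendstoI)
    fix a :: ereal assume a: "a < 0"
    show "\<forall>\<^sub>F t in at_top. a < ereal (t powr p) * esssup lebesgue (\<lambda>x. ereal \<bar>f t x\<bar>)"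
      using eventually_gt_at_top[of "0::real"]
    proof eventually_elim
      fix t :: real assume "0 < t"
      then have "0 \<le> ereal (t powr p) * esssup lebesgue (\<lambda>x. ereal \<bar>f t x\<bar>)" using nn by simp
      then show "a < ereal (t powr p) * esssup lebesgue (\<lambda>x. ereal \<bar>f t x\<bar>)" using a by simp
    qed
  next
    fix a :: ereal assume a: "0 < a"
    from ereal_dense2[OF a] obtain e where e: "0 < ereal e" "ereal e < a" by auto
    then have "0 < e" by simp
    from up[OF this] show "\<forall>\<^sub>F t in at_top. ereal (t powr p) * esssup lebesgue (\<lambda>x. ereal \<bar>f t x\<bar>) < a"
      by eventually_elim (use e(2) in simp)
  qed
qed

theorem theorem1p1:
  fixes J :: "real ^ 'n \<Rightarrow> real" and H :: "(real ^ 'n) set"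
    and u0 \<phi> :: "real ^ 'n \<Rightarrow> real" and u :: "real \<Rightarrow> real ^ 'n \<Rightarrow> real"
    and M \<alpha> :: real
  assumes "3 \<le> CARD('n)"
    and "open H" and "bounded H" and "smooth_boundary H" and "0 \<in> H"
    and "nonlocal_kernel J"
    and "integrable lebesgue u0" and "esssup lebesgue (\<lambda>x. ereal \<bar>u0 x\<bar>) < \<infinity>"
    and "AE x in lebesgue. 0 \<le> u0 x"
    and "AE x in lebesgue. x \<in> H \<longrightarrow> u0 x = 0"
    and "nonlocal_solution J H u0 u"
    and "stationary_solution J H \<phi>"
    and "M = (LINT x|lebesgue. u0 x * \<phi> x)"
    and "\<alpha> = diffusivity J"
  shows "((\<lambda>t. ereal (t powr (real CARD('n) / 2)) *
             esssup lebesgue (\<lambda>x. ereal \<bar>u t x - M * \<phi> x * heat_kernel \<alpha> x t\<bar>))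
          \<longlongrightarrow> 0) at_top"
proof -
  interpret radial_density J by (rule nonlocal_kernel_radial_density) fact
  have W: "- H \<in> sets borel" using assms(2) by auto
  interpret killed_walk J "- H" by unfold_locales (rule W)
  have u0H: "AE x in lebesgue. x \<notin> - H \<longrightarrow> u0 x = 0" using assms(10) by simp
  from bounded_representative[OF assms(7,8,9) u0H W] obtain v0 B where
    v0: "integrable lborel v0" "bbound v0 B" "\<And>x. 0 \<le> v0 x" "\<And>x. x \<notin> - H \<Longrightarrow> v0 x = 0" "AE x in lborel. u0 x = v0 x"
    by blast
  note phi_meas = stationary_representative(1)[OF assms(12) refl assms(3)]
  from stationary_representative(2)[OF assms(12) refl assms(3)] obtain \<psi> where
    psi: "bbound \<psi> 1" "\<And>x. 0 \<le> \<psi> x" "kill.step \<psi> = \<psi>" "AE x in lborel. \<phi> x = \<psi> x"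
      "\<And>e. 0 < e \<Longrightarrow> \<exists>R. \<forall>x. R < norm x \<longrightarrow> 1 - \<psi> x \<le> e"
    by blast
  interpret P: killed_problem J "- H" v0 \<psi> B
    by unfold_locales (use v0 psi in auto)
  have M: "M = P.M"
    unfolding assms(13) P.M_def
  proof (rule representative_integral(1))
    show "(\<lambda>x. u0 x * \<phi> x) \<in> borel_measurable lebesgue" using assms(7) phi_meas by auto
    show "(\<lambda>x. v0 x * \<psi> x) \<in> borel_measurable borel" using bboundD(1)[OF v0(2)] bboundD(1)[OF psi(1)] by auto
    show "AE x in lborel. u0 x * \<phi> x = v0 x * \<psi> x" using v0(5) psi(4) by eventually_elim simp
  qed
  show ?thesis
  proof (rule esssup_tendsto_zero)
    fix t :: real assume t: "0 < t"
    have "integrable lebesgue (u t)"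
      using assms(11) t by (auto simp: nonlocal_solution_def L1_continuous_on_def)
    moreover have "(\<lambda>x::real ^ 'n. heat_kernel \<alpha> x t) \<in> borel_measurable lebesgue"
      by (rule measurable_completion) simp
    ultimately show "(\<lambda>x. u t x - M * \<phi> x * heat_kernel \<alpha> x t) \<in> borel_measurable lebesgue"
      using phi_meas by auto
  next
    fix e :: real assume e: "0 < e"
    show "\<forall>\<^sub>F t in at_top. AE x in lebesgue. t powr (real CARD('n) / 2) * \<bar>u t x - M * \<phi> x * heat_kernel \<alpha> x t\<bar> \<le> e"
      using P.killed_asymptotics[OF e] eventually_gt_at_top[of "0::real"]
    proof eventually_elim
      fix t :: real
      assume b: "\<forall>x. t powr (real DIM(real ^ 'n) / 2) * \<bar>P.w t x - P.M * \<psi> x * hk x t\<bar> \<le> e" and t: "0 < t"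
      have "AE x in lborel. u t x = kill.heat t v0 x"
        by (rule solution_is_heat[OF assms(11) refl v0(1,2,5,4) t])
      then show "AE x in lebesgue. t powr (real CARD('n) / 2) * \<bar>u t x - M * \<phi> x * heat_kernel \<alpha> x t\<bar> \<le> e"
        unfolding AE_completion_iff using psi(4)
      proof eventually_elim
        fix x assume "u t x = kill.heat t v0 x" "\<phi> x = \<psi> x"
        then show "t powr (real CARD('n) / 2) * \<bar>u t x - M * \<phi> x * heat_kernel \<alpha> x t\<bar> \<le> e"
          using b[rule_format, of x] by (simp add: P.w_def M hk_def assms(14))
      qed
    qed
  qed
qed

end
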